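(* Let $M$ be a compact oriented $5$-manifold. Define, for a $3$-form $\phi$ on $M$ and a vector field $w$ on $M$, $\mu(\phi)(w)=\frac12\int_M(\phi*\phi)(w)$, where $(\phi*\phi)(w)=\phi\wedge i_w\phi$. Then, restricted to the space $\mathbf{E}$ of exact $3$-forms, $\mu$ is an equivariant moment map for the action of the group $\mathrm{Diff}(M)$ of oriented diffeomorphisms, with respect to the symplectic form $\langle\ ,\ \rangle$: that is, $\mu(f^*\phi)(f^*w)=\mu(\phi)(w)$ for all $f\in\mathrm{Diff}(M)$, and for every vector field $w$ the derivative of $\phi\mapsto\mu(\phi)(w)$ at $\phi\in\mathbf{E}$ in the direction $\delta\phi\in\mathbf{E}$ is $$\delta\mu(w)=\langle L_w\phi,\delta\phi\rangle .$$
   Context: The symplectic form on $\mathbf{E}$ is: for $\psi_1,\psi_2\in\mathbf{E}$ choose a $2$-form $\sigma$ with $\psi_1=d\sigma$ and set $\langle\psi_1,\psi_2\rangle=\int_M\sigma\wedge\psi_2$ (well-defined and skew-symmetric). $\mathrm{Diff}(M)$ acts on forms by pull-back, the infinitesimal action of a vector field $w$ being the Lie derivative $\phi\mapsto L_w\phi$; $f^*w$ is the pulled-back vector field. The expression $\phi*\phi\in\Gamma(T^*M\otimes\Lambda^5T^*M)$ is the quadratic expression coming from the isomorphism $\Lambda^3T^*M\cong\Lambda^2TM\otimes\Lambda^5T^*M$ followed by the contraction $\Lambda^2TM\otimes\Lambda^3T^*M\to T^*M$; it is normalised so that $(\phi*\phi)(w)=\phi\wedge i_w\phi$. *)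

theory Defs
  imports "HOL-Analysis.Analysis"
begin

section \<open>Smooth maps between Euclidean spaces\<close>

primrec n_smooth_on :: "nat \<Rightarrow> 'a::real_normed_vector set \<Rightarrow> ('a \<Rightarrow> 'b::real_normed_vector) \<Rightarrow> bool" where
  "n_smooth_on 0 S g \<longleftrightarrow> continuous_on S g"
| "n_smooth_on (Suc n) S g \<longleftrightarrow>
     (\<forall>x\<in>S. g differentiable (at x)) \<and>
     (\<forall>v. n_smooth_on n S (\<lambda>x. frechet_derivative g (at x) v))"

text \<open>Used on open sets only, where it means of class C-infinity.\<close>
definition smooth_on :: "'a::real_normed_vector set \<Rightarrow> ('a \<Rightarrow> 'b::real_normed_vector) \<Rightarrow> bool" where
  "smooth_on S g \<longleftrightarrow> (\<forall>n. n_smooth_on n S g)"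


section \<open>Compact oriented 5-manifolds\<close>

text \<open>A chart is a pair of a domain and a coordinate map; the values of the coordinate map
  off the domain are irrelevant.\<close>
type_synonym 'm chart = "'m set \<times> ('m \<Rightarrow> real^5)"

definition chart_image :: "'m chart \<Rightarrow> (real^5) set" where
  "chart_image c = snd c ` fst c"

definition chart_inv :: "'m chart \<Rightarrow> real^5 \<Rightarrow> 'm" where
  "chart_inv c = inv_into (fst c) (snd c)"

text \<open>The expression of a map \<open>f\<close> in the charts \<open>c\<close> (source) and \<open>c'\<close> (target), and the set on
  which it is meaningful. For \<open>f = id\<close> this is the coordinate change from \<open>c\<close> to \<open>c'\<close>.\<close>
definition local_rep :: "'m chart \<Rightarrow> 'm chart \<Rightarrow> ('m \<Rightarrow> 'm) \<Rightarrow> real^5 \<Rightarrow> real^5" where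
  "local_rep c c' f = (\<lambda>x. snd c' (f (chart_inv c x)))"

definition local_dom :: "'m chart \<Rightarrow> 'm chart \<Rightarrow> ('m \<Rightarrow> 'm) \<Rightarrow> (real^5) set" where
  "local_dom c c' f = snd c ` {p \<in> fst c. f p \<in> fst c'}"

definition local_deriv :: "'m chart \<Rightarrow> 'm chart \<Rightarrow> ('m \<Rightarrow> 'm) \<Rightarrow> real^5 \<Rightarrow> real^5 \<Rightarrow> real^5" where
  "local_deriv c c' f x = frechet_derivative (local_rep c c' f) (at x)"

text \<open>\<open>M\<close> carries the subspace topology; \<open>A\<close> is an oriented smooth atlas, not necessarily maximal.
  Charts map onto open sets, so there is no boundary.\<close>
definition compact_oriented_5_manifold :: "'m::t2_space set \<Rightarrow> 'm chart set \<Rightarrow> bool" where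
  "compact_oriented_5_manifold M A \<longleftrightarrow>
     compact M \<and>
     (\<Union>c\<in>A. fst c) = M \<and>
     (\<forall>c\<in>A. openin (top_of_set M) (fst c) \<and> open (chart_image c) \<and>
        homeomorphism (fst c) (chart_image c) (snd c) (chart_inv c)) \<and>
     (\<forall>c\<in>A. \<forall>c'\<in>A. smooth_on (local_dom c c' id) (local_rep c c' id) \<and>
        (\<forall>x\<in>local_dom c c' id. det (matrix (local_deriv c c' id x)) > 0))"

definition smooth_map :: "'m::t2_space set \<Rightarrow> 'm chart set \<Rightarrow> ('m \<Rightarrow> 'm) \<Rightarrow> bool" where
  "smooth_map M A f \<longleftrightarrow> f ` M \<subseteq> M \<and> continuous_on M f \<and>
     (\<forall>c\<in>A. \<forall>c'\<in>A. smooth_on (local_dom c c' f) (local_rep c c' f))"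

definition oriented_diffeos :: "'m::t2_space set \<Rightarrow> 'm chart set \<Rightarrow> ('m \<Rightarrow> 'm) set" where
  "oriented_diffeos M A =
     {f. bij_betw f M M \<and> smooth_map M A f \<and> smooth_map M A (inv_into M f) \<and>
         (\<forall>c\<in>A. \<forall>c'\<in>A. \<forall>x\<in>local_dom c c' f. det (matrix (local_deriv c c' f x)) > 0)}"


section \<open>Vector fields and differential forms\<close>

text \<open>A tensor field is the family of its local representatives in the charts of the atlas,
  compatible under coordinate changes. Representatives are set to 0 where they carry no
  information (\<open>c \<notin> A\<close> or \<open>x\<close> outside the image of \<open>c\<close>), so that equality of tensor fields is
  equality of families.

  The arguments of a \<open>k\<close>-form are given as a sequence of vectors of which only the first \<open>k\<close> matter.\<close>
type_synonym 'm vfield = "'m chart \<Rightarrow> real^5 \<Rightarrow> real^5"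
type_synonym 'm dform = "'m chart \<Rightarrow> real^5 \<Rightarrow> (nat \<Rightarrow> real^5) \<Rightarrow> real"

definition vector_fields :: "'m chart set \<Rightarrow> 'm vfield set" where
  "vector_fields A =
     {w. (\<forall>c\<in>A. smooth_on (chart_image c) (w c)) \<and>
         (\<forall>c\<in>A. \<forall>c'\<in>A. \<forall>x\<in>local_dom c c' id.
            w c' (local_rep c c' id x) = local_deriv c c' id x (w c x)) \<and>
         (\<forall>c x. \<not> (c \<in> A \<and> x \<in> chart_image c) \<longrightarrow> w c x = 0)}"

definition alternating_form :: "nat \<Rightarrow> ((nat \<Rightarrow> real^5) \<Rightarrow> real) \<Rightarrow> bool" where
  "alternating_form k \<alpha> \<longleftrightarrow>
     (\<forall>v v'. (\<forall>i<k. v i = v' i) \<longrightarrow> \<alpha> v = \<alpha> v') \<and>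
     (\<forall>v. \<forall>i<k. linear (\<lambda>u. \<alpha> (v(i := u)))) \<and>
     (\<forall>v. \<forall>i<k. \<forall>j<k. i \<noteq> j \<and> v i = v j \<longrightarrow> \<alpha> v = 0)"

definition diff_forms :: "'m chart set \<Rightarrow> nat \<Rightarrow> 'm dform set" where
  "diff_forms A k =
     {\<phi>. (\<forall>c\<in>A. \<forall>x\<in>chart_image c. alternating_form k (\<phi> c x)) \<and>
         (\<forall>c\<in>A. \<forall>v. smooth_on (chart_image c) (\<lambda>x. \<phi> c x v)) \<and>
         (\<forall>c\<in>A. \<forall>c'\<in>A. \<forall>x\<in>local_dom c c' id. \<forall>v.
            \<phi> c x v = \<phi> c' (local_rep c c' id x) (\<lambda>i. local_deriv c c' id x (v i))) \<and>
         (\<forall>c x v. \<not> (c \<in> A \<and> x \<in> chart_image c) \<longrightarrow> \<phi> c x v = 0)}"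

definition wedge :: "nat \<Rightarrow> nat \<Rightarrow> 'm dform \<Rightarrow> 'm dform \<Rightarrow> 'm dform" where
  "wedge p q \<alpha> \<beta> = (\<lambda>c x v.
     (\<Sum>\<pi> | \<pi> permutes {..<p+q}.
        of_int (sign \<pi>) * \<alpha> c x (\<lambda>i. v (\<pi> i)) * \<beta> c x (\<lambda>i. v (\<pi> (p + i))))
     / (fact p * fact q))"

definition interior_product :: "'m vfield \<Rightarrow> 'm dform \<Rightarrow> 'm dform" where
  "interior_product w \<phi> = (\<lambda>c x v. \<phi> c x (case_nat (w c x) v))"

text \<open>The exterior derivative of a \<open>k\<close>-form: in the \<open>i\<close>-th term the vector \<open>v i\<close> is omitted from the
  arguments of the form and used as the direction of differentiation.\<close>
definition ext_deriv :: "'m chart set \<Rightarrow> nat \<Rightarrow> 'm dform \<Rightarrow> 'm dform" where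
  "ext_deriv A k \<phi> = (\<lambda>c x v.
     if c \<in> A \<and> x \<in> chart_image c then
       (\<Sum>i\<le>k. (-1) ^ i *
          frechet_derivative (\<lambda>y. \<phi> c y (\<lambda>j. v (if j < i then j else Suc j))) (at x) (v i))
     else 0)"

text \<open>The Lie derivative of a \<open>k\<close>-form: this is
  \<open>(L\<^sub>w \<phi>)(v\<^sub>0,\<dots>) = w(\<phi>(v\<^sub>0,\<dots>)) - (\<Sum>i<k. \<phi>(v\<^sub>0,\<dots>,[w,v\<^sub>i],\<dots>))\<close> evaluated on vector fields \<open>v\<^sub>i\<close>
  that are constant in the chart, for which \<open>[w,v\<^sub>i] = - Dw(v\<^sub>i)\<close>.\<close>
definition lie_deriv :: "'m chart set \<Rightarrow> nat \<Rightarrow> 'm vfield \<Rightarrow> 'm dform \<Rightarrow> 'm dform" where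
  "lie_deriv A k w \<phi> = (\<lambda>c x v.
     if c \<in> A \<and> x \<in> chart_image c then
       frechet_derivative (\<lambda>y. \<phi> c y v) (at x) (w c x)
       + (\<Sum>i<k. \<phi> c x (v(i := frechet_derivative (w c) (at x) (v i))))
     else 0)"

text \<open>Pull-backs at the point with coordinate \<open>x\<close> in \<open>c\<close> use any chart around its image under \<open>f\<close>;
  by compatibility the choice does not matter.\<close>
definition target_chart :: "'m chart set \<Rightarrow> ('m \<Rightarrow> 'm) \<Rightarrow> 'm chart \<Rightarrow> real^5 \<Rightarrow> 'm chart" where
  "target_chart A f c x = (SOME c'. c' \<in> A \<and> f (chart_inv c x) \<in> fst c')"

definition pullback_form :: "'m chart set \<Rightarrow> ('m \<Rightarrow> 'm) \<Rightarrow> 'm dform \<Rightarrow> 'm dform" where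
  "pullback_form A f \<phi> = (\<lambda>c x v.
     if c \<in> A \<and> x \<in> chart_image c then
       (let c' = target_chart A f c x
        in \<phi> c' (local_rep c c' f x) (\<lambda>i. local_deriv c c' f x (v i)))
     else 0)"

definition pullback_vfield :: "'m chart set \<Rightarrow> ('m \<Rightarrow> 'm) \<Rightarrow> 'm vfield \<Rightarrow> 'm vfield" where
  "pullback_vfield A f w = (\<lambda>c x.
     if c \<in> A \<and> x \<in> chart_image c then
       (let c' = target_chart A f c x
        in inv (local_deriv c c' f x) (w c' (local_rep c c' f x)))
     else 0)"


section \<open>Integration of 5-forms\<close>

definition partition_of_unity ::
    "'m::t2_space set \<Rightarrow> 'm chart set \<Rightarrow> 'm chart set \<Rightarrow> ('m chart \<Rightarrow> 'm \<Rightarrow> real) \<Rightarrow> bool" where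
  "partition_of_unity M A C \<rho> \<longleftrightarrow>
     finite C \<and> C \<subseteq> A \<and>
     (\<forall>c\<in>C. (\<forall>c'\<in>A. smooth_on (chart_image c') (\<lambda>x. \<rho> c (chart_inv c' x))) \<and>
        (\<forall>p\<in>M. \<rho> c p \<ge> 0) \<and>
        M \<inter> closure {p\<in>M. \<rho> c p \<noteq> 0} \<subseteq> fst c) \<and>
     (\<forall>p\<in>M. (\<Sum>c\<in>C. \<rho> c p) = 1)"

text \<open>The \<open>i\<close>-th standard basis vector for \<open>i < 5\<close>; charts are oriented by the ordered basis
  \<open>std_frame 0, \<dots>, std_frame 4\<close>.\<close>
definition std_frame :: "nat \<Rightarrow> real^5" where
  "std_frame i = axis (of_nat i) 1"

definition form_integral :: "'m::t2_space set \<Rightarrow> 'm chart set \<Rightarrow> 'm dform \<Rightarrow> real" where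
  "form_integral M A \<omega> =
     (let P = (SOME P. partition_of_unity M A (fst P) (snd P))
      in \<Sum>c\<in>fst P. integral (chart_image c)
           (\<lambda>x. snd P c (chart_inv c x) * \<omega> c x std_frame))"


section \<open>Exact 3-forms, the symplectic form and the moment map\<close>

definition exact_3_forms :: "'m chart set \<Rightarrow> 'm dform set" where
  "exact_3_forms A = ext_deriv A 2 ` diff_forms A 2"

definition symplectic_pairing ::
    "'m::t2_space set \<Rightarrow> 'm chart set \<Rightarrow> 'm dform \<Rightarrow> 'm dform \<Rightarrow> real" where
  "symplectic_pairing M A \<psi>\<^sub>1 \<psi>\<^sub>2 =
     (let \<sigma> = (SOME \<sigma>. \<sigma> \<in> diff_forms A 2 \<and> \<psi>\<^sub>1 = ext_deriv A 2 \<sigma>)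
      in form_integral M A (wedge 2 3 \<sigma> \<psi>\<^sub>2))"

definition form_star :: "'m dform \<Rightarrow> 'm vfield \<Rightarrow> 'm dform" where
  "form_star \<phi> w = wedge 3 2 \<phi> (interior_product w \<phi>)"

definition moment :: "'m::t2_space set \<Rightarrow> 'm chart set \<Rightarrow> 'm dform \<Rightarrow> 'm vfield \<Rightarrow> real" where
  "moment M A \<phi> w = 1/2 * form_integral M A (form_star \<phi> w)"

end

theory Submission
  imports Defs
begin

text \<open>
  The 5-form \<open>\<phi> \<and> i\<^sub>w\<phi>\<close> is natural: pulling back \<open>\<phi>\<close> and \<open>w\<close> by \<open>f\<close> pulls it back
  (\<open>form_star_pullback\<close>), and an orientation-preserving diffeomorphism does not change the integral of a 5-form
  (\<open>form_integral_pullback\<close>). This is equivariance.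

  For the derivative, \<open>\<phi> \<mapsto> \<phi> \<and> i\<^sub>w\<phi>\<close> is quadratic with polarisation \<open>\<phi> \<and> i\<^sub>w\<delta> + \<delta> \<and> i\<^sub>w\<phi>\<close>. On a 5-manifold
  \<open>\<phi> \<and> \<delta>\<close> vanishes because its degree is 6, and contracting it with \<open>w\<close> shows that the two terms are equal, both to
  \<open>i\<^sub>w\<phi> \<and> \<delta>\<close> (\<open>wedge_interior_product\<close>). Hence the derivative of the moment is the integral of \<open>i\<^sub>w\<phi> \<and> \<delta>\<close>. Since
  \<open>\<phi>\<close> is closed, Cartan's formula (\<open>local_cartan\<close>) gives \<open>L\<^sub>w\<phi> = d(i\<^sub>w\<phi>)\<close>, so \<open>i\<^sub>w\<phi>\<close> is a primitive of
  \<open>L\<^sub>w\<phi>\<close>. The primitive that enters the symplectic pairing may be a different one; the difference of the two is a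
  closed form \<open>\<alpha>\<close>, and for exact \<open>\<delta> = d\<tau>\<close> the form \<open>\<alpha> \<and> d\<tau> = d(\<alpha> \<and> \<tau>)\<close> integrates to 0 by Stokes' theorem
  (\<open>stokes_closed_wedge_exact\<close>).

  The integral refers to an arbitrary smooth partition of unity, whose existence
  (\<open>ex_partition_of_unity\<close>) rests on a smooth bump function and on compactness. Every statement about integrals
  over \<open>M\<close> is reduced to pieces supported in a single chart. There invariance is the change of variables formula, together
  with the fact that alternating 5-forms on \<open>real^5\<close> scale by the determinant (\<open>alternating_5_form_det\<close>), and Stokes'
  theorem says that the derivative of a compactly supported function has integral 0
  (\<open>integral_fd_compact_support\<close>).

  In charts, forms are handled through two facts. One is a chain rule for forms with variable arguments
  (\<open>form_substitution\<close>). The other is the symmetry of second derivatives (\<open>fd_commute\<close>), which yields that \<open>d\<close> commutes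
  with pull-back and that \<open>d \<circ> d = 0\<close>. Wedge products are written as alternations, sums over permutations
  with signs, so that identities between them become reindexings by explicit permutations.
\<close>

section \<open>Calculus of smooth maps\<close>

abbreviation fd :: "('a::real_normed_vector \<Rightarrow> 'b::real_normed_vector) \<Rightarrow> 'a \<Rightarrow> 'a \<Rightarrow> 'b" where
  "fd f x \<equiv> frechet_derivative f (at x)"

lemma fd_eq: "(f has_derivative f') (at x) \<Longrightarrow> fd f x = f'"
  by (metis frechet_derivative_at)

lemma differentiable_cong_open:
  assumes "open S" "x \<in> S" "\<And>y. y \<in> S \<Longrightarrow> f y = g y" "f differentiable (at x)"
  shows "g differentiable (at x)"
  using assms unfolding differentiable_def by (meson has_derivative_transform_within_open)

lemma fd_cong_open:
  assumes "open S" "x \<in> S" "\<And>y. y \<in> S \<Longrightarrow> f y = g y"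
  shows "fd f x = fd g x"
proof -
  have "(f has_derivative f') (at x) \<longleftrightarrow> (g has_derivative f') (at x)" for f'
    using assms by (metis has_derivative_transform_within_open)
  then show ?thesis by (simp add: frechet_derivative_def)
qed

lemma n_smooth_on_cong:
  assumes "open S" "\<And>x. x \<in> S \<Longrightarrow> f x = g x" "n_smooth_on n S f"
  shows "n_smooth_on n S g"
  using assms(2,3)
proof (induction n arbitrary: f g)
  case 0
  then show ?case by (metis continuous_on_cong n_smooth_on.simps(1))
next
  case (Suc n)
  have "g differentiable (at x)" if "x \<in> S" for x
    using differentiable_cong_open[OF assms(1) that] Suc.prems that by auto
  moreover have "n_smooth_on n S (\<lambda>x. fd g x v)" for v
  proof (rule Suc.IH)
    show "fd f x v = fd g x v" if "x \<in> S" for x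
      using fd_cong_open[OF assms(1) that Suc.prems(1)] by simp
    show "n_smooth_on n S (\<lambda>x. fd f x v)" using Suc.prems by simp
  qed
  ultimately show ?case by simp
qed

lemma n_smooth_on_continuous: "n_smooth_on n S f \<Longrightarrow> continuous_on S f"
  by (cases n) (auto intro!: continuous_at_imp_continuous_on differentiable_imp_continuous_within)

lemma n_smooth_on_SucD: "n_smooth_on (Suc n) S f \<Longrightarrow> n_smooth_on n S f"
proof (induction n arbitrary: f)
  case 0
  then show ?case using n_smooth_on_continuous[of "Suc 0" S f] by simp
next
  case (Suc n)
  from Suc.prems have d: "\<forall>x\<in>S. f differentiable (at x)"
    and s: "\<And>v. n_smooth_on (Suc n) S (\<lambda>x. fd f x v)"
    using n_smooth_on.simps(2)[of "Suc n" S f] by blast+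
  show ?case using d Suc.IH[OF s] n_smooth_on.simps(2)[of n S f] by blast
qed

lemma n_smooth_on_local:
  assumes "\<And>x. x \<in> S \<Longrightarrow> \<exists>T. open T \<and> x \<in> T \<and> n_smooth_on n T f"
  shows "n_smooth_on n S f"
  using assms
proof (induction n arbitrary: f)
  case 0
  have "continuous (at x within S) f" if "x \<in> S" for x
    using 0[OF that] continuous_at_imp_continuous_within
    by (metis continuous_on_eq_continuous_at n_smooth_on.simps(1))
  then show ?case by (simp add: continuous_on_eq_continuous_within)
next
  case (Suc n)
  have "n_smooth_on n S (\<lambda>x. fd f x v)" for v
  proof (rule Suc.IH)
    fix x assume "x \<in> S"
    then obtain T where "open T" "x \<in> T" "n_smooth_on (Suc n) T f" using Suc.prems by blast
    then show "\<exists>T. open T \<and> x \<in> T \<and> n_smooth_on n T (\<lambda>x. fd f x v)"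
      unfolding n_smooth_on.simps by blast
  qed
  moreover have "f differentiable (at x)" if "x \<in> S" for x
    using Suc.prems[OF that] by auto
  ultimately show ?case by simp
qed

lemma n_smooth_on_const: "n_smooth_on n S (\<lambda>x. c)"
  by (induction n arbitrary: c) auto

text \<open>The form in which the following inductions on the order meet \<open>n_smooth_on\<close>: from a formula for the
  derivative, whose pieces are smooth of the order in the induction hypothesis.\<close>
lemma n_smooth_on_SucI:
  assumes "open S" "\<And>x. x \<in> S \<Longrightarrow> (f has_derivative f' x) (at x)"
    and "\<And>v. n_smooth_on n S (\<lambda>x. f' x v)"
  shows "n_smooth_on (Suc n) S f"
proof -
  have "n_smooth_on n S (\<lambda>x. fd f x v)" for v
    by (rule n_smooth_on_cong[OF assms(1) _ assms(3)]) (simp add: fd_eq[OF assms(2)])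
  then show ?thesis using assms(2) unfolding n_smooth_on.simps differentiable_def by blast
qed

lemma n_smooth_on_SucE:
  assumes "n_smooth_on (Suc n) S f"
  shows "\<And>x. x \<in> S \<Longrightarrow> (f has_derivative fd f x) (at x)" "\<And>v. n_smooth_on n S (\<lambda>x. fd f x v)"
  using assms by (auto simp: frechet_derivative_works)

lemma n_smooth_on_add:
  assumes "open S" "n_smooth_on n S f" "n_smooth_on n S g"
  shows "n_smooth_on n S (\<lambda>x. f x + g x)"
  using assms(2,3)
proof (induction n arbitrary: f g)
  case 0
  then show ?case by (simp add: continuous_on_add)
next
  case (Suc n)
  show ?case
    by (rule n_smooth_on_SucI[OF assms(1) has_derivative_add[OF n_smooth_on_SucE(1)[OF Suc.prems(1)]
            n_smooth_on_SucE(1)[OF Suc.prems(2)]]])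
       (auto intro!: Suc.IH n_smooth_on_SucE(2)[OF Suc.prems(1)] n_smooth_on_SucE(2)[OF Suc.prems(2)])
qed

lemma n_smooth_on_bounded_linear:
  assumes "open S" "bounded_linear L" "n_smooth_on n S f"
  shows "n_smooth_on n S (\<lambda>x. L (f x))"
  using assms(3)
proof (induction n arbitrary: f)
  case 0
  then show ?case using assms(2) by (auto intro: bounded_linear.continuous_on)
next
  case (Suc n)
  show ?case
    by (rule n_smooth_on_SucI[OF assms(1) bounded_linear.has_derivative[OF assms(2) n_smooth_on_SucE(1)[OF Suc.prems]]])
       (auto intro!: Suc.IH n_smooth_on_SucE(2)[OF Suc.prems])
qed

lemma n_smooth_on_ident: "n_smooth_on n S (\<lambda>x. x)"
  by (cases n) (auto simp: n_smooth_on_const)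

lemma n_smooth_on_bilinear:
  assumes "open S" "bounded_bilinear h" "n_smooth_on n S f" "n_smooth_on n S g"
  shows "n_smooth_on n S (\<lambda>x. h (f x) (g x))"
  using assms(3,4)
proof (induction n arbitrary: f g)
  case 0
  then show ?case using assms(2) by (auto intro: bounded_bilinear.continuous_on)
next
  case (Suc n)
  note f = Suc.prems(1) and g = Suc.prems(2)
  show ?case
  proof (rule n_smooth_on_SucI[OF assms(1)])
    show "((\<lambda>x. h (f x) (g x)) has_derivative (\<lambda>v. h (f x) (fd g x v) + h (fd f x v) (g x))) (at x)"
      if "x \<in> S" for x
      by (rule bounded_bilinear.FDERIV[OF assms(2) n_smooth_on_SucE(1)[OF f that] n_smooth_on_SucE(1)[OF g that]])
    show "n_smooth_on n S (\<lambda>x. h (f x) (fd g x v) + h (fd f x v) (g x))" for v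
      by (intro n_smooth_on_add assms(1) Suc.IH n_smooth_on_SucD[OF f] n_smooth_on_SucD[OF g]
          n_smooth_on_SucE(2)[OF f] n_smooth_on_SucE(2)[OF g])
  qed
qed

lemma n_smooth_on_sum:
  assumes "open S" "\<And>i. i \<in> I \<Longrightarrow> n_smooth_on n S (f i)"
  shows "n_smooth_on n S (\<lambda>x. \<Sum>i\<in>I. f i x)"
  using assms(2)
  by (induction I rule: infinite_finite_induct)
     (auto intro!: n_smooth_on_add assms(1) simp: n_smooth_on_const)

lemma fd_basis_expansion:
  fixes g :: "'a::euclidean_space \<Rightarrow> 'b::real_normed_vector"
  assumes "g differentiable (at y)"
  shows "fd g y w = (\<Sum>b\<in>Basis. (w \<bullet> b) *\<^sub>R fd g y b)"
proof -
  have l: "linear (fd g y)" using assms by (rule linear_frechet_derivative)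
  have "fd g y w = fd g y (\<Sum>b\<in>Basis. (w \<bullet> b) *\<^sub>R b)"
    by (simp add: euclidean_representation)
  also have "\<dots> = (\<Sum>b\<in>Basis. (w \<bullet> b) *\<^sub>R fd g y b)"
    by (simp add: linear_sum[OF l] linear_scale[OF l])
  finally show ?thesis .
qed

text \<open>By the chain rule the derivative of \<open>g \<circ> f\<close> along a fixed vector has a moving direction in \<open>g\<close>. Expanding that
  direction in the basis brings in only derivatives of \<open>g\<close> along fixed vectors, to which the induction hypothesis applies.\<close>
lemma n_smooth_on_compose:
  fixes f :: "'a::real_normed_vector \<Rightarrow> 'b::euclidean_space" and g :: "'b \<Rightarrow> 'c::real_normed_vector"
  assumes "open S" "f ` S \<subseteq> T" "n_smooth_on n S f" "n_smooth_on n T g"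
  shows "n_smooth_on n S (\<lambda>x. g (f x))"
  using assms(3,4)
proof (induction n arbitrary: g)
  case 0
  then show ?case using assms(2) by (auto intro: continuous_on_compose2)
next
  case (Suc n)
  note f = Suc.prems(1) and g = Suc.prems(2)
  show ?case
  proof (rule n_smooth_on_SucI[OF assms(1)])
    fix x assume x: "x \<in> S"
    then have fx: "f x \<in> T" using assms(2) by blast
    have "((\<lambda>x. g (f x)) has_derivative (\<lambda>v. fd g (f x) (fd f x v))) (at x)"
      by (rule has_derivative_compose[OF n_smooth_on_SucE(1)[OF f x] n_smooth_on_SucE(1)[OF g fx]])
    moreover have "(\<lambda>v. fd g (f x) (fd f x v)) = (\<lambda>v. \<Sum>b\<in>Basis. (fd f x v \<bullet> b) *\<^sub>R fd g (f x) b)"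
      using g fx by (intro ext fd_basis_expansion) simp
    ultimately show "((\<lambda>x. g (f x)) has_derivative (\<lambda>v. \<Sum>b\<in>Basis. (fd f x v \<bullet> b) *\<^sub>R fd g (f x) b)) (at x)"
      by metis
  next
    show "n_smooth_on n S (\<lambda>x. \<Sum>b\<in>Basis. (fd f x v \<bullet> b) *\<^sub>R fd g (f x) b)" for v
      by (intro n_smooth_on_sum assms(1) n_smooth_on_bilinear[OF _ bounded_bilinear_scaleR]
            n_smooth_on_bilinear[OF _ bounded_bilinear_inner] n_smooth_on_const
            Suc.IH n_smooth_on_SucD[OF f] n_smooth_on_SucE(2)[OF f] n_smooth_on_SucE(2)[OF g])
  qed
qed

lemma n_smooth_on_inverse:
  fixes f :: "'a::real_normed_vector \<Rightarrow> real"
  assumes "open S" "\<And>x. x \<in> S \<Longrightarrow> f x \<noteq> 0" "n_smooth_on n S f"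
  shows "n_smooth_on n S (\<lambda>x. inverse (f x))"
  using assms(3)
proof (induction n)
  case 0
  then show ?case using assms(2) by (auto intro: continuous_on_inverse)
next
  case (Suc n)
  show ?case
  proof (rule n_smooth_on_SucI[OF assms(1)])
    show "((\<lambda>x. inverse (f x)) has_derivative (\<lambda>v. - (inverse (f x) * fd f x v * inverse (f x)))) (at x)"
      if "x \<in> S" for x
      by (rule Deriv.has_derivative_inverse[OF assms(2)[OF that] n_smooth_on_SucE(1)[OF Suc.prems that]])
    show "n_smooth_on n S (\<lambda>x. - (inverse (f x) * fd f x v * inverse (f x)))" for v
      by (intro n_smooth_on_bounded_linear[OF assms(1) bounded_linear_minus[OF bounded_linear_ident]]
            n_smooth_on_bilinear[OF assms(1) bounded_bilinear_mult] Suc.IH n_smooth_on_SucD[OF Suc.prems]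
            n_smooth_on_SucE(2)[OF Suc.prems])
  qed
qed

lemma smooth_on_cong: "open S \<Longrightarrow> (\<And>x. x \<in> S \<Longrightarrow> f x = g x) \<Longrightarrow> smooth_on S f \<Longrightarrow> smooth_on S g"
  unfolding smooth_on_def using n_smooth_on_cong by blast

lemma smooth_on_local:
  "(\<And>x. x \<in> S \<Longrightarrow> \<exists>T. open T \<and> x \<in> T \<and> smooth_on T f) \<Longrightarrow> smooth_on S f"
  unfolding smooth_on_def by (meson n_smooth_on_local)

lemma smooth_on_const: "smooth_on S (\<lambda>x. c)"
  by (simp add: smooth_on_def n_smooth_on_const)

lemma smooth_on_ident: "smooth_on S (\<lambda>x. x)"
  by (simp add: smooth_on_def n_smooth_on_ident)

lemma smooth_on_add:
  "open S \<Longrightarrow> smooth_on S f \<Longrightarrow> smooth_on S g \<Longrightarrow> smooth_on S (\<lambda>x. f x + g x)"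
  by (simp add: smooth_on_def n_smooth_on_add)

lemma smooth_on_bounded_linear:
  "open S \<Longrightarrow> bounded_linear L \<Longrightarrow> smooth_on S f \<Longrightarrow> smooth_on S (\<lambda>x. L (f x))"
  by (simp add: smooth_on_def n_smooth_on_bounded_linear)

lemma smooth_on_bilinear:
  "open S \<Longrightarrow> bounded_bilinear h \<Longrightarrow> smooth_on S f \<Longrightarrow> smooth_on S g \<Longrightarrow> smooth_on S (\<lambda>x. h (f x) (g x))"
  by (simp add: smooth_on_def n_smooth_on_bilinear)

lemma smooth_on_mult:
  fixes f g :: "'a::real_normed_vector \<Rightarrow> real"
  shows "open S \<Longrightarrow> smooth_on S f \<Longrightarrow> smooth_on S g \<Longrightarrow> smooth_on S (\<lambda>x. f x * g x)"
  by (rule smooth_on_bilinear[OF _ bounded_bilinear_mult])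

lemma smooth_on_diff:
  "open S \<Longrightarrow> smooth_on S f \<Longrightarrow> smooth_on S g \<Longrightarrow> smooth_on S (\<lambda>x. f x - g x)"
  using smooth_on_add[of S f "\<lambda>x. - g x"]
    smooth_on_bounded_linear[OF _ bounded_linear_minus[OF bounded_linear_ident], of S g] by simp

lemma smooth_on_inner:
  fixes f g :: "'a::real_normed_vector \<Rightarrow> 'b::real_inner"
  shows "open S \<Longrightarrow> smooth_on S f \<Longrightarrow> smooth_on S g \<Longrightarrow> smooth_on S (\<lambda>x. f x \<bullet> g x)"
  by (rule smooth_on_bilinear[OF _ bounded_bilinear_inner])

lemma smooth_on_sum:
  "open S \<Longrightarrow> (\<And>i. i \<in> I \<Longrightarrow> smooth_on S (f i)) \<Longrightarrow> smooth_on S (\<lambda>x. \<Sum>i\<in>I. f i x)"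
  by (simp add: smooth_on_def n_smooth_on_sum)

lemma smooth_on_inverse:
  fixes f :: "'a::real_normed_vector \<Rightarrow> real"
  shows "open S \<Longrightarrow> (\<And>x. x \<in> S \<Longrightarrow> f x \<noteq> 0) \<Longrightarrow> smooth_on S f \<Longrightarrow> smooth_on S (\<lambda>x. inverse (f x))"
  by (simp add: smooth_on_def n_smooth_on_inverse)

lemma smooth_on_compose:
  fixes f :: "'a::real_normed_vector \<Rightarrow> 'b::euclidean_space"
  shows "open S \<Longrightarrow> f ` S \<subseteq> T \<Longrightarrow> smooth_on S f \<Longrightarrow> smooth_on T g \<Longrightarrow> smooth_on S (\<lambda>x. g (f x))"
  unfolding smooth_on_def by (metis n_smooth_on_compose)

lemma smooth_on_differentiable: "smooth_on S f \<Longrightarrow> x \<in> S \<Longrightarrow> f differentiable (at x)"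
  unfolding smooth_on_def by (metis n_smooth_on.simps(2))

lemma smooth_on_has_derivative: "smooth_on S f \<Longrightarrow> x \<in> S \<Longrightarrow> (f has_derivative fd f x) (at x)"
  using smooth_on_differentiable frechet_derivative_works by blast

lemma smooth_on_fd: "smooth_on S f \<Longrightarrow> smooth_on S (\<lambda>x. fd f x v)"
  unfolding smooth_on_def by (metis n_smooth_on.simps(2))

lemma smooth_on_continuous: "smooth_on S f \<Longrightarrow> continuous_on S f"
  unfolding smooth_on_def using n_smooth_on_continuous by blast

text \<open>Apply the mean value theorem along \<open>a\<close> and then along \<open>b\<close>. The left-hand side is symmetric in \<open>a\<close> and \<open>b\<close>,
  which forces the symmetry of second derivatives in the limit \<open>h \<rightarrow> 0\<close>.\<close>
lemma mixed_difference_mean_value: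
  fixes f :: "'a::real_normed_vector \<Rightarrow> real"
  assumes "open S" "smooth_on S f" "h > 0"
    and sub: "\<And>s t. 0 \<le> s \<Longrightarrow> s \<le> h \<Longrightarrow> 0 \<le> t \<Longrightarrow> t \<le> h \<Longrightarrow> x + s *\<^sub>R a + t *\<^sub>R b \<in> S"
  obtains s t where "0 \<le> s" "s \<le> h" "0 \<le> t" "t \<le> h"
    "f (x + h *\<^sub>R a + h *\<^sub>R b) - f (x + h *\<^sub>R a) - f (x + h *\<^sub>R b) + f x
      = h * h * fd (\<lambda>y. fd f y a) (x + s *\<^sub>R a + t *\<^sub>R b) b"
proof -
  define F where "F = (\<lambda>s. f (x + s *\<^sub>R a + h *\<^sub>R b) - f (x + s *\<^sub>R a + 0 *\<^sub>R b))"
  have dline: "((\<lambda>s. g (y + s *\<^sub>R c)) has_derivative (\<lambda>r. r * fd g (y + s *\<^sub>R c) c)) (at s)"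
    if "y + s *\<^sub>R c \<in> S" "smooth_on S g" for g :: "'a \<Rightarrow> real" and y c s
  proof -
    have 1: "((\<lambda>s. y + s *\<^sub>R c) has_derivative (\<lambda>r. r *\<^sub>R c)) (at s)"
      by (auto intro!: derivative_eq_intros)
    have 2: "(g has_derivative fd g (y + s *\<^sub>R c)) (at (y + s *\<^sub>R c))"
      using smooth_on_has_derivative[OF that(2,1)] .
    show ?thesis
      using diff_chain_at[OF 1 2] linear_scale[OF has_derivative_linear[OF 2]]
      by (simp add: o_def)
  qed
  define D where "D s = fd f (x + s *\<^sub>R a + h *\<^sub>R b) a - fd f (x + s *\<^sub>R a + 0 *\<^sub>R b) a" for s
  have "(F has_derivative (\<lambda>r. r * D s)) (at s)" if s: "0 \<le> s" "s \<le> h" for s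
  proof -
    have 1: "x + h *\<^sub>R b + s *\<^sub>R a \<in> S" "x + s *\<^sub>R a \<in> S"
      using sub[OF s, of h] sub[OF s, of 0] assms(3) by (auto simp: algebra_simps)
    show ?thesis unfolding F_def D_def
      using has_derivative_diff[OF dline[OF 1(1) assms(2)] dline[OF 1(2) assms(2)]]
      by (simp add: algebra_simps)
  qed
  then obtain s where "s \<in> {0<..<h}" "F h - F 0 = (h - 0) * D s"
    using mvt_simple[of 0 h F "\<lambda>s r. r * D s"] assms(3) has_derivative_at_withinI
    by (metis atLeastAtMost_iff)
  then have s: "0 < s" "s < h" "F h - F 0 = h * D s" by auto
  define G where "G = (\<lambda>t. fd f (x + s *\<^sub>R a + t *\<^sub>R b) a)"
  have dG: "(G has_derivative (\<lambda>r. r * fd (\<lambda>y. fd f y a) (x + s *\<^sub>R a + t *\<^sub>R b) b)) (at t)"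
    if t: "0 \<le> t" "t \<le> h" for t
    unfolding G_def using dline[OF sub[of s t] smooth_on_fd[OF assms(2)]] s t by auto
  obtain t where t: "t \<in> {0<..<h}" "G h - G 0 = (h - 0) * fd (\<lambda>y. fd f y a) (x + s *\<^sub>R a + t *\<^sub>R b) b"
    using mvt_simple[of 0 h G "\<lambda>t r. r * fd (\<lambda>y. fd f y a) (x + s *\<^sub>R a + t *\<^sub>R b) b"]
      dG assms(3) has_derivative_at_withinI by (metis atLeastAtMost_iff)
  show thesis
  proof (rule that[of s t])
    show "f (x + h *\<^sub>R a + h *\<^sub>R b) - f (x + h *\<^sub>R a) - f (x + h *\<^sub>R b) + f x
      = h * h * fd (\<lambda>y. fd f y a) (x + s *\<^sub>R a + t *\<^sub>R b) b"
      using s(3) t(2) unfolding F_def G_def D_def by simp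
  qed (use s t in auto)
qed

lemma fd_commute_real:
  fixes f :: "'a::real_normed_vector \<Rightarrow> real"
  assumes "open S" "smooth_on S f" "x \<in> S"
  shows "fd (\<lambda>y. fd f y a) x b = fd (\<lambda>y. fd f y b) x a"
proof (rule ccontr)
  define P where "P = (\<lambda>y. fd (\<lambda>y. fd f y a) y b)"
  define Q where "Q = (\<lambda>y. fd (\<lambda>y. fd f y b) y a)"
  assume "\<not> ?thesis"
  then have pos: "dist (P x) (Q x) / 2 > 0" by (simp add: P_def Q_def)
  define e where "e = dist (P x) (Q x) / 2"
  have "isCont P x" "isCont Q x"
    using smooth_on_continuous[OF smooth_on_fd[OF smooth_on_fd[OF assms(2)]]] assms(1,3)
    unfolding P_def Q_def by (auto simp: continuous_on_eq_continuous_at)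
  then obtain d1 d2 where d12: "d1 > 0" "\<And>y. dist y x < d1 \<Longrightarrow> dist (P y) (P x) < e"
    "d2 > 0" "\<And>y. dist y x < d2 \<Longrightarrow> dist (Q y) (Q x) < e"
    using pos[folded e_def] unfolding continuous_at_eps_delta by metis
  obtain d3 where d3: "d3 > 0" "ball x d3 \<subseteq> S" using assms(1,3) by (meson openE)
  define d where "d = min d1 (min d2 d3)"
  \<comment> \<open>The parallelogram with sides \<open>h a\<close>, \<open>h b\<close> then stays within distance \<open>d\<close> of \<open>x\<close>.\<close>
  define h where "h = d / (2 * (norm a + norm b + 1))"
  have d: "d > 0" using d12 d3 by (simp add: d_def)
  have n: "norm a + norm b + 1 > 0" by (smt (verit) norm_ge_zero)
  have h: "h > 0" using d n by (simp add: h_def)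
  have near: "dist (x + s *\<^sub>R a + t *\<^sub>R b) x < d" if "0 \<le> s" "s \<le> h" "0 \<le> t" "t \<le> h" for s t
  proof -
    have "dist (x + s *\<^sub>R a + t *\<^sub>R b) x \<le> s * norm a + t * norm b"
      using that by (simp add: dist_norm norm_triangle_le)
    also have "\<dots> \<le> h * norm a + h * norm b"
      using that by (intro add_mono mult_right_mono) auto
    also have "\<dots> \<le> h * (norm a + norm b + 1)" using h by (simp add: algebra_simps)
    also have "\<dots> = d / 2" using n by (simp add: h_def divide_simps)
    finally show ?thesis using d by simp
  qed
  have S: "x + s *\<^sub>R a + t *\<^sub>R b \<in> S" if "0 \<le> s" "s \<le> h" "0 \<le> t" "t \<le> h" for s t
    using near[OF that] d3 by (auto simp: d_def dist_commute subset_iff)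
  obtain s t where st: "0 \<le> s" "s \<le> h" "0 \<le> t" "t \<le> h"
    "f (x + h *\<^sub>R a + h *\<^sub>R b) - f (x + h *\<^sub>R a) - f (x + h *\<^sub>R b) + f x
      = h * h * P (x + s *\<^sub>R a + t *\<^sub>R b)"
    using mixed_difference_mean_value[OF assms(1,2) h S] unfolding P_def by blast
  have S': "x + s *\<^sub>R b + t *\<^sub>R a \<in> S" if "0 \<le> s" "s \<le> h" "0 \<le> t" "t \<le> h" for s t
    using S[of t s] that by (simp add: algebra_simps)
  obtain s' t' where st': "0 \<le> s'" "s' \<le> h" "0 \<le> t'" "t' \<le> h"
    "f (x + h *\<^sub>R b + h *\<^sub>R a) - f (x + h *\<^sub>R b) - f (x + h *\<^sub>R a) + f x
      = h * h * Q (x + s' *\<^sub>R b + t' *\<^sub>R a)"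
    using mixed_difference_mean_value[OF assms(1,2) h S'] unfolding Q_def by blast
  have "h * h * P (x + s *\<^sub>R a + t *\<^sub>R b) = h * h * Q (x + t' *\<^sub>R a + s' *\<^sub>R b)"
    using st(5) st'(5) by (simp add: algebra_simps)
  then have eq: "P (x + s *\<^sub>R a + t *\<^sub>R b) = Q (x + t' *\<^sub>R a + s' *\<^sub>R b)" using h by simp
  have "dist (P (x + s *\<^sub>R a + t *\<^sub>R b)) (P x) < e"
    using near[OF st(1-4)] by (intro d12) (simp add: d_def)
  moreover have "dist (Q (x + t' *\<^sub>R a + s' *\<^sub>R b)) (Q x) < e"
    using near[of t' s'] st'(1-4) by (intro d12) (simp add: d_def)
  ultimately show False
    using eq dist_triangle[of "P x" "Q x" "P (x + s *\<^sub>R a + t *\<^sub>R b)"]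
      dist_commute[of "P x"] unfolding e_def by simp
qed

lemma fd_commute:
  fixes f :: "'a::real_normed_vector \<Rightarrow> 'b::euclidean_space"
  assumes "open S" "smooth_on S f" "x \<in> S"
  shows "fd (\<lambda>y. fd f y a) x b = fd (\<lambda>y. fd f y b) x a"
proof (rule euclidean_eqI)
  fix i :: 'b assume "i \<in> Basis"
  have inner_fd: "fd (\<lambda>y. g y \<bullet> i) y v = fd g y v \<bullet> i"
    if "g differentiable (at y)" for g :: "'a \<Rightarrow> 'b" and y v
    using fd_eq[OF has_derivative_inner_left[OF that[unfolded frechet_derivative_works]]] by simp
  have si: "smooth_on S (\<lambda>y. f y \<bullet> i)"
    by (intro smooth_on_inner assms smooth_on_const)
  have "fd (\<lambda>y. fd f y a) x b \<bullet> i = fd (\<lambda>y. fd (\<lambda>y. f y \<bullet> i) y a) x b" for a b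
  proof -
    have "fd (\<lambda>y. fd f y a) x b \<bullet> i = fd (\<lambda>y. fd f y a \<bullet> i) x b"
      by (rule inner_fd[symmetric]) (rule smooth_on_differentiable[OF smooth_on_fd[OF assms(2)] assms(3)])
    also have "\<dots> = fd (\<lambda>y. fd (\<lambda>y. f y \<bullet> i) y a) x b"
      using fd_cong_open[OF assms(1,3), of "\<lambda>y. fd f y a \<bullet> i" "\<lambda>y. fd (\<lambda>y. f y \<bullet> i) y a"]
        inner_fd smooth_on_differentiable[OF assms(2)] by simp
    finally show ?thesis .
  qed
  then show "fd (\<lambda>y. fd f y a) x b \<bullet> i = fd (\<lambda>y. fd f y b) x a \<bullet> i"
    using fd_commute_real[OF assms(1) si assms(3), of a b] by simp
qed

section \<open>A smooth function vanishing on the negative half-line\<close>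

text \<open>The functions \<open>t\<^sup>-\<^sup>k exp (-1/t)\<close>, extended by 0 to \<open>t \<le> 0\<close>. The family is treated at once because
  the derivative of a member is a linear combination of members.\<close>
definition flat_exp :: "nat \<Rightarrow> real \<Rightarrow> real" where
  "flat_exp k t = (if t \<le> 0 then 0 else inverse t ^ k / exp (inverse t))"

lemma flat_exp_tendsto_0: "(flat_exp k \<longlongrightarrow> 0) (at 0)"
proof -
  have "((\<lambda>t. inverse t ^ k / exp (inverse t)) \<longlongrightarrow> 0) (at_right (0::real))"
    by (rule filterlim_compose[OF tendsto_power_div_exp_0 filterlim_inverse_at_top_right])
  then have r: "(flat_exp k \<longlongrightarrow> 0) (at_right 0)"
    by (rule Lim_transform_eventually)
       (auto simp: flat_exp_def eventually_at_filter intro!: always_eventually)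
  have l: "(flat_exp k \<longlongrightarrow> 0) (at_left 0)"
    by (rule Lim_transform_eventually[OF tendsto_const])
       (auto simp: flat_exp_def eventually_at_filter intro!: always_eventually)
  show ?thesis using l r by (simp add: filterlim_at_split)
qed

lemma flat_exp_has_derivative:
  "(flat_exp k has_real_derivative flat_exp (k + 2) t - real k * flat_exp (k + 1) t) (at t)"
proof -
  consider "t < 0" | "t = 0" | "t > 0" by linarith
  then show ?thesis
  proof cases
    case 1
    have "((\<lambda>_. 0) has_real_derivative 0) (at t)" by simp
    then have "(flat_exp k has_real_derivative 0) (at t)"
      by (rule has_field_derivative_transform_within_open[where S="{..<0}"])
         (use 1 in \<open>auto simp: flat_exp_def\<close>)
    then show ?thesis using 1 by (simp add: flat_exp_def)
  next
    case 2
    have "((\<lambda>h. (flat_exp k (0 + h) - flat_exp k 0) / h) \<longlongrightarrow> 0) (at 0)"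
      by (rule Lim_transform_eventually[OF flat_exp_tendsto_0[of "k + 1"]])
         (auto simp: flat_exp_def eventually_at_filter divide_simps intro!: always_eventually)
    then show ?thesis using 2 by (simp add: DERIV_def flat_exp_def)
  next
    case 3
    let ?y = "inverse t"
    have "((\<lambda>y. y ^ k * exp (- y)) has_real_derivative
        real k * ?y ^ (k - 1) * exp (- ?y) - ?y ^ k * exp (- ?y)) (at ?y)"
      by (auto intro!: derivative_eq_intros)
    moreover have "(inverse has_real_derivative - (?y * ?y)) (at t)"
      using DERIV_inverse[of t] 3 by (simp add: power2_eq_square)
    ultimately have "((\<lambda>t. inverse t ^ k * exp (- inverse t)) has_real_derivative
        (real k * ?y ^ (k - 1) * exp (- ?y) - ?y ^ k * exp (- ?y)) * - (?y * ?y)) (at t)"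
      by (rule DERIV_chain2)
    moreover have "(real k * ?y ^ (k - 1) * exp (- ?y) - ?y ^ k * exp (- ?y)) * - (?y * ?y) =
        flat_exp (k + 2) t - real k * flat_exp (k + 1) t"
      using 3 by (cases k) (auto simp: flat_exp_def exp_minus divide_inverse algebra_simps)
    ultimately have "((\<lambda>t. inverse t ^ k / exp (inverse t)) has_real_derivative
        flat_exp (k + 2) t - real k * flat_exp (k + 1) t) (at t)"
      by (simp add: exp_minus divide_inverse)
    then show ?thesis
      by (rule has_field_derivative_transform_within_open[where S="{0<..}"])
         (use 3 in \<open>auto simp: flat_exp_def\<close>)
  qed
qed

lemma smooth_on_flat_exp: "smooth_on UNIV (flat_exp k)"
proof -
  have "n_smooth_on n UNIV (flat_exp k)" for n
  proof (induction n arbitrary: k)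
    case 0
    show ?case using DERIV_continuous[OF flat_exp_has_derivative]
      by (simp add: continuous_on_eq_continuous_at)
  next
    case (Suc n)
    show ?case
    proof (rule n_smooth_on_SucI[OF open_UNIV])
      show "(flat_exp k has_derivative (\<lambda>v. (flat_exp (k + 2) t - real k * flat_exp (k + 1) t) * v)) (at t)"
        for t using flat_exp_has_derivative[of k t] by (simp add: has_field_derivative_def)
      have "n_smooth_on n UNIV (\<lambda>t. (flat_exp (k + 2) t + (- real k) * flat_exp (k + 1) t) * v)" for v
        by (intro n_smooth_on_bilinear[OF _ bounded_bilinear_mult] n_smooth_on_add
            n_smooth_on_const Suc.IH open_UNIV)
      then show "n_smooth_on n UNIV (\<lambda>t. (flat_exp (k + 2) t - real k * flat_exp (k + 1) t) * v)" for v
        by simp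
    qed
  qed
  then show ?thesis by (simp add: smooth_on_def)
qed

lemma flat_exp_0_pos: "t > 0 \<Longrightarrow> flat_exp 0 t > 0"
  and flat_exp_0_nonpos: "t \<le> 0 \<Longrightarrow> flat_exp 0 t = 0"
  and flat_exp_0_nonneg: "flat_exp 0 t \<ge> 0"
  by (auto simp: flat_exp_def)

section \<open>Alternating forms on \<open>real^5\<close>\<close>

lemma alt_form_cong:
  assumes "alternating_form k \<alpha>" "\<And>i. i < k \<Longrightarrow> v i = v' i"
  shows "\<alpha> v = \<alpha> v'"
  using assms(1)[unfolded alternating_form_def, THEN conjunct1] assms(2) by metis

lemma alt_form_linear: "alternating_form k \<alpha> \<Longrightarrow> i < k \<Longrightarrow> linear (\<lambda>u. \<alpha> (v(i := u)))"
  by (simp add: alternating_form_def)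

lemma alt_form_eq_0:
  assumes "alternating_form k \<alpha>" "i < k" "j < k" "i \<noteq> j" "v i = v j"
  shows "\<alpha> v = 0"
  using assms(1)[unfolded alternating_form_def, THEN conjunct2, THEN conjunct2] assms(2-) by metis

lemma alt_form_pullback:
  fixes L :: "real^5 \<Rightarrow> real^5"
  assumes "alternating_form k \<alpha>" "linear L"
  shows "alternating_form k (\<lambda>v. \<alpha> (\<lambda>i. L (v i)))"
  unfolding alternating_form_def
proof (intro conjI allI impI)
  fix v i assume i: "i < k"
  have "linear (\<lambda>u. \<alpha> ((\<lambda>j. L (v j))(i := L u)))"
    using linear_compose[OF assms(2) alt_form_linear[OF assms(1) i]] by (simp add: o_def)
  moreover have "(\<lambda>j. L (v j))(i := L u) = (\<lambda>j. L ((v(i := u)) j))" for u by auto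
  ultimately show "linear (\<lambda>u. \<alpha> (\<lambda>j. L ((v(i := u)) j)))" by simp
next
  fix v v' :: "nat \<Rightarrow> real^5" assume "\<forall>i<k. v i = v' i"
  then show "\<alpha> (\<lambda>i. L (v i)) = \<alpha> (\<lambda>i. L (v' i))"
    by (intro alt_form_cong[OF assms(1)]) simp
next
  fix v :: "nat \<Rightarrow> real^5" and i j assume "i < k" "j < k" "i \<noteq> j \<and> v i = v j"
  then show "\<alpha> (\<lambda>i. L (v i)) = 0"
    by (intro alt_form_eq_0[OF assms(1), of i j]) auto
qed

abbreviation slot_swap :: "'a \<Rightarrow> 'a \<Rightarrow> 'a \<Rightarrow> 'a" where
  "slot_swap \<equiv> Transposition.transpose"

lemma alt_form_swap:
  assumes "alternating_form k \<alpha>" "i < k" "j < k" "i \<noteq> j"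
  shows "\<alpha> (\<lambda>l. v (slot_swap i j l)) = - \<alpha> v"
proof -
  define B where "B = (\<lambda>a b. \<alpha> (v(i := a, j := b)))"
  have l1: "linear (\<lambda>a. B a b)" for b
    using alt_form_linear[OF assms(1,2), of "v(j := b)"]
    unfolding B_def fun_upd_twist[OF assms(4)] .
  have l2: "linear (B a)" for a
    using alt_form_linear[OF assms(1,3), of "v(i := a)"] by (simp add: B_def)
  have B0: "B a a = 0" for a
    unfolding B_def using assms by (intro alt_form_eq_0[of k \<alpha> i j]) auto
  have "0 = B (v i + v j) (v i + v j)" by (simp add: B0)
  also have "\<dots> = B (v i) (v j) + B (v j) (v i)"
    by (simp only: linear_add[OF l1] linear_add[OF l2]) (simp add: B0)
  finally have "B (v j) (v i) = - B (v i) (v j)" by simp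
  moreover have "(\<lambda>l. v (slot_swap i j l)) = v(i := v j, j := v i)"
    using assms(4) by (auto simp: Transposition.transpose_def)
  ultimately show ?thesis by (simp add: B_def)
qed

lemma linear_sum_scale:
  assumes "linear f"
  shows "f (\<Sum>i\<in>I. a i *\<^sub>R b i) = (\<Sum>i\<in>I. a i *\<^sub>R f (b i))"
  by (simp add: linear_sum[OF assms] linear_scale[OF assms])

lemma of_nat_5_bij: "bij_betw (of_nat :: nat \<Rightarrow> 5) {..<5} UNIV"
proof (rule bij_betw_imageI)
  show inj: "inj_on (of_nat :: nat \<Rightarrow> 5) {..<5}"
  proof (rule inj_onI)
    fix i j :: nat assume "i \<in> {..<5}" "j \<in> {..<5}" and eq: "(of_nat i :: 5) = of_nat j"
    then have "i \<in> {0,1,2,3,4}" "j \<in> {0,1,2,3,4}" by auto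
    with eq show "i = j" by auto
  qed
  show "(of_nat :: nat \<Rightarrow> 5) ` {..<5} = UNIV"
    by (rule card_subset_eq) (auto simp: card_image[OF inj])
qed

lemma vector_axis_expansion: "(x::real^'n) = (\<Sum>k\<in>UNIV. (x $ k) *\<^sub>R axis k 1)"
  using basis_expansion[of x] by (simp add: scalar_mult_eq_scaleR)

lemma std_frame_expansion: "w = (\<Sum>j<5. (w \<bullet> std_frame j) *\<^sub>R std_frame j)"
proof -
  have "(\<Sum>j<5. (w \<bullet> std_frame j) *\<^sub>R std_frame j) = (\<Sum>k\<in>UNIV. (w $ k) *\<^sub>R axis k 1)"
    using sum.reindex_bij_betw[OF of_nat_5_bij, of "\<lambda>k. (w $ k) *\<^sub>R axis k 1"]
    by (simp add: std_frame_def inner_axis)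
  then show ?thesis using vector_axis_expansion[of w] by simp
qed

text \<open>The determinant of a system of five vectors, as a form. It normalises the factor by which a linear
  map scales the one-dimensional space of alternating 5-forms.\<close>
definition det_form :: "(nat \<Rightarrow> real^5) \<Rightarrow> real" where
  "det_form v = det (\<chi> k. v (inv_into {..<5} of_nat k))"

lemma idx5: "inv_into {..<5} of_nat (k::5) < 5" "of_nat (inv_into {..<5} of_nat (k::5)) = k"
  and idx5_of_nat: "i < 5 \<Longrightarrow> inv_into {..<5} of_nat (of_nat i :: 5) = i"
proof -
  have "k \<in> (of_nat :: nat \<Rightarrow> 5) ` {..<5}" using of_nat_5_bij by (simp add: bij_betw_def)
  then show "inv_into {..<5} of_nat k < 5" "of_nat (inv_into {..<5} of_nat k) = k"
    using inv_into_into[of k "of_nat :: nat \<Rightarrow> 5" "{..<5}"] by (auto simp: f_inv_into_f)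
  show "i < 5 \<Longrightarrow> inv_into {..<5} of_nat (of_nat i :: 5) = i"
    using of_nat_5_bij by (intro inv_into_f_f) (auto simp: bij_betw_def)
qed

lemma alternating_det_form: "alternating_form 5 det_form"
  unfolding alternating_form_def
proof (intro conjI allI impI)
  fix v v' :: "nat \<Rightarrow> real^5" assume "\<forall>i<5. v i = v' i"
  then show "det_form v = det_form v'" by (simp add: det_form_def idx5(1))
next
  fix v :: "nat \<Rightarrow> real^5" and i :: nat assume i: "i < 5"
  have iff: "inv_into {..<5} of_nat k = i \<longleftrightarrow> k = of_nat i" for k :: 5
    using idx5(2)[of k] idx5_of_nat[OF i] by auto
  have eq: "det_form (v(i := u)) = det (\<chi> k. if k = of_nat i then u else v (inv_into {..<5} of_nat k))" for u
    unfolding det_form_def by (rule arg_cong[where f=det]) (simp add: vec_eq_iff iff)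
  show "linear (\<lambda>u. det_form (v(i := u)))"
  proof (rule linearI)
    let ?c = "\<lambda>k::5. v (inv_into {..<5} of_nat k)"
    show "det_form (v(i := a + b)) = det_form (v(i := a)) + det_form (v(i := b))" for a b
      unfolding eq by (rule det_row_add[of "of_nat i" "\<lambda>_. a" "\<lambda>_. b" ?c])
    show "det_form (v(i := r *\<^sub>R a)) = r *\<^sub>R det_form (v(i := a))" for r a
      unfolding eq using det_row_mul[of "of_nat i" r "\<lambda>_. a" ?c]
      unfolding scalar_mult_eq_scaleR by simp
  qed
next
  fix v :: "nat \<Rightarrow> real^5" and i j :: nat assume ij: "i < 5" "j < 5" "i \<noteq> j \<and> v i = v j"
  show "det_form v = 0" unfolding det_form_def
  proof (rule det_identical_rows[of "of_nat i" "of_nat j"])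
    show "(of_nat i :: 5) \<noteq> of_nat j" using ij idx5_of_nat[of i] idx5_of_nat[of j] by metis
  qed (use ij in \<open>simp add: row_def idx5_of_nat\<close>)
qed

lemma det_form_linear_image: "det_form (\<lambda>i. L (std_frame i)) = det (matrix L)"
proof -
  have "det_form (\<lambda>i. L (std_frame i)) = det (Finite_Cartesian_Product.transpose (matrix L))"
    unfolding det_form_def
    by (rule arg_cong[where f=det]) (simp add: vec_eq_iff std_frame_def idx5 matrix_def Finite_Cartesian_Product.transpose_def)
  then show ?thesis by simp
qed

lemma alt_form_scaled_args:
  assumes "alternating_form k \<alpha>" "m \<le> k"
  shows "\<alpha> (\<lambda>i. if i < m then a i *\<^sub>R v i else v i) = (\<Prod>i<m. a i) * \<alpha> v"
  using assms(2)
proof (induction m)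
  case 0
  then show ?case by simp
next
  case (Suc m)
  let ?w = "\<lambda>i. if i < m then a i *\<^sub>R v i else v i"
  have "(\<lambda>i. if i < Suc m then a i *\<^sub>R v i else v i) = ?w(m := a m *\<^sub>R v m)"
    by (auto simp: less_Suc_eq)
  moreover have "?w(m := v m) = ?w" by auto
  ultimately have "\<alpha> (\<lambda>i. if i < Suc m then a i *\<^sub>R v i else v i) = a m * \<alpha> ?w"
    using linear_scale[OF alt_form_linear[OF assms(1), of m ?w]] Suc.prems by simp
  then show ?case using Suc by simp
qed

text \<open>A vector \<open>u\<close> in the kernel with a nonzero \<open>k\<close>-th component: put \<open>f u = 0\<close> into the \<open>k\<close>-th slot and expand. Only the
  \<open>k\<close>-th summand survives, as the others repeat an argument.\<close>
lemma alt_form_singular: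
  assumes "alternating_form 5 \<alpha>" "linear f" "\<not> inj f"
  shows "\<alpha> (\<lambda>i. f (std_frame i)) = 0"
proof -
  obtain u where u: "u \<noteq> 0" "f u = 0" using assms(2,3) by (auto simp: linear_injective_0)
  have "\<exists>k<5. u \<bullet> std_frame k \<noteq> 0"
    using std_frame_expansion[of u] u(1) by (metis (no_types, lifting) lessThan_iff scaleR_eq_0_iff sum.neutral)
  then obtain k where k: "k < 5" "u \<bullet> std_frame k \<noteq> 0" by blast
  let ?v = "\<lambda>i. f (std_frame i)"
  let ?l = "\<lambda>x. \<alpha> (?v(k := x))"
  have lin: "linear ?l" by (rule alt_form_linear[OF assms(1) k(1)])
  have "0 = ?l (f u)" using u linear_0[OF lin] by simp
  also have "f u = (\<Sum>j<5. (u \<bullet> std_frame j) *\<^sub>R f (std_frame j))"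
    using arg_cong[OF std_frame_expansion[of u], of f] by (simp add: linear_sum_scale[OF assms(2)])
  also have "?l \<dots> = (\<Sum>j<5. (u \<bullet> std_frame j) * ?l (f (std_frame j)))"
    by (simp add: linear_sum_scale[OF lin])
  also have "\<dots> = (\<Sum>j<5. if j = k then (u \<bullet> std_frame k) * \<alpha> ?v else 0)"
  proof (rule sum.cong[OF refl])
    fix j :: nat assume "j \<in> {..<5}"
    then show "(u \<bullet> std_frame j) * ?l (f (std_frame j)) = (if j = k then (u \<bullet> std_frame k) * \<alpha> ?v else 0)"
      using alt_form_eq_0[OF assms(1), of j k "?v(k := f (std_frame j))"] k(1)
      by (auto simp: fun_upd_idem)
  qed
  also have "\<dots> = (u \<bullet> std_frame k) * \<alpha> ?v" using k(1) by (simp add: sum.delta)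
  finally show ?thesis using k(2) by simp
qed

text \<open>Elementary maps generate all linear maps; each scales every alternating 5-form by a
  factor that does not depend on the form, and evaluating on the form \<open>det_form\<close> identifies it.\<close>
proposition alternating_5_form_det:
  assumes "alternating_form 5 \<alpha>" "linear L"
  shows "\<alpha> (\<lambda>i. L (std_frame i)) = det (matrix L) * \<alpha> std_frame"
proof -
  let ?scales = "\<lambda>L. \<exists>c. \<forall>\<alpha>. alternating_form 5 \<alpha> \<longrightarrow> \<alpha> (\<lambda>i. L (std_frame i)) = c * \<alpha> std_frame"
  have "?scales L"
  proof (rule induct_linear_elementary[OF assms(2)])
    fix f g :: "real^5 \<Rightarrow> real^5"
    assume "linear f" "linear g"
      and "?scales f"
      and "?scales g"
    then obtain c d where
      c: "\<And>\<alpha>. alternating_form 5 \<alpha> \<Longrightarrow> \<alpha> (\<lambda>i. f (std_frame i)) = c * \<alpha> std_frame" and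
      d: "\<And>\<alpha>. alternating_form 5 \<alpha> \<Longrightarrow> \<alpha> (\<lambda>i. g (std_frame i)) = d * \<alpha> std_frame"
      by metis
    have "\<alpha> (\<lambda>i. (f \<circ> g) (std_frame i)) = (d * c) * \<alpha> std_frame" if "alternating_form 5 \<alpha>" for \<alpha>
      using d[OF alt_form_pullback[OF that \<open>linear f\<close>]] c[OF that] by simp
    then show "?scales (f \<circ> g)"
      by blast
  next
    fix f :: "real^5 \<Rightarrow> real^5" and i assume f: "linear f" and "\<And>x. f x $ i = 0"
    then have "\<not> inj f"
      by (metis linear_injective_imp_surjective one_neq_zero surjE vec_component)
    then have "\<alpha> (\<lambda>i. f (std_frame i)) = 0 * \<alpha> std_frame" if "alternating_form 5 \<alpha>" for \<alpha>
      using alt_form_singular[OF that f] by simp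
    then show "?scales f"
      by blast
  next
    fix c :: "5 \<Rightarrow> real"
    have "(\<chi> k. c k * std_frame i $ k) = c (of_nat i) *\<^sub>R std_frame i" for i
      by (simp add: vec_eq_iff std_frame_def axis_def)
    then have "\<alpha> (\<lambda>i. \<chi> k. c k * std_frame i $ k) = (\<Prod>i<5. c (of_nat i)) * \<alpha> std_frame"
      if "alternating_form 5 \<alpha>" for \<alpha>
      using alt_form_scaled_args[OF that, of 5 "\<lambda>i. c (of_nat i)" std_frame]
        alt_form_cong[OF that,
          of "\<lambda>i. if i < 5 then c (of_nat i) *\<^sub>R std_frame i else std_frame i" "\<lambda>i. \<chi> k. c k * std_frame i $ k"]
      by simp
    then show "?scales (\<lambda>x. \<chi> k. c k * x $ k)"
      by blast
  next
    fix m n :: 5 assume "m \<noteq> n"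
    define a b where "a = inv_into {..<5} of_nat m" and "b = inv_into {..<5} of_nat n"
    have ab: "a < 5" "b < 5" "of_nat a = m" "of_nat b = n" using idx5 by (auto simp: a_def b_def)
    have tr: "(\<chi> k. std_frame i $ slot_swap m n k) = std_frame (slot_swap a b i)"
      if "i < 5" for i
    proof -
      have "of_nat (slot_swap a b i) = slot_swap m n (of_nat i :: 5)"
      proof -
        have "of_nat i = m \<longleftrightarrow> i = a" "of_nat i = n \<longleftrightarrow> i = b"
          using idx5_of_nat[OF that] ab(3,4) unfolding a_def b_def by auto
        then show ?thesis using ab(3,4) by (simp add: Transposition.transpose_def)
      qed
      moreover have "slot_swap m n k = p \<longleftrightarrow> k = slot_swap m n p" for k p
        by (metis transpose_involutory)
      ultimately show ?thesis
        by (simp add: vec_eq_iff std_frame_def axis_def)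
    qed
    have "\<alpha> (\<lambda>i. \<chi> k. std_frame i $ slot_swap m n k) = (-1) * \<alpha> std_frame"
      if "alternating_form 5 \<alpha>" for \<alpha>
    proof -
      have "\<alpha> (\<lambda>i. \<chi> k. std_frame i $ slot_swap m n k)
          = \<alpha> (\<lambda>i. std_frame (slot_swap a b i))"
        by (rule alt_form_cong[OF that]) (rule tr)
      also have "\<dots> = - \<alpha> std_frame"
        using ab \<open>m \<noteq> n\<close> by (intro alt_form_swap[OF that]) auto
      finally show ?thesis by simp
    qed
    then show "?scales (\<lambda>x. \<chi> k. x $ slot_swap m n k)"
      by blast
  next
    fix m n :: 5 assume "m \<noteq> n"
    define a b where "a = inv_into {..<5} of_nat m" and "b = inv_into {..<5} of_nat n"
    have ab: "a < 5" "b < 5" "of_nat a = m" "of_nat b = n" using idx5 by (auto simp: a_def b_def)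
    have sh: "(\<chi> k. if k = m then std_frame i $ m + std_frame i $ n else std_frame i $ k)
        = (std_frame(b := std_frame b + std_frame a)) i" if "i < 5" for i
    proof -
      have "of_nat i = m \<longleftrightarrow> i = a" "of_nat i = n \<longleftrightarrow> i = b"
        using idx5_of_nat[OF that] ab(3,4) unfolding a_def b_def by auto
      then show ?thesis using ab(3,4) \<open>m \<noteq> n\<close>
        by (auto simp: vec_eq_iff std_frame_def axis_def)
    qed
    have "\<alpha> (\<lambda>i. \<chi> k. if k = m then std_frame i $ m + std_frame i $ n else std_frame i $ k) = 1 * \<alpha> std_frame"
      if "alternating_form 5 \<alpha>" for \<alpha>
    proof -
      have "\<alpha> (\<lambda>i. \<chi> k. if k = m then std_frame i $ m + std_frame i $ n else std_frame i $ k)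
          = \<alpha> (std_frame(b := std_frame b + std_frame a))"
        by (rule alt_form_cong[OF that]) (rule sh)
      also have "\<dots> = \<alpha> std_frame + \<alpha> (std_frame(b := std_frame a))"
        using linear_add[OF alt_form_linear[OF that ab(2), of std_frame], of "std_frame b" "std_frame a"]
        by simp
      also have "\<alpha> (std_frame(b := std_frame a)) = 0"
        using ab \<open>m \<noteq> n\<close> by (intro alt_form_eq_0[OF that, of a b]) auto
      finally show ?thesis by simp
    qed
    then show "?scales (\<lambda>x. \<chi> k. if k = m then x $ m + x $ n else x $ k)"
      by blast
  qed
  then obtain c where c: "\<And>\<alpha>. alternating_form 5 \<alpha> \<Longrightarrow> \<alpha> (\<lambda>i. L (std_frame i)) = c * \<alpha> std_frame"
    by blast
  have "det_form std_frame = 1"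
    using det_form_linear_image[of id] by (simp add: matrix_id_mat_1)
  then have "c = det (matrix L)"
    using c[OF alternating_det_form] det_form_linear_image[of L] by simp
  then show ?thesis using c[OF assms(1)] by simp
qed

section \<open>Alternation and wedge products at a point\<close>

text \<open>Without a factorial factor: in the wedge product the factor is \<open>1 / (p! q!)\<close>.\<close>
definition alternation :: "nat \<Rightarrow> ((nat \<Rightarrow> 'v) \<Rightarrow> real) \<Rightarrow> (nat \<Rightarrow> 'v) \<Rightarrow> real" where
  "alternation n F v = (\<Sum>\<pi> | \<pi> permutes {..<n}. of_int (sign \<pi>) * F (\<lambda>i. v (\<pi> i)))"

lemma alternation_cong:
  "(\<And>\<pi>. \<pi> permutes {..<n} \<Longrightarrow> F (\<lambda>i. v (\<pi> i)) = G (\<lambda>i. v (\<pi> i))) \<Longrightarrow> alternation n F v = alternation n G v"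
  by (simp add: alternation_def)

lemma alternation_sum:
  "alternation n (\<lambda>u. \<Sum>j\<in>J. H j u) v = (\<Sum>j\<in>J. alternation n (H j) v)"
  unfolding alternation_def by (subst sum.swap) (simp add: sum_distrib_left)

lemma alternation_add: "alternation n (\<lambda>u. F u + G u) v = alternation n F v + alternation n G v"
  by (simp add: alternation_def algebra_simps sum.distrib)

lemma alternation_diff: "alternation n (\<lambda>u. F u - G u) v = alternation n F v - alternation n G v"
  by (simp add: alternation_def algebra_simps sum_subtractf)

lemma alternation_minus: "alternation n (\<lambda>u. - F u) v = - alternation n F v"
  by (simp add: alternation_def sum_negf)

lemma alternation_cmult: "alternation n (\<lambda>u. c * F u) v = c * alternation n F v"
  by (simp add: alternation_def algebra_simps sum_distrib_left)

lemma alternation_zero: "alternation n (\<lambda>u. 0) v = 0"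
  by (simp add: alternation_def)

lemma sign_mult_permutes:
  fixes \<pi> \<tau> :: "nat \<Rightarrow> nat"
  assumes "\<pi> permutes {..<n}" "\<tau> permutes {..<n}"
  shows "sign (\<pi> \<circ> \<tau>) = sign \<pi> * sign \<tau>"
  using assms[THEN permutes_imp_permutation[OF finite_lessThan]] by (simp add: sign_compose)

lemma alternation_permute_slots:
  assumes "\<tau> permutes {..<n}"
  shows "alternation n (\<lambda>u. F (\<lambda>i. u (\<tau> i))) v = of_int (sign \<tau>) * alternation n F v"
proof -
  have sq: "real_of_int (sign \<tau>) * of_int (sign \<tau>) = 1"
    by (simp flip: of_int_mult)
  have "of_int (sign \<tau>) * alternation n F v
      = (\<Sum>\<pi> | \<pi> permutes {..<n}. of_int (sign \<tau>) * (of_int (sign (\<pi> \<circ> \<tau>)) * F (\<lambda>i. v ((\<pi> \<circ> \<tau>) i))))"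
    unfolding alternation_def sum_distrib_left
    by (rule sum_permutations_compose_right[OF assms])
  also have "\<dots> = alternation n (\<lambda>u. F (\<lambda>i. u (\<tau> i))) v"
    unfolding alternation_def
  proof (rule sum.cong[OF refl])
    fix \<pi> assume "\<pi> \<in> {\<pi>. \<pi> permutes {..<n}}"
    then have "sign (\<pi> \<circ> \<tau>) = sign \<pi> * sign \<tau>" using sign_mult_permutes assms by blast
    then have "real_of_int (sign \<tau>) * of_int (sign (\<pi> \<circ> \<tau>)) = of_int (sign \<pi>)"
      using sq by (simp add: algebra_simps)
    then show "of_int (sign \<tau>) * (of_int (sign (\<pi> \<circ> \<tau>)) * F (\<lambda>i. v ((\<pi> \<circ> \<tau>) i)))
        = of_int (sign \<pi>) * F (\<lambda>i. v (\<pi> (\<tau> i)))"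
      by (simp flip: mult.assoc)
  qed
  finally show ?thesis by simp
qed

lemma alternation_transpose_slots:
  assumes "i < n" "j < n" "i \<noteq> j"
  shows "alternation n (\<lambda>u. F (\<lambda>l. u (slot_swap i j l))) v = - alternation n F v"
  using alternation_permute_slots[OF permutes_swap_id, of i n j F v] assms
  by (simp add: sign_swap_id)

lemma linear_sum_functions:
  fixes g :: "'i \<Rightarrow> 'a::real_vector \<Rightarrow> real"
  assumes "\<And>i. i \<in> I \<Longrightarrow> linear (g i)"
  shows "linear (\<lambda>u. \<Sum>i\<in>I. c i * g i u)"
proof (rule linearI)
  show "(\<Sum>i\<in>I. c i * g i (a + b)) = (\<Sum>i\<in>I. c i * g i a) + (\<Sum>i\<in>I. c i * g i b)" for a b
    using linear_add[OF assms] by (simp add: algebra_simps sum.distrib)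
  show "(\<Sum>i\<in>I. c i * g i (r *\<^sub>R a)) = r *\<^sub>R (\<Sum>i\<in>I. c i * g i a)" for r a
    using linear_scale[OF assms] by (simp add: sum_distrib_left mult_ac)
qed

lemma alt_form_alternation:
  assumes cong: "\<And>v v'. (\<And>i. i < n \<Longrightarrow> v i = v' i) \<Longrightarrow> F v = F v'"
    and lin: "\<And>v i. i < n \<Longrightarrow> linear (\<lambda>u. F (v(i := u)))"
  shows "alternating_form n (alternation n F)"
  unfolding alternating_form_def
proof (intro conjI allI impI)
  fix v v' :: "nat \<Rightarrow> real^5" assume "\<forall>i<n. v i = v' i"
  then show "alternation n F v = alternation n F v'"
    unfolding alternation_def
    by (intro sum.cong refl arg_cong2[where f="(*)"] cong) (metis lessThan_iff mem_Collect_eq permutes_in_image)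
next
  fix v :: "nat \<Rightarrow> real^5" and i assume i: "i < n"
  have "linear (\<lambda>u. \<Sum>\<pi> | \<pi> permutes {..<n}. of_int (sign \<pi>) * F (\<lambda>l. (v(i := u)) (\<pi> l)))"
  proof (rule linear_sum_functions)
    fix \<pi> assume "\<pi> \<in> {\<pi>. \<pi> permutes {..<n}}"
    then have p: "\<pi> permutes {..<n}" by simp
    obtain k where k: "k < n" "\<pi> k = i"
      using permutes_image[OF p] i by (metis imageE lessThan_iff)
    have "\<pi> l = i \<longleftrightarrow> l = k" for l using k permutes_inj[OF p] by (metis injD)
    then have "(\<lambda>l. (v(i := u)) (\<pi> l)) = (\<lambda>l. v (\<pi> l))(k := u)" for u by auto
    then show "linear (\<lambda>u. F (\<lambda>l. (v(i := u)) (\<pi> l)))"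
      using lin[OF k(1), of "\<lambda>l. v (\<pi> l)"] by simp
  qed
  then show "linear (\<lambda>u. alternation n F (v(i := u)))" by (simp add: alternation_def)
next
  fix v :: "nat \<Rightarrow> real^5" and i j assume ij: "i < n" "j < n" "i \<noteq> j \<and> v i = v j"
  let ?\<tau> = "slot_swap i j"
  have \<tau>: "?\<tau> permutes {..<n}" using ij by (intro permutes_swap_id) auto
  have v: "v (?\<tau> l) = v l" for l using ij by (auto simp: Transposition.transpose_def)
  have "alternation n F v = (\<Sum>\<pi> | \<pi> permutes {..<n}. of_int (sign (?\<tau> \<circ> \<pi>)) * F (\<lambda>i. v ((?\<tau> \<circ> \<pi>) i)))"
    unfolding alternation_def by (rule setum_permutations_compose_left[OF \<tau>])
  also have "\<dots> = (\<Sum>\<pi> | \<pi> permutes {..<n}. - (of_int (sign \<pi>) * F (\<lambda>i. v (\<pi> i))))"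
    using sign_mult_permutes[OF \<tau>] ij by (intro sum.cong) (auto simp: v sign_swap_id)
  finally have "alternation n F v = - alternation n F v" by (simp add: alternation_def sum_negf)
  then show "alternation n F v = 0" by simp
qed

lemma wedge_eq_alternation:
  "wedge p q \<alpha> \<beta> c x v
    = alternation (p + q) (\<lambda>u. \<alpha> c x u * \<beta> c x (\<lambda>i. u (p + i))) v / (fact p * fact q)"
  by (simp add: wedge_def alternation_def mult.assoc)

lemma alt_form_divide: "alternating_form k \<alpha> \<Longrightarrow> alternating_form k (\<lambda>v. \<alpha> v / c)"
  unfolding alternating_form_def
  by (auto simp: linear_iff add_divide_distrib)

lemma alt_form_wedge:
  assumes a: "alternating_form p (\<alpha> c x)" and b: "alternating_form q (\<beta> c x)"
  shows "alternating_form (p + q) (wedge p q \<alpha> \<beta> c x)"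
  unfolding wedge_eq_alternation
proof (rule alt_form_divide, rule alt_form_alternation)
  fix v v' :: "nat \<Rightarrow> real^5" assume "\<And>i. i < p + q \<Longrightarrow> v i = v' i"
  then show "\<alpha> c x v * \<beta> c x (\<lambda>i. v (p + i)) = \<alpha> c x v' * \<beta> c x (\<lambda>i. v' (p + i))"
    by (intro arg_cong2[where f="(*)"] alt_form_cong[OF a] alt_form_cong[OF b]) auto
next
  fix v :: "nat \<Rightarrow> real^5" and i assume i: "i < p + q"
  show "linear (\<lambda>u. \<alpha> c x (v(i := u)) * \<beta> c x (\<lambda>l. (v(i := u)) (p + l)))"
  proof (cases "i < p")
    case True
    then have "(\<lambda>l. (v(i := u)) (p + l)) = (\<lambda>l. v (p + l))" for u by auto
    then show ?thesis using linear_sum_functions[of "{0::nat}" "\<lambda>_ u. \<alpha> c x (v(i := u))" "\<lambda>_. \<beta> c x (\<lambda>l. v (p + l))"]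
        alt_form_linear[OF a True, of v]
      by (simp add: mult.commute)
  next
    case False
    then obtain j where j: "i = p + j" "j < q" using i
      by (metis add_less_cancel_left le_add_diff_inverse not_less)
    have 1: "\<alpha> c x (v(i := u)) = \<alpha> c x v" for u
      using j by (intro alt_form_cong[OF a]) auto
    have 2: "(\<lambda>l. (v(i := u)) (p + l)) = (\<lambda>l. v (p + l))(j := u)" for u
      using j by auto
    show ?thesis unfolding 1 2
      using linear_sum_functions[of "{0::nat}" "\<lambda>_ u. \<beta> c x ((\<lambda>l. v (p + l))(j := u))" "\<lambda>_. \<alpha> c x v"]
        alt_form_linear[OF b j(2)] by simp
  qed
qed

section \<open>Contraction of a product of two 3-forms\<close>

lemma less_3_cases: "i < 3 \<Longrightarrow> i = 0 \<or> i = 1 \<or> i = (2::nat)" by linarith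

lemma permuted_frame_expansion:
  assumes "\<pi> permutes {..<5}"
  shows "w = (\<Sum>j<5. (w \<bullet> std_frame (\<pi> j)) *\<^sub>R std_frame (\<pi> j))"
  using std_frame_expansion[of w]
    sum.permute[OF assms, of "\<lambda>j. (w \<bullet> std_frame j) *\<^sub>R std_frame j"]
  by (simp add: o_def)

text \<open>Expand \<open>w\<close> in the frame \<open>u\<close> that is being alternated. The components along \<open>u\<^sub>3, u\<^sub>4\<close>
  repeat an argument of \<open>b\<close>, and those along \<open>u\<^sub>1, u\<^sub>2\<close> contribute as much as the one along \<open>u\<^sub>0\<close>.\<close>
lemma alternation_contraction:
  assumes a: "alternating_form 3 a" and b: "alternating_form 3 b"
  shows "alternation 5 (\<lambda>u. a u * b (case_nat w (\<lambda>i. u (3 + i)))) std_frame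
    = 3 * alternation 5 (\<lambda>u. (w \<bullet> u 0) * a u * b (case_nat (u 0) (\<lambda>i. u (3 + i)))) std_frame"
proof -
  define H where "H = (\<lambda>j u. (w \<bullet> u j) * a u * b (case_nat (u j) (\<lambda>i. u (3 + i))))"
  have upd: "case_nat y r = (case_nat 0 r)(0 := y)" for y :: "real^5" and r
    by (auto split: nat.split)
  have "alternation 5 (\<lambda>u. a u * b (case_nat w (\<lambda>i. u (3 + i)))) std_frame
      = alternation 5 (\<lambda>u. \<Sum>j<5. H j u) std_frame"
  proof (rule alternation_cong)
    fix \<pi> :: "nat \<Rightarrow> nat" assume p: "\<pi> permutes {..<5}"
    define u where "u = (\<lambda>i. std_frame (\<pi> i))"
    have "(\<lambda>y. b (case_nat y (\<lambda>i. u (3 + i)))) = (\<lambda>y. b ((case_nat 0 (\<lambda>i. u (3 + i)))(0 := y)))"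
      by (rule ext, rule arg_cong[where f=b], rule upd)
    then have lin: "linear (\<lambda>y. b (case_nat y (\<lambda>i. u (3 + i))))"
      using alt_form_linear[OF b, of 0 "case_nat 0 (\<lambda>i. u (3 + i))"] by simp
    have "b (case_nat w (\<lambda>i. u (3 + i)))
        = b (case_nat (\<Sum>j<5. (w \<bullet> u j) *\<^sub>R u j) (\<lambda>i. u (3 + i)))"
      using permuted_frame_expansion[OF p, of w] by (simp add: u_def)
    also have "\<dots> = (\<Sum>j<5. (w \<bullet> u j) * b (case_nat (u j) (\<lambda>i. u (3 + i))))"
      using linear_sum_scale[OF lin, of "\<lambda>j. w \<bullet> u j" u "{..<5}"] by simp
    finally show "a u * b (case_nat w (\<lambda>i. u (3 + i))) = (\<Sum>j<5. H j u)"
      by (simp add: H_def sum_distrib_left mult_ac)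
  qed
  also have "\<dots> = (\<Sum>j<5. alternation 5 (H j) std_frame)"
    by (rule alternation_sum)
  also have "\<dots> = (\<Sum>j\<in>{0,1,2,3,4}. alternation 5 (H j) std_frame)"
    by (rule sum.cong) auto
  also have "\<dots> = alternation 5 (H 0) std_frame + alternation 5 (H 1) std_frame
      + alternation 5 (H 2) std_frame + alternation 5 (H 3) std_frame + alternation 5 (H 4) std_frame"
    by simp
  also have "H 3 = (\<lambda>_. 0)"
  proof
    fix u
    have "b (case_nat (u 3) (\<lambda>i. u (3 + i))) = 0"
      by (rule alt_form_eq_0[OF b, of 0 1]) auto
    then show "H 3 u = 0" by (simp add: H_def)
  qed
  also have "H 4 = (\<lambda>_. 0)"
  proof
    fix u
    have "b (case_nat (u 4) (\<lambda>i. u (3 + i))) = 0"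
      by (rule alt_form_eq_0[OF b, of 0 2]) (auto simp: numeral_2_eq_2)
    then show "H 4 u = 0" by (simp add: H_def)
  qed
  finally have sum3: "alternation 5 (\<lambda>u. a u * b (case_nat w (\<lambda>i. u (3 + i)))) std_frame
    = alternation 5 (H 0) std_frame + alternation 5 (H 1) std_frame + alternation 5 (H 2) std_frame"
    by (simp add: alternation_zero)
  have "alternation 5 (H j) std_frame = alternation 5 (H 0) std_frame" if "j = 1 \<or> j = 2" for j
  proof -
    have "H j u = - H 0 (\<lambda>l. u (slot_swap 0 j l))" for u
    proof -
      have "a (\<lambda>l. u (slot_swap 0 j l)) = - a u"
        using that by (intro alt_form_swap[OF a]) auto
      moreover have "(\<lambda>i. u (slot_swap 0 j (3 + i))) = (\<lambda>i. u (3 + i))"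
        using that by (auto simp: Transposition.transpose_def)
      ultimately show ?thesis by (simp add: H_def)
    qed
    then have "alternation 5 (H j) std_frame
        = alternation 5 (\<lambda>u. - H 0 (\<lambda>l. u (slot_swap 0 j l))) std_frame" by presburger
    also have "\<dots> = alternation 5 (H 0) std_frame"
      unfolding alternation_minus using that
      by (subst alternation_transpose_slots) auto
    finally show ?thesis .
  qed
  from this[of 1] this[of 2] sum3 show ?thesis by (simp add: H_def)
qed

text \<open>This is \<open>i\<^sub>w(a \<and> b) = 0\<close>, where \<open>a \<and> b\<close> vanishes because its degree is 6. In the form of the preceding lemma, both
  sides alternate the same expression up to an even permutation of the slots.\<close>
lemma alternation_contraction_commute:
  assumes a: "alternating_form 3 a" and b: "alternating_form 3 b"
  shows "alternation 5 (\<lambda>u. a u * b (case_nat w (\<lambda>i. u (3 + i)))) std_frame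
    = alternation 5 (\<lambda>u. b u * a (case_nat w (\<lambda>i. u (3 + i)))) std_frame"
proof -
  \<comment> \<open>exchanges the pairs of slots \<open>1, 2\<close> and \<open>3, 4\<close>\<close>
  define \<tau> :: "nat \<Rightarrow> nat" where "\<tau> = slot_swap 1 3 \<circ> slot_swap 2 4"
  define F where "F = (\<lambda>u. (w \<bullet> u 0) * a u * b (case_nat (u 0) (\<lambda>i. u (3 + i))))"
  have tp: "\<tau> permutes {..<5}" unfolding \<tau>_def
    by (intro permutes_compose permutes_swap_id) auto
  have sg: "sign \<tau> = 1" unfolding \<tau>_def
    by (subst sign_compose) (auto simp: permutation_swap_id sign_swap_id)
  have \<tau>: "\<tau> 0 = 0" "\<tau> 1 = 3" "\<tau> 2 = 4" "\<tau> 3 = 1" "\<tau> 4 = 2"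
    by (simp_all add: \<tau>_def Transposition.transpose_def)
  have "(w \<bullet> u 0) * b u * a (case_nat (u 0) (\<lambda>i. u (3 + i))) = F (\<lambda>i. u (\<tau> i))" for u
  proof -
    have "b u = b (case_nat (u 0) (\<lambda>i. u (\<tau> (3 + i))))"
      by (rule alt_form_cong[OF b]) (use \<tau> in \<open>auto dest!: less_3_cases simp: numeral_2_eq_2\<close>)
    moreover have "a (case_nat (u 0) (\<lambda>i. u (3 + i))) = a (\<lambda>i. u (\<tau> i))"
      by (rule alt_form_cong[OF a]) (use \<tau> in \<open>auto dest!: less_3_cases simp: numeral_2_eq_2\<close>)
    ultimately show ?thesis by (simp add: F_def \<tau>(1))
  qed
  then have "alternation 5 (\<lambda>u. (w \<bullet> u 0) * b u * a (case_nat (u 0) (\<lambda>i. u (3 + i)))) std_frame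
      = alternation 5 F std_frame"
    using alternation_permute_slots[OF tp, of F std_frame] sg by simp
  then show ?thesis
    using alternation_contraction[OF a b, of w] alternation_contraction[OF b a, of w] by (simp add: F_def)
qed

text \<open>Moving a block of two slots past a block of three is an even permutation.\<close>
lemma alternation_block_swap:
  assumes a: "alternating_form 3 a" and b: "alternating_form 3 b"
  shows "alternation 5 (\<lambda>u. a (case_nat w u) * b (\<lambda>i. u (2 + i))) v
    = alternation 5 (\<lambda>u. b u * a (case_nat w (\<lambda>i. u (3 + i)))) v"
proof -
  \<comment> \<open>the rotation \<open>i \<mapsto> i + 2\<close> modulo 5, a 5-cycle\<close>
  define \<tau> :: "nat \<Rightarrow> nat" where "\<tau> = slot_swap 0 2 \<circ> (slot_swap 2 4 \<circ>
    (slot_swap 4 1 \<circ> slot_swap 1 3))"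
  define F where "F = (\<lambda>u. b u * a (case_nat w (\<lambda>i. u (3 + i))))"
  have tp: "\<tau> permutes {..<5}" unfolding \<tau>_def
    by (intro permutes_compose permutes_swap_id) auto
  have sg: "sign \<tau> = 1" unfolding \<tau>_def
    by (simp add: sign_compose permutation_swap_id permutation_compose sign_swap_id)
  have \<tau>: "\<tau> 0 = 2" "\<tau> 1 = 3" "\<tau> 2 = 4" "\<tau> 3 = 0" "\<tau> 4 = 1"
    by (simp_all add: \<tau>_def Transposition.transpose_def)
  have "a (case_nat w u) * b (\<lambda>i. u (2 + i)) = F (\<lambda>i. u (\<tau> i))" for u
  proof -
    have "b (\<lambda>i. u (2 + i)) = b (\<lambda>i. u (\<tau> i))"
    proof (rule alt_form_cong[OF b])
      fix i :: nat assume "i < 3"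
      from less_3_cases[OF this] show "u (2 + i) = u (\<tau> i)"
        using \<tau> by (elim disjE) (simp_all add: eval_nat_numeral)
    qed
    moreover have "a (case_nat w u) = a (case_nat w (\<lambda>i. u (\<tau> (3 + i))))"
      by (rule alt_form_cong[OF a]) (use \<tau> in \<open>auto dest!: less_3_cases simp: numeral_2_eq_2\<close>)
    ultimately show ?thesis by (simp add: F_def)
  qed
  then have "alternation 5 (\<lambda>u. a (case_nat w u) * b (\<lambda>i. u (2 + i))) v = alternation 5 F v"
    using alternation_permute_slots[OF tp, of F v] sg by simp
  then show ?thesis by (simp add: F_def)
qed

lemma wedge_interior_product:
  assumes "alternating_form 3 (\<phi> c x)" "alternating_form 3 (\<delta> c x)"
  shows "wedge 3 2 \<delta> (interior_product w \<phi>) c x std_frame = wedge 2 3 (interior_product w \<phi>) \<delta> c x std_frame"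
    and "wedge 3 2 \<phi> (interior_product w \<delta>) c x std_frame = wedge 2 3 (interior_product w \<phi>) \<delta> c x std_frame"
  using alternation_block_swap[OF assms, of "w c x" std_frame]
    alternation_contraction_commute[OF assms, of "w c x"]
  by (simp_all add: wedge_eq_alternation interior_product_def mult.commute)

section \<open>Calculus of forms in an open subset of \<open>real^5\<close>\<close>

text \<open>What membership in \<open>diff_forms\<close> requires in a single chart.\<close>
definition local_form :: "nat \<Rightarrow> (real^5) set \<Rightarrow> (real^5 \<Rightarrow> (nat \<Rightarrow> real^5) \<Rightarrow> real) \<Rightarrow> bool" where
  "local_form k U \<phi> \<longleftrightarrow> open U \<and> (\<forall>x\<in>U. alternating_form k (\<phi> x)) \<and> (\<forall>v. smooth_on U (\<lambda>x. \<phi> x v))"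

text \<open>The summation in \<open>ext_deriv\<close>, detached from charts.\<close>
definition local_d :: "nat \<Rightarrow> (real^5 \<Rightarrow> (nat \<Rightarrow> real^5) \<Rightarrow> real) \<Rightarrow> real^5 \<Rightarrow> (nat \<Rightarrow> real^5) \<Rightarrow> real" where
  "local_d k \<phi> x v = (\<Sum>i\<le>k. (-1) ^ i * fd (\<lambda>y. \<phi> y (\<lambda>j. v (if j < i then j else Suc j))) x (v i))"

definition vec2 :: "'v \<Rightarrow> 'v \<Rightarrow> nat \<Rightarrow> 'v" where
  "vec2 a b = case_nat a (\<lambda>_. b)"

definition vec3 :: "'v \<Rightarrow> 'v \<Rightarrow> 'v \<Rightarrow> nat \<Rightarrow> 'v" where
  "vec3 a b c = case_nat a (vec2 b c)"

lemma vec2_simps [simp]: "vec2 a b 0 = a" "vec2 a b (Suc 0) = b" "vec2 a b (Suc i) = b"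
  by (simp_all add: vec2_def)

lemma vec3_simps [simp]: "vec3 a b c 0 = a" "vec3 a b c (Suc 0) = b" "vec3 a b c 2 = c"
    "vec3 a b c (Suc (Suc 0)) = c"
  by (simp_all add: vec3_def numeral_2_eq_2)

lemma local_formD:
  assumes "local_form k U \<phi>"
  shows "open U" "\<And>x. x \<in> U \<Longrightarrow> alternating_form k (\<phi> x)" "\<And>v. smooth_on U (\<lambda>x. \<phi> x v)"
    "\<And>x v. x \<in> U \<Longrightarrow> ((\<lambda>y. \<phi> y v) has_derivative fd (\<lambda>y. \<phi> y v) x) (at x)"
  using assms smooth_on_has_derivative unfolding local_form_def by blast+

lemma less_2_cases: "i < 2 \<Longrightarrow> i = 0 \<or> i = (1::nat)" by linarith

lemma alt_form_vec2:
  assumes "alternating_form 2 \<alpha>" shows "\<alpha> v = \<alpha> (vec2 (v 0) (v 1))"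
  by (rule alt_form_cong[OF assms]) (auto dest!: less_2_cases)

lemma alt_form_vec3:
  assumes "alternating_form 3 \<alpha>" shows "\<alpha> v = \<alpha> (vec3 (v 0) (v 1) (v 2))"
  by (rule alt_form_cong[OF assms]) (auto dest!: less_3_cases)

lemma alt_form_2_linear:
  assumes "alternating_form 2 \<alpha>"
  shows "linear (\<lambda>a. \<alpha> (vec2 a b))" "linear (\<lambda>b. \<alpha> (vec2 a b))"
proof -
  have 1: "\<alpha> ((vec2 0 b)(0 := a)) = \<alpha> (vec2 a b)" for a b
    by (rule alt_form_cong[OF assms]) (auto dest!: less_2_cases)
  have 2: "\<alpha> ((vec2 a 0)(1 := b)) = \<alpha> (vec2 a b)" for a b
    by (rule alt_form_cong[OF assms]) (auto dest!: less_2_cases)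
  show "linear (\<lambda>a. \<alpha> (vec2 a b))"
    using alt_form_linear[OF assms, of 0 "vec2 0 b"] unfolding 1 by simp
  show "linear (\<lambda>b. \<alpha> (vec2 a b))"
    using alt_form_linear[OF assms, of 1 "vec2 a 0"] unfolding 2 by simp
qed

lemma alt_form_2_swap:
  assumes "alternating_form 2 \<alpha>" shows "\<alpha> (vec2 a b) = - \<alpha> (vec2 b a)"
proof -
  have "\<alpha> (vec2 a b) = \<alpha> (\<lambda>l. vec2 b a (slot_swap 0 1 l))"
    by (rule alt_form_cong[OF assms]) (auto dest!: less_2_cases)
  also have "\<dots> = - \<alpha> (vec2 b a)"
    by (rule alt_form_swap[OF assms]) auto
  finally show ?thesis .
qed

lemma alt_form_3_swap:
  assumes "alternating_form 3 \<alpha>"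
  shows "\<alpha> (vec3 a b c) = - \<alpha> (vec3 b a c)" "\<alpha> (vec3 a b c) = - \<alpha> (vec3 a c b)"
proof -
  have "\<alpha> (vec3 a b c) = \<alpha> (\<lambda>l. vec3 b a c (slot_swap 0 1 l))"
    by (rule alt_form_cong[OF assms]) (auto dest!: less_3_cases simp: Transposition.transpose_def)
  also have "\<dots> = - \<alpha> (vec3 b a c)"
    by (rule alt_form_swap[OF assms]) auto
  finally show "\<alpha> (vec3 a b c) = - \<alpha> (vec3 b a c)" .
  have "\<alpha> (vec3 a b c) = \<alpha> (\<lambda>l. vec3 a c b (slot_swap 1 2 l))"
    by (rule alt_form_cong[OF assms]) (auto dest!: less_3_cases simp: Transposition.transpose_def)
  also have "\<dots> = - \<alpha> (vec3 a c b)"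
    by (rule alt_form_swap[OF assms]) auto
  finally show "\<alpha> (vec3 a b c) = - \<alpha> (vec3 a c b)" .
qed

text \<open>Being alternating is a linear condition on forms, hence inherited by derivatives with respect to the base point.\<close>
lemma alt_form_fd:
  assumes "local_form k U \<phi>" "x \<in> U"
  shows "alternating_form k (\<lambda>v. fd (\<lambda>y. \<phi> y v) x h)"
  unfolding alternating_form_def
proof (intro conjI allI impI)
  note lf = local_formD[OF assms(1)]
  show "fd (\<lambda>y. \<phi> y v) x h = fd (\<lambda>y. \<phi> y v') x h" if "\<forall>i<k. v i = v' i" for v v'
    using fd_cong_open[OF lf(1) assms(2), of "\<lambda>y. \<phi> y v" "\<lambda>y. \<phi> y v'"]
      alt_form_cong[OF lf(2), of _ v v'] that by simp
  show "fd (\<lambda>y. \<phi> y v) x h = 0" if "i < k" "j < k" "i \<noteq> j \<and> v i = v j" for v i j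
    using fd_cong_open[OF lf(1) assms(2), of "\<lambda>y. \<phi> y v" "\<lambda>y. 0"]
      alt_form_eq_0[OF lf(2), of _ i j v] that by simp
  show "linear (\<lambda>u. fd (\<lambda>y. \<phi> y (v(i := u))) x h)" if i: "i < k" for v i
  proof (rule linearI)
    note lin = alt_form_linear[OF lf(2) i, of _ v]
    fix a b :: "real^5" and r :: real
    have "fd (\<lambda>y. \<phi> y (v(i := a + b))) x = fd (\<lambda>y. \<phi> y (v(i := a)) + \<phi> y (v(i := b))) x"
      by (rule fd_cong_open[OF lf(1) assms(2)]) (rule linear_add[OF lin])
    then show "fd (\<lambda>y. \<phi> y (v(i := a + b))) x h = fd (\<lambda>y. \<phi> y (v(i := a))) x h + fd (\<lambda>y. \<phi> y (v(i := b))) x h"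
      using fd_eq[OF has_derivative_add[OF lf(4) lf(4)], OF assms(2) assms(2), of "v(i := a)" "v(i := b)"] by simp
    have "fd (\<lambda>y. \<phi> y (v(i := r *\<^sub>R a))) x = fd (\<lambda>y. r *\<^sub>R \<phi> y (v(i := a))) x"
      by (rule fd_cong_open[OF lf(1) assms(2)]) (rule linear_scale[OF lin])
    then show "fd (\<lambda>y. \<phi> y (v(i := r *\<^sub>R a))) x h = r *\<^sub>R fd (\<lambda>y. \<phi> y (v(i := a))) x h"
      using fd_eq[OF has_derivative_scaleR_right[OF lf(4)], OF assms(2), of r "v(i := a)"] by simp
  qed
qed

lemma fd_form_linear:
  "local_form k U \<phi> \<Longrightarrow> x \<in> U \<Longrightarrow> linear (\<lambda>h. fd (\<lambda>y. \<phi> y v) x h)"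
  using has_derivative_linear[OF local_formD(4)] by simp

lemma alt_form_expand:
  assumes "alternating_form k \<alpha>" "m < k"
  shows "(\<Sum>b\<in>Basis. (a \<bullet> b) * \<alpha> (w(m := b))) = \<alpha> (w(m := a))"
  using linear_sum_scale[OF alt_form_linear[OF assms], of w "\<lambda>b. a \<bullet> b" "\<lambda>b. b" Basis]
  by (simp add: euclidean_representation)

text \<open>The arguments are made variable one slot after the other; a slot becomes variable by
  expanding its vector in the standard basis.\<close>
proposition form_substitution:
  assumes \<phi>: "local_form k U \<phi>" and T: "open T" and g: "smooth_on T g" "g ` T \<subseteq> U"
    and u: "\<And>i. i < k \<Longrightarrow> smooth_on T (u i)"
  shows "smooth_on T (\<lambda>x. \<phi> (g x) (\<lambda>i. u i x))"
    and "\<And>x. x \<in> T \<Longrightarrow> ((\<lambda>x. \<phi> (g x) (\<lambda>i. u i x)) has_derivative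
      (\<lambda>h. fd (\<lambda>y. \<phi> y (\<lambda>i. u i x)) (g x) (fd g x h)
         + (\<Sum>i<k. \<phi> (g x) ((\<lambda>i. u i x)(i := fd (u i) x h))))) (at x)"
proof -
  note lf = local_formD[OF \<phi>]
  define cur where "cur m x v = (\<lambda>i. if i < m then u i x else v i)" for m x v
  have gU: "g x \<in> U" if "x \<in> T" for x using g(2) that by blast
  have cur_Suc: "cur (Suc m) x v = (cur m x v)(m := u m x)" for m x v
    by (auto simp: cur_def less_Suc_eq)
  have cur_upd: "cur m x (v(m := b)) = (cur m x v)(m := b)" for m x v b
    by (auto simp: cur_def)
  have expand: "\<phi> (g x) (cur (Suc m) x v) = (\<Sum>b\<in>Basis. (u m x \<bullet> b) * \<phi> (g x) (cur m x (v(m := b))))"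
    if "m < k" "x \<in> T" for m x v
    unfolding cur_Suc cur_upd using alt_form_expand[OF lf(2)[OF gU[OF that(2)]] that(1)] by metis
  have smooth: "smooth_on T (\<lambda>x. \<phi> (g x) (cur m x v))" if "m \<le> k" for m v
    using that
  proof (induction m arbitrary: v)
    case 0
    then show ?case using smooth_on_compose[OF T g(2,1) lf(3)] by (simp add: cur_def)
  next
    case (Suc m)
    show ?case
    proof (rule smooth_on_cong[OF T])
      show "smooth_on T (\<lambda>x. \<Sum>b\<in>Basis. (u m x \<bullet> b) * \<phi> (g x) (cur m x (v(m := b))))"
        using Suc u[of m] by (intro smooth_on_sum smooth_on_mult smooth_on_inner T smooth_on_const) auto
      show "(\<Sum>b\<in>Basis. (u m x \<bullet> b) * \<phi> (g x) (cur m x (v(m := b)))) = \<phi> (g x) (cur (Suc m) x v)"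
        if "x \<in> T" for x
        using expand[of m x v] that Suc.prems by simp
    qed
  qed
  show "smooth_on T (\<lambda>x. \<phi> (g x) (\<lambda>i. u i x))"
  proof (rule smooth_on_cong[OF T _ smooth[of k undefined]])
    show "\<phi> (g x) (cur k x undefined) = \<phi> (g x) (\<lambda>i. u i x)" if "x \<in> T" for x
      by (rule alt_form_cong[OF lf(2)[OF gU[OF that]]]) (simp add: cur_def)
  qed simp
  fix x assume x: "x \<in> T"
  let ?A = "\<lambda>w. fd (\<lambda>y. \<phi> y w) (g x)"
  note altx = lf(2)[OF gU[OF x]]
  have deriv: "((\<lambda>x. \<phi> (g x) (cur m x v)) has_derivative
      (\<lambda>h. ?A (cur m x v) (fd g x h) + (\<Sum>i<m. \<phi> (g x) ((cur m x v)(i := fd (u i) x h))))) (at x)"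
    if "m \<le> k" for m v
    using that
  proof (induction m arbitrary: v)
    case 0
    have "(g has_derivative fd g x) (at x)" using smooth_on_has_derivative[OF g(1) x] .
    from has_derivative_compose[OF this lf(4)[OF gU[OF x], of v]]
    show ?case by (simp add: cur_def)
  next
    case (Suc m)
    then have m: "m < k" by simp
    define \<psi> where "\<psi> b = (\<lambda>x. \<phi> (g x) (cur m x (v(m := b))))" for b
    define D where "D b h = ?A (cur m x (v(m := b))) (fd g x h)
        + (\<Sum>i<m. \<phi> (g x) ((cur m x (v(m := b)))(i := fd (u i) x h)))" for b h
    have IH: "(\<psi> b has_derivative D b) (at x)" for b
      unfolding \<psi>_def D_def by (rule Suc.IH) (use Suc.prems in simp)
    have um: "(u m has_derivative fd (u m) x) (at x)"
      using smooth_on_has_derivative[OF u[OF m] x] .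
    have "((\<lambda>x. \<Sum>b\<in>Basis. (u m x \<bullet> b) * \<psi> b x) has_derivative
        (\<lambda>h. \<Sum>b\<in>Basis. (u m x \<bullet> b) * D b h + (fd (u m) x h \<bullet> b) * \<psi> b x)) (at x)"
      by (intro has_derivative_sum has_derivative_mult has_derivative_inner_left um IH)
    then have 1: "((\<lambda>x. \<phi> (g x) (cur (Suc m) x v)) has_derivative
        (\<lambda>h. \<Sum>b\<in>Basis. (u m x \<bullet> b) * D b h + (fd (u m) x h \<bullet> b) * \<psi> b x)) (at x)"
      by (rule has_derivative_transform_within_open[OF _ T x]) (simp add: expand[OF m] \<psi>_def)
    have "(\<Sum>b\<in>Basis. (u m x \<bullet> b) * D b h + (fd (u m) x h \<bullet> b) * \<psi> b x)
      = ?A (cur (Suc m) x v) (fd g x h) + (\<Sum>i<Suc m. \<phi> (g x) ((cur (Suc m) x v)(i := fd (u i) x h)))" for h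
    proof -
      have "(\<Sum>b\<in>Basis. (u m x \<bullet> b) * D b h + (fd (u m) x h \<bullet> b) * \<psi> b x)
        = (\<Sum>b\<in>Basis. (u m x \<bullet> b) * ?A ((cur m x v)(m := b)) (fd g x h))
        + (\<Sum>b\<in>Basis. \<Sum>i<m. (u m x \<bullet> b) * \<phi> (g x) ((cur m x v)(m := b, i := fd (u i) x h)))
        + (\<Sum>b\<in>Basis. (fd (u m) x h \<bullet> b) * \<phi> (g x) ((cur m x v)(m := b)))"
        by (simp add: D_def \<psi>_def cur_upd sum.distrib distrib_left sum_distrib_left)
      also have "(\<Sum>b\<in>Basis. (u m x \<bullet> b) * ?A ((cur m x v)(m := b)) (fd g x h))
          = ?A (cur (Suc m) x v) (fd g x h)"
        unfolding cur_Suc by (rule alt_form_expand[OF alt_form_fd[OF \<phi> gU[OF x]] m])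
      also have "(\<Sum>b\<in>Basis. \<Sum>i<m. (u m x \<bullet> b) * \<phi> (g x) ((cur m x v)(m := b, i := fd (u i) x h)))
          = (\<Sum>i<m. \<phi> (g x) ((cur (Suc m) x v)(i := fd (u i) x h)))"
      proof (subst sum.swap, rule sum.cong[OF refl])
        fix i assume "i \<in> {..<m}"
        then have c: "w(m := b, i := z) = w(i := z, m := b)" for w :: "nat \<Rightarrow> real^5" and b z
          by (simp add: fun_upd_twist)
        show "(\<Sum>b\<in>Basis. (u m x \<bullet> b) * \<phi> (g x) ((cur m x v)(m := b, i := fd (u i) x h)))
            = \<phi> (g x) ((cur (Suc m) x v)(i := fd (u i) x h))"
          unfolding cur_Suc c by (rule alt_form_expand[OF altx m])
      qed
      also have "(\<Sum>b\<in>Basis. (fd (u m) x h \<bullet> b) * \<phi> (g x) ((cur m x v)(m := b)))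
          = \<phi> (g x) ((cur (Suc m) x v)(m := fd (u m) x h))"
        unfolding cur_Suc fun_upd_upd by (rule alt_form_expand[OF altx m])
      finally show ?thesis by (simp add: fun_upd_def)
    qed
    then show ?case using 1 by (simp add: fun_upd_def)
  qed
  let ?v = "\<lambda>i. u i x"
  have eqv: "cur k x ?v = ?v" by (auto simp: cur_def)
  have "((\<lambda>x. \<phi> (g x) (cur k x ?v)) has_derivative
      (\<lambda>h. ?A ?v (fd g x h) + (\<Sum>i<k. \<phi> (g x) (?v(i := fd (u i) x h))))) (at x)"
    using deriv[of k ?v] unfolding eqv by simp
  then show "((\<lambda>x. \<phi> (g x) (\<lambda>i. u i x)) has_derivative
      (\<lambda>h. ?A ?v (fd g x h) + (\<Sum>i<k. \<phi> (g x) (?v(i := fd (u i) x h))))) (at x)"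
  proof (rule has_derivative_transform_within_open[OF _ T x])
    show "\<phi> (g y) (cur k y ?v) = \<phi> (g y) (\<lambda>i. u i y)" if "y \<in> T" for y
      by (rule alt_form_cong[OF lf(2)[OF gU[OF that]]]) (simp add: cur_def)
  qed
qed

lemma alt_form_insert:
  assumes "alternating_form (Suc k) \<alpha>"
  shows "alternating_form k (\<lambda>v. \<alpha> (case_nat w v))"
  unfolding alternating_form_def
proof (intro conjI allI impI)
  show "\<alpha> (case_nat w v) = \<alpha> (case_nat w v')" if "\<forall>i<k. v i = v' i" for v v'
    by (rule alt_form_cong[OF assms]) (use that in \<open>auto split: nat.split\<close>)
  show "\<alpha> (case_nat w v) = 0" if "i < k" "j < k" "i \<noteq> j \<and> v i = v j" for v i j
    by (rule alt_form_eq_0[OF assms, of "Suc i" "Suc j"]) (use that in auto)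
  show "linear (\<lambda>u. \<alpha> (case_nat w (v(i := u))))" if "i < k" for v i
  proof -
    have "case_nat w (v(i := u)) = (case_nat w v)(Suc i := u)" for u
      by (auto split: nat.split)
    then show ?thesis using alt_form_linear[OF assms, of "Suc i" "case_nat w v"] that by simp
  qed
qed

lemma local_form_interior:
  assumes "local_form (Suc k) U \<phi>" "smooth_on U w"
  shows "local_form k U (\<lambda>x v. \<phi> x (case_nat (w x) v))"
proof -
  note lf = local_formD[OF assms(1)]
  have "smooth_on U (\<lambda>x. \<phi> x (\<lambda>i. case_nat (w x) v i))" for v
  proof (rule form_substitution(1)[OF assms(1) lf(1) smooth_on_ident])
    show "smooth_on U (\<lambda>x. case_nat (w x) v i)" for i
      using assms(2) by (cases i) (auto simp: smooth_on_const)
  qed simp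
  then show ?thesis using lf alt_form_insert by (simp add: local_form_def)
qed

lemma linear_fd: "smooth_on T g \<Longrightarrow> x \<in> T \<Longrightarrow> linear (fd g x)"
  using has_derivative_linear[OF smooth_on_has_derivative] .

lemma local_form_pullback:
  assumes "local_form k U \<phi>" "open T" "smooth_on T g" "g ` T \<subseteq> U"
  shows "local_form k T (\<lambda>x v. \<phi> (g x) (\<lambda>i. fd g x (v i)))"
  using assms alt_form_pullback[OF local_formD(2)[OF assms(1)] linear_fd[OF assms(3)]]
    form_substitution(1)[OF assms, of "\<lambda>i x. fd g x (_ i)"] smooth_on_fd[OF assms(3)]
  unfolding local_form_def by blast

lemma fd_form_vec2:
  assumes "local_form 2 U \<phi>" "x \<in> U"
  shows "fd (\<lambda>y. \<phi> y v) x h = fd (\<lambda>y. \<phi> y (vec2 (v 0) (v 1))) x h"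
  by (rule alt_form_vec2[OF alt_form_fd[OF assms]])

lemma fd_form_vec3:
  assumes "local_form 3 U \<phi>" "x \<in> U"
  shows "fd (\<lambda>y. \<phi> y v) x h = fd (\<lambda>y. \<phi> y (vec3 (v 0) (v 1) (v 2))) x h"
  by (rule alt_form_vec3[OF alt_form_fd[OF assms]])

lemma local_d_2:
  assumes "local_form 2 U \<phi>" "x \<in> U"
  shows "local_d 2 \<phi> x v = fd (\<lambda>y. \<phi> y (vec2 (v 1) (v 2))) x (v 0)
     - fd (\<lambda>y. \<phi> y (vec2 (v 0) (v 2))) x (v 1) + fd (\<lambda>y. \<phi> y (vec2 (v 0) (v 1))) x (v 2)"
proof -
  have "{..2::nat} = {0,1,2}" by auto
  then have "local_d 2 \<phi> x v = fd (\<lambda>y. \<phi> y (\<lambda>j. v (Suc j))) x (v 0)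
     - fd (\<lambda>y. \<phi> y (\<lambda>j. v (if j < 1 then j else Suc j))) x (v 1)
     + fd (\<lambda>y. \<phi> y (\<lambda>j. v (if j < 2 then j else Suc j))) x (v 2)"
    by (simp add: local_d_def)
  then show ?thesis
    unfolding fd_form_vec2[OF assms, of "\<lambda>j. v (Suc j)"]
      fd_form_vec2[OF assms, of "\<lambda>j. v (if j < 1 then j else Suc j)"]
      fd_form_vec2[OF assms, of "\<lambda>j. v (if j < 2 then j else Suc j)"]
    by (simp add: numeral_2_eq_2)
qed

lemma local_d_3:
  assumes "local_form 3 U \<phi>" "x \<in> U"
  shows "local_d 3 \<phi> x v = fd (\<lambda>y. \<phi> y (vec3 (v 1) (v 2) (v 3))) x (v 0)
     - fd (\<lambda>y. \<phi> y (vec3 (v 0) (v 2) (v 3))) x (v 1)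
     + fd (\<lambda>y. \<phi> y (vec3 (v 0) (v 1) (v 3))) x (v 2)
     - fd (\<lambda>y. \<phi> y (vec3 (v 0) (v 1) (v 2))) x (v 3)"
proof -
  have "{..3::nat} = {0,1,2,3}" by auto
  then have "local_d 3 \<phi> x v = fd (\<lambda>y. \<phi> y (\<lambda>j. v (Suc j))) x (v 0)
     - fd (\<lambda>y. \<phi> y (\<lambda>j. v (if j < 1 then j else Suc j))) x (v 1)
     + fd (\<lambda>y. \<phi> y (\<lambda>j. v (if j < 2 then j else Suc j))) x (v 2)
     - fd (\<lambda>y. \<phi> y (\<lambda>j. v (if j < 3 then j else Suc j))) x (v 3)"
    by (simp add: local_d_def)
  then show ?thesis
    unfolding fd_form_vec3[OF assms, of "\<lambda>j. v (Suc j)"]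
      fd_form_vec3[OF assms, of "\<lambda>j. v (if j < 1 then j else Suc j)"]
      fd_form_vec3[OF assms, of "\<lambda>j. v (if j < 2 then j else Suc j)"]
      fd_form_vec3[OF assms, of "\<lambda>j. v (if j < 3 then j else Suc j)"]
    by (simp add: numeral_2_eq_2 numeral_3_eq_3)
qed

text \<open>The second derivatives of \<open>g\<close> that appear on differentiating the pull-back are symmetric, and the
  alternating sum cancels them.\<close>
proposition local_d_pullback:
  assumes \<phi>: "local_form 2 U \<phi>" and T: "open T" and g: "smooth_on T g" "g ` T \<subseteq> U" and x: "x \<in> T"
  shows "local_d 2 (\<lambda>x v. \<phi> (g x) (\<lambda>i. fd g x (v i))) x v = local_d 2 \<phi> (g x) (\<lambda>i. fd g x (v i))"
proof -
  define \<phi>' where "\<phi>' = (\<lambda>x v. \<phi> (g x) (\<lambda>i. fd g x (v i)))"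
  have \<phi>': "local_form 2 T \<phi>'" unfolding \<phi>'_def by (rule local_form_pullback[OF \<phi> T g])
  have gx: "g x \<in> U" using g(2) x by blast
  note alt = local_formD(2)[OF \<phi> gx]
  define S where "S a h = fd (\<lambda>x. fd g x a) x h" for a h
  have S_comm: "S a h = S h a" for a h unfolding S_def by (rule fd_commute[OF T g(1) x])
  have D: "fd (\<lambda>y. \<phi>' y (vec2 a b)) x h = fd (\<lambda>y. \<phi> y (vec2 (fd g x a) (fd g x b))) (g x) (fd g x h)
      + \<phi> (g x) (vec2 (S a h) (fd g x b)) + \<phi> (g x) (vec2 (fd g x a) (S b h))" for a b h
  proof -
    let ?u = "\<lambda>i x. fd g x (vec2 a b i)"
    have "((\<lambda>y. \<phi>' y (vec2 a b)) has_derivative (\<lambda>h. fd (\<lambda>y. \<phi> y (\<lambda>i. ?u i x)) (g x) (fd g x h)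
         + (\<Sum>i<2. \<phi> (g x) ((\<lambda>i. ?u i x)(i := fd (?u i) x h))))) (at x)"
      unfolding \<phi>'_def by (rule form_substitution(2)[OF \<phi> T g _ x]) (rule smooth_on_fd[OF g(1)])
    from fd_eq[OF this] have "fd (\<lambda>y. \<phi>' y (vec2 a b)) x h = fd (\<lambda>y. \<phi> y (\<lambda>i. ?u i x)) (g x) (fd g x h)
         + (\<Sum>i<2. \<phi> (g x) ((\<lambda>i. ?u i x)(i := fd (?u i) x h)))" by simp
    also have "(\<Sum>i<2. \<phi> (g x) ((\<lambda>i. ?u i x)(i := fd (?u i) x h)))
        = \<phi> (g x) ((\<lambda>i. ?u i x)(0 := S a h)) + \<phi> (g x) ((\<lambda>i. ?u i x)(1 := S b h))"
      by (simp add: numeral_2_eq_2 S_def)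
    also have "\<phi> (g x) ((\<lambda>i. ?u i x)(0 := S a h)) = \<phi> (g x) (vec2 (S a h) (fd g x b))"
      by (rule alt_form_cong[OF alt]) (auto dest!: less_2_cases)
    also have "\<phi> (g x) ((\<lambda>i. ?u i x)(1 := S b h)) = \<phi> (g x) (vec2 (fd g x a) (S b h))"
      by (rule alt_form_cong[OF alt]) (auto dest!: less_2_cases)
    finally show ?thesis using fd_form_vec2[OF \<phi> gx, of "\<lambda>i. ?u i x"] by simp
  qed
  have "local_d 2 \<phi>' x v = local_d 2 \<phi> (g x) (\<lambda>i. fd g x (v i))"
    unfolding local_d_2[OF \<phi>' x] local_d_2[OF \<phi> gx] D
    using S_comm[of "v 1" "v 0"] S_comm[of "v 2" "v 0"] S_comm[of "v 2" "v 1"]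
      alt_form_2_swap[OF alt, of "S (v 0) (v 2)" "fd g x (v 1)"]
    by simp
  then show ?thesis by (simp add: \<phi>'_def)
qed

lemma alt_form_3_cyclic:
  fixes B :: "real^5 \<Rightarrow> real^5 \<Rightarrow> real^5 \<Rightarrow> real"
  assumes l: "\<And>q h. linear (\<lambda>p. B p q h)" "\<And>p h. linear (\<lambda>q. B p q h)" "\<And>p q. linear (\<lambda>h. B p q h)"
    and sw: "\<And>p q h. B p q h = - B q p h"
  shows "alternating_form 3 (\<lambda>v. B (v 1) (v 2) (v 0) - B (v 0) (v 2) (v 1) + B (v 0) (v 1) (v 2))"
  unfolding alternating_form_def
proof (intro conjI allI impI)
  have same: "B p p h = 0" for p h using sw[of p p h] by simp
  fix v :: "nat \<Rightarrow> real^5" and i :: nat assume "i < 3"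
  then consider "i = 0" | "i = 1" | "i = 2" using less_3_cases by blast
  then show "linear (\<lambda>u. B ((v(i := u)) 1) ((v(i := u)) 2) ((v(i := u)) 0)
      - B ((v(i := u)) 0) ((v(i := u)) 2) ((v(i := u)) 1) + B ((v(i := u)) 0) ((v(i := u)) 1) ((v(i := u)) 2))"
    by cases (auto intro!: linear_compose_add linear_compose_sub l)
  fix j :: nat assume "j < 3" "i \<noteq> j \<and> v i = v j"
  then show "B (v 1) (v 2) (v 0) - B (v 0) (v 2) (v 1) + B (v 0) (v 1) (v 2) = 0"
    using less_3_cases[OF \<open>i < 3\<close>] less_3_cases[OF \<open>j < 3\<close>] sw[of "v 0" "v 1" "v 2"]
      sw[of "v 1" "v 2" "v 0"] sw[of "v 0" "v 2" "v 1"] same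
    by (elim disjE conjE) (simp_all add: same)
qed simp

lemma local_form_local_d:
  assumes "local_form 2 U \<phi>"
  shows "local_form 3 U (local_d 2 \<phi>)"
  unfolding local_form_def
proof (intro conjI ballI allI)
  note lf = local_formD[OF assms]
  show "open U" by (rule lf)
  fix x assume x: "x \<in> U"
  have "alternating_form 3 (\<lambda>v. fd (\<lambda>y. \<phi> y (vec2 (v 1) (v 2))) x (v 0)
     - fd (\<lambda>y. \<phi> y (vec2 (v 0) (v 2))) x (v 1) + fd (\<lambda>y. \<phi> y (vec2 (v 0) (v 1))) x (v 2))"
    using alt_form_2_linear[OF alt_form_fd[OF assms x]]
      alt_form_2_swap[OF alt_form_fd[OF assms x]]
      fd_form_linear[OF assms x]
    by (intro alt_form_3_cyclic) blast+
  then show "alternating_form 3 (local_d 2 \<phi> x)"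
    unfolding local_d_2[OF assms x, abs_def, symmetric] .
next
  note lf = local_formD[OF assms]
  fix v
  show "smooth_on U (\<lambda>x. local_d 2 \<phi> x v)"
  proof (rule smooth_on_cong[OF lf(1)])
    show "smooth_on U (\<lambda>x. fd (\<lambda>y. \<phi> y (vec2 (v 1) (v 2))) x (v 0)
     - fd (\<lambda>y. \<phi> y (vec2 (v 0) (v 2))) x (v 1) + fd (\<lambda>y. \<phi> y (vec2 (v 0) (v 1))) x (v 2))"
      by (intro smooth_on_add smooth_on_diff smooth_on_fd lf)
  qed (simp add: local_d_2[OF assms])
qed

text \<open>The twelve second derivatives cancel in pairs by symmetry.\<close>
lemma local_d_local_d:
  assumes \<phi>: "local_form 2 U \<phi>" and x: "x \<in> U"
  shows "local_d 3 (local_d 2 \<phi>) x v = 0"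
proof -
  note lf = local_formD[OF \<phi>]
  define S where "S p q a h = fd (\<lambda>y. fd (\<lambda>z. \<phi> z (vec2 p q)) y a) x h" for p q a h
  have S_comm: "S p q a h = S p q h a" for p q a h
    unfolding S_def by (rule fd_commute[OF lf(1,3) x])
  have D: "fd (\<lambda>y. local_d 2 \<phi> y (vec3 a b c)) x h = S b c a h - S a c b h + S a b c h" for a b c h
  proof -
    have 1: "fd (\<lambda>y. local_d 2 \<phi> y (vec3 a b c)) x
        = fd (\<lambda>y. fd (\<lambda>z. \<phi> z (vec2 b c)) y a - fd (\<lambda>z. \<phi> z (vec2 a c)) y b + fd (\<lambda>z. \<phi> z (vec2 a b)) y c) x"
      by (rule fd_cong_open[OF lf(1) x]) (simp add: local_d_2[OF \<phi>])
    have "((\<lambda>y. fd (\<lambda>z. \<phi> z (vec2 p q)) y a) has_derivative S p q a) (at x)" for p q a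
      unfolding S_def by (rule smooth_on_has_derivative[OF smooth_on_fd[OF lf(3)] x])
    then have 2: "((\<lambda>y. fd (\<lambda>z. \<phi> z (vec2 b c)) y a - fd (\<lambda>z. \<phi> z (vec2 a c)) y b + fd (\<lambda>z. \<phi> z (vec2 a b)) y c)
        has_derivative (\<lambda>h. S b c a h - S a c b h + S a b c h)) (at x)"
      by (intro has_derivative_add has_derivative_diff) 
    show ?thesis unfolding 1 fd_eq[OF 2] by (rule refl)
  qed
  show ?thesis
    unfolding local_d_3[OF local_form_local_d[OF \<phi>] x] D
    using S_comm[of "v 2" "v 3" "v 1" "v 0"] S_comm[of "v 1" "v 3" "v 2" "v 0"] S_comm[of "v 1" "v 2" "v 3" "v 0"]
      S_comm[of "v 0" "v 3" "v 2" "v 1"] S_comm[of "v 0" "v 2" "v 3" "v 1"] S_comm[of "v 0" "v 1" "v 3" "v 2"]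
    by simp
qed

text \<open>Cartan's formula \<open>L\<^sub>w \<phi> = d (i\<^sub>w \<phi>) + i\<^sub>w (d \<phi>)\<close>. Of the derivatives of \<open>\<phi>\<close> on the right only the one along \<open>w\<close>
  survives; the derivatives of \<open>w\<close> agree after moving them to the slot that they replace.\<close>
proposition local_cartan:
  assumes \<phi>: "local_form 3 U \<phi>" and w: "smooth_on U w" and x: "x \<in> U"
  shows "fd (\<lambda>y. \<phi> y v) x (w x) + (\<Sum>i<3. \<phi> x (v(i := fd w x (v i))))
    = local_d 2 (\<lambda>y v. \<phi> y (case_nat (w y) v)) x v + local_d 3 \<phi> x (case_nat (w x) v)"
proof -
  note lf = local_formD[OF \<phi>]
  note alt = lf(2)[OF x]
  define \<iota> where "\<iota> = (\<lambda>y v. \<phi> y (case_nat (w y) v))"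
  have \<phi>': "local_form (Suc 2) U \<phi>" using \<phi> by (simp add: numeral_3_eq_3 numeral_2_eq_2)
  have \<iota>: "local_form 2 U \<iota>" unfolding \<iota>_def by (rule local_form_interior[OF \<phi>' w])
  have D: "fd (\<lambda>y. \<iota> y (vec2 a b)) x h = fd (\<lambda>y. \<phi> y (vec3 (w x) a b)) x h + \<phi> x (vec3 (fd w x h) a b)" for a b h
  proof -
    let ?u = "\<lambda>i y. vec3 (w y) a b i"
    have "((\<lambda>y. \<phi> y (\<lambda>i. ?u i y)) has_derivative (\<lambda>h. fd (\<lambda>y. \<phi> y (\<lambda>i. ?u i x)) x (fd (\<lambda>x. x) x h)
         + (\<Sum>i<3. \<phi> x ((\<lambda>i. ?u i x)(i := fd (?u i) x h))))) (at x)"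
    proof (rule form_substitution(2)[OF \<phi> lf(1) smooth_on_ident _ _ x])
      show "smooth_on U (\<lambda>y. vec3 (w y) a b i)" for i
        using w by (cases i) (auto simp: smooth_on_const vec3_def)
    qed simp
    from fd_eq[OF this] have "fd (\<lambda>y. \<iota> y (vec2 a b)) x h = fd (\<lambda>y. \<phi> y (\<lambda>i. ?u i x)) x h
         + (\<Sum>i<3. \<phi> x ((\<lambda>i. ?u i x)(i := fd (?u i) x h)))"
      by (simp add: \<iota>_def vec3_def)
    also have "(\<Sum>i<3. \<phi> x ((\<lambda>i. ?u i x)(i := fd (?u i) x h)))
        = \<phi> x ((\<lambda>i. ?u i x)(0 := fd w x h)) + \<phi> x ((\<lambda>i. ?u i x)(1 := 0)) + \<phi> x ((\<lambda>i. ?u i x)(2 := 0))"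
      by (simp add: numeral_3_eq_3 numeral_2_eq_2)
    also have "\<phi> x ((\<lambda>i. ?u i x)(1 := 0)) = 0"
      by (rule linear_0[OF alt_form_linear[OF alt]]) simp
    also have "\<phi> x ((\<lambda>i. ?u i x)(2 := 0)) = 0"
      by (rule linear_0[OF alt_form_linear[OF alt]]) simp
    also have "\<phi> x ((\<lambda>i. ?u i x)(0 := fd w x h)) = \<phi> x (vec3 (fd w x h) a b)"
      by (rule alt_form_cong[OF alt]) (auto dest!: less_3_cases)
    finally show ?thesis by simp
  qed
  have lie: "(\<Sum>i<3. \<phi> x (v(i := fd w x (v i)))) = \<phi> x (vec3 (fd w x (v 0)) (v 1) (v 2))
      + \<phi> x (vec3 (v 0) (fd w x (v 1)) (v 2)) + \<phi> x (vec3 (v 0) (v 1) (fd w x (v 2)))"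
    using alt_form_vec3[OF alt, of "v(0 := fd w x (v 0))"]
      alt_form_vec3[OF alt, of "v(1 := fd w x (v 1))"]
      alt_form_vec3[OF alt, of "v(2 := fd w x (v 2))"]
    by (simp add: numeral_3_eq_3 numeral_2_eq_2)
  have nat_case: "case_nat (w x) v 0 = w x" "case_nat (w x) v 1 = v 0" "case_nat (w x) v 2 = v 1"
    "case_nat (w x) v 3 = v 2"
    by (simp_all add: numeral_2_eq_2 numeral_3_eq_3)
  have "fd (\<lambda>y. \<phi> y v) x (w x) = fd (\<lambda>y. \<phi> y (vec3 (v 0) (v 1) (v 2))) x (w x)"
    by (rule fd_form_vec3[OF \<phi> x])
  then show ?thesis
    unfolding \<iota>_def[symmetric] local_d_2[OF \<iota> x] D local_d_3[OF \<phi> x] lie nat_case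
    using alt_form_3_swap[OF alt, of "fd w x (v 1)" "v 0" "v 2"]
      alt_form_3_swap[OF alt, of "fd w x (v 2)" "v 0" "v 1"]
      alt_form_3_swap[OF alt, of "v 0" "fd w x (v 2)" "v 1"]
    by simp
qed

text \<open>For closed \<open>\<alpha>\<close>, the form \<open>\<alpha> \<and> d\<beta>\<close> equals \<open>d(\<alpha> \<and> \<beta>)\<close>: it is a sum of derivatives of functions
  that vanish wherever \<open>\<beta>\<close> does. The factor 3 counts the summands of \<open>d\<beta>\<close>, which contribute equally under
  alternation.\<close>
lemma alternation_closed_wedge_d:
  assumes \<alpha>: "local_form 2 U \<alpha>" and \<beta>: "local_form 2 U \<beta>" and x: "x \<in> U"
    and closed: "\<And>v. local_d 2 \<alpha> x v = 0"
  shows "alternation 5 (\<lambda>u. \<alpha> x u * local_d 2 \<beta> x (\<lambda>i. u (2 + i))) v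
    = 3 * alternation 5 (\<lambda>u. fd (\<lambda>y. \<alpha> y u * \<beta> y (\<lambda>i. u (3 + i))) x (u 2)) v"
proof -
  \<comment> \<open>\<open>P\<close> and \<open>Q\<close> are the two terms of the product rule; the alternation of \<open>Q\<close> is a multiple of \<open>d\<alpha> \<and> \<beta> = 0\<close>.\<close>
  define P where "P u = \<alpha> x u * fd (\<lambda>y. \<beta> y (vec2 (u 3) (u 4))) x (u 2)" for u
  define Q where "Q u = fd (\<lambda>y. \<alpha> y (vec2 (u 0) (u 1))) x (u 2) * \<beta> x (\<lambda>i. u (3 + i))" for u
  \<comment> \<open>even permutations that carry the last summand of \<open>d\<beta>\<close>, and the first one of \<open>d\<alpha>\<close>, to the shape of \<open>P\<close> and \<open>Q\<close>\<close>
  define \<rho> :: "nat \<Rightarrow> nat" where "\<rho> = slot_swap 2 4 \<circ> slot_swap 4 3"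
  define \<sigma> :: "nat \<Rightarrow> nat" where "\<sigma> = slot_swap 0 1 \<circ> slot_swap 1 2"
  have perm: "\<rho> permutes {..<5}" "\<sigma> permutes {..<5}" unfolding \<rho>_def \<sigma>_def
    by (intro permutes_compose permutes_swap_id; simp)+
  have sgn: "sign \<rho> = 1" "sign \<sigma> = 1" unfolding \<rho>_def \<sigma>_def
    by (simp_all add: sign_compose permutation_swap_id sign_swap_id)
  have \<rho>: "\<rho> 0 = 0" "\<rho> 1 = 1" "\<rho> 2 = 4" "\<rho> 3 = 2" "\<rho> 4 = 3"
    by (simp_all add: \<rho>_def Transposition.transpose_def)
  have \<sigma>: "\<sigma> 0 = 1" "\<sigma> 1 = 2" "\<sigma> 2 = 0" "\<And>i. \<sigma> (3 + i) = 3 + i"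
    by (simp_all add: \<sigma>_def Transposition.transpose_def)
  note alt = local_formD(2)[OF \<alpha> x]
  have "\<alpha> x u * local_d 2 \<beta> x (\<lambda>i. u (2 + i))
      = P u - P (\<lambda>l. u (slot_swap 2 3 l)) + P (\<lambda>l. u (\<rho> l))" for u
  proof -
    have "\<alpha> x (\<lambda>l. u (slot_swap 2 3 l)) = \<alpha> x u"
      by (rule alt_form_cong[OF alt]) (auto dest!: less_2_cases simp: Transposition.transpose_def)
    moreover have "\<alpha> x (\<lambda>l. u (\<rho> l)) = \<alpha> x u"
      by (rule alt_form_cong[OF alt]) (use \<rho> in \<open>auto dest!: less_2_cases\<close>)
    moreover have "2 + 0 = (2::nat)" "2 + 1 = (3::nat)" "2 + 2 = (4::nat)" by simp_all
    ultimately show ?thesis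
      unfolding local_d_2[OF \<beta> x] by (simp only: P_def \<rho>) (simp add: Transposition.transpose_def algebra_simps)
  qed
  then have 1: "alternation 5 (\<lambda>u. \<alpha> x u * local_d 2 \<beta> x (\<lambda>i. u (2 + i))) v = 3 * alternation 5 P v"
    using alternation_permute_slots[OF perm(1), of P v] sgn
      alternation_transpose_slots[of 2 5 3 P v]
    by (simp add: alternation_add alternation_diff)
  have "0 = Q (\<lambda>l. u (\<sigma> l)) - Q (\<lambda>l. u (slot_swap 1 2 l)) + Q u" for u
  proof -
    have "0 = local_d 2 \<alpha> x u * \<beta> x (\<lambda>i. u (3 + i))" by (simp add: closed)
    also have "\<dots> = Q (\<lambda>l. u (\<sigma> l)) - Q (\<lambda>l. u (slot_swap 1 2 l)) + Q u"
      unfolding local_d_2[OF \<alpha> x] using \<sigma> by (simp add: Q_def Transposition.transpose_def algebra_simps)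
    finally show ?thesis .
  qed
  then have "alternation 5 (\<lambda>u. 0) v
      = alternation 5 (\<lambda>u. Q (\<lambda>l. u (\<sigma> l)) - Q (\<lambda>l. u (slot_swap 1 2 l)) + Q u) v"
    by presburger
  then have 2: "alternation 5 Q v = 0"
    using alternation_permute_slots[OF perm(2), of Q v] sgn
      alternation_transpose_slots[of 1 5 2 Q v]
    by (simp add: alternation_add alternation_diff alternation_zero)
  have "fd (\<lambda>y. \<alpha> y u * \<beta> y (\<lambda>i. u (3 + i))) x (u 2) = P u + Q u" for u
  proof -
    have "fd (\<lambda>y. \<alpha> y u * \<beta> y (\<lambda>i. u (3 + i))) x (u 2)
        = \<alpha> x u * fd (\<lambda>y. \<beta> y (\<lambda>i. u (3 + i))) x (u 2) + fd (\<lambda>y. \<alpha> y u) x (u 2) * \<beta> x (\<lambda>i. u (3 + i))"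
      using fd_eq[OF has_derivative_mult[OF local_formD(4)[OF \<alpha> x] local_formD(4)[OF \<beta> x]]] by simp
    also have "fd (\<lambda>y. \<beta> y (\<lambda>i. u (3 + i))) x (u 2) = fd (\<lambda>y. \<beta> y (vec2 (u 3) (u 4))) x (u 2)"
      using fd_form_vec2[OF \<beta> x, of "\<lambda>i. u (3 + i)"] by simp
    also have "fd (\<lambda>y. \<alpha> y u) x (u 2) = fd (\<lambda>y. \<alpha> y (vec2 (u 0) (u 1))) x (u 2)"
      by (rule fd_form_vec2[OF \<alpha> x])
    finally show ?thesis by (simp add: P_def Q_def)
  qed
  then show ?thesis using 1 2 by (simp add: alternation_add)
qed

section \<open>Charts, forms and pull-backs on a manifold\<close>

lemma local_d_cong:
  assumes "open T" "x \<in> T" "\<And>y v. y \<in> T \<Longrightarrow> \<phi> y v = \<psi> y v"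
  shows "local_d k \<phi> x v = local_d k \<psi> x v"
proof -
  have "fd (\<lambda>y. \<phi> y u) x = fd (\<lambda>y. \<psi> y u) x" for u
    by (rule fd_cong_open[OF assms(1,2)]) (rule assms(3))
  then show ?thesis by (simp add: local_d_def)
qed

lemma local_form_local:
  assumes "open U" "\<And>x. x \<in> U \<Longrightarrow> \<exists>T \<psi>. x \<in> T \<and> local_form k T \<psi> \<and> (\<forall>y\<in>T. \<forall>v. \<psi> y v = \<phi> y v)"
  shows "local_form k U \<phi>"
  unfolding local_form_def
proof (intro conjI ballI allI)
  show "open U" by fact
  fix x assume "x \<in> U"
  from assms(2)[OF this] obtain T \<psi> where "x \<in> T" "local_form k T \<psi>" "\<forall>y\<in>T. \<forall>v. \<psi> y v = \<phi> y v" by blast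
  then have "alternating_form k (\<psi> x)" "\<psi> x = \<phi> x" by (auto simp: local_form_def)
  then show "alternating_form k (\<phi> x)" by simp
next
  fix v show "smooth_on U (\<lambda>x. \<phi> x v)"
  proof (rule smooth_on_local)
    fix x assume "x \<in> U"
    from assms(2)[OF this] obtain T \<psi> where *: "x \<in> T" "local_form k T \<psi>" "\<forall>y\<in>T. \<forall>v. \<psi> y v = \<phi> y v" by blast
    then have "smooth_on T (\<lambda>x. \<phi> x v)"
      using smooth_on_cong[of T "\<lambda>x. \<psi> x v" "\<lambda>x. \<phi> x v"] by (simp add: local_form_def)
    then show "\<exists>T. open T \<and> x \<in> T \<and> smooth_on T (\<lambda>x. \<phi> x v)"
      using * by (auto simp: local_form_def)
  qed
qed

lemma diff_forms_compat:
  assumes "\<phi> \<in> diff_forms A k" "c \<in> A" "c' \<in> A" "x \<in> local_dom c c' id"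
  shows "\<phi> c x v = \<phi> c' (local_rep c c' id x) (\<lambda>i. local_deriv c c' id x (v i))"
  using assms unfolding diff_forms_def by blast

lemma diff_forms_zero:
  assumes "\<phi> \<in> diff_forms A k" "\<not> (c \<in> A \<and> x \<in> chart_image c)"
  shows "\<phi> c x v = 0"
  using assms unfolding diff_forms_def by blast

lemma ext_deriv_eq_local_d:
  "ext_deriv A k \<phi> c x v = (if c \<in> A \<and> x \<in> chart_image c then local_d k (\<phi> c) x v else 0)"
  by (simp add: ext_deriv_def local_d_def)

locale closed_5_manifold =
  fixes M :: "'m::t2_space set" and A :: "'m chart set"
  assumes manifold: "compact_oriented_5_manifold M A"
begin

lemma compact_M: "compact M"
  using manifold by (simp add: compact_oriented_5_manifold_def)

lemma chart_cover: "p \<in> M \<Longrightarrow> \<exists>c\<in>A. p \<in> fst c"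
  using manifold unfolding compact_oriented_5_manifold_def by blast

context
  fixes c assumes c: "c \<in> A"
begin

lemma open_chart_image: "open (chart_image c)"
  and chart_homeomorphism: "homeomorphism (fst c) (chart_image c) (snd c) (chart_inv c)"
  and openin_chart: "openin (top_of_set M) (fst c)"
  using manifold c by (auto simp: compact_oriented_5_manifold_def)

lemma chart_subset: "fst c \<subseteq> M"
  using openin_chart openin_subset by fastforce

lemma chart_inv_snd: "p \<in> fst c \<Longrightarrow> chart_inv c (snd c p) = p"
  and snd_chart_inv: "x \<in> chart_image c \<Longrightarrow> snd c (chart_inv c x) = x"
  using chart_homeomorphism by (auto simp: homeomorphism_def)

lemma snd_in_chart_image: "p \<in> fst c \<Longrightarrow> snd c p \<in> chart_image c"
  by (simp add: chart_image_def)

lemma chart_inv_in: "x \<in> chart_image c \<Longrightarrow> chart_inv c x \<in> fst c"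
  and chart_inv_in_M: "x \<in> chart_image c \<Longrightarrow> chart_inv c x \<in> M"
  using chart_inv_snd chart_subset by (force simp: chart_image_def)+

lemma continuous_chart_inv: "continuous_on (chart_image c) (chart_inv c)"
  and continuous_chart: "continuous_on (fst c) (snd c)"
  using chart_homeomorphism by (auto simp: homeomorphism_def)

lemma local_dom_iff: "x \<in> local_dom c d f \<longleftrightarrow> x \<in> chart_image c \<and> f (chart_inv c x) \<in> fst d"
proof
  show "x \<in> chart_image c \<and> f (chart_inv c x) \<in> fst d" if "x \<in> local_dom c d f"
    using that chart_inv_snd by (auto simp: local_dom_def chart_image_def)
  show "x \<in> local_dom c d f" if "x \<in> chart_image c \<and> f (chart_inv c x) \<in> fst d"
    using that chart_inv_in snd_chart_inv unfolding local_dom_def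
    by (intro image_eqI[of _ _ "chart_inv c x"]) auto
qed

end

lemma openin_vimage_chart:
  assumes "c \<in> A" "openin (top_of_set M) S" "continuous_on M f" "f ` M \<subseteq> M"
  shows "open {x \<in> chart_image c. f (chart_inv c x) \<in> S}"
proof -
  obtain T where T: "open T" "S = M \<inter> T" using assms(2) by (auto simp: openin_open)
  have "continuous_on (chart_image c) (\<lambda>x. f (chart_inv c x))"
    using chart_inv_in_M[OF assms(1)]
    by (intro continuous_on_compose2[OF assms(3) continuous_chart_inv[OF assms(1)]]) auto
  then have "open (chart_image c \<inter> (\<lambda>x. f (chart_inv c x)) -` T)"
    using open_chart_image[OF assms(1)] T(1) by (simp add: continuous_on_open_vimage Int_commute)
  also have "chart_image c \<inter> (\<lambda>x. f (chart_inv c x)) -` T = {x \<in> chart_image c. f (chart_inv c x) \<in> S}"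
    using T(2) chart_inv_in_M[OF assms(1)] assms(4) by auto
  finally show ?thesis .
qed

lemma open_chart_minus_compact:
  assumes c: "c \<in> A" and K: "compact K"
  shows "open {x \<in> chart_image c. chart_inv c x \<notin> K}"
proof -
  have "openin (top_of_set M) (M - K)"
    using compact_imp_closed[OF K] by (auto simp: openin_open)
  from openin_vimage_chart[OF c this continuous_on_id] show ?thesis
    using chart_inv_in_M[OF c] by (simp add: conj_commute cong: conj_cong)
qed

lemma smooth_mapD:
  assumes "smooth_map M A f"
  shows "f ` M \<subseteq> M" "continuous_on M f"
    "\<And>c c'. c \<in> A \<Longrightarrow> c' \<in> A \<Longrightarrow> smooth_on (local_dom c c' f) (local_rep c c' f)"
  using assms by (auto simp: smooth_map_def)

lemma open_local_dom:
  assumes "smooth_map M A f" "c \<in> A" "d \<in> A"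
  shows "open (local_dom c d f)"
proof -
  have "local_dom c d f = {x \<in> chart_image c. f (chart_inv c x) \<in> fst d}"
    using local_dom_iff[OF assms(2)] by blast
  then show ?thesis
    using openin_vimage_chart[OF assms(2) openin_chart[OF assms(3)] smooth_mapD(2,1)[OF assms(1)]] by simp
qed

lemma smooth_map_id: "smooth_map M A id"
  using manifold by (auto simp: smooth_map_def compact_oriented_5_manifold_def)

lemma local_rep_in: "c \<in> A \<Longrightarrow> d \<in> A \<Longrightarrow> x \<in> local_dom c d f \<Longrightarrow> local_rep c d f x \<in> chart_image d"
  using snd_in_chart_image local_dom_iff by (simp add: local_rep_def)

lemma local_rep_image: "c \<in> A \<Longrightarrow> d \<in> A \<Longrightarrow> local_rep c d f ` local_dom c d f \<subseteq> chart_image d"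
  using local_rep_in by blast

lemma chart_inv_local_rep:
  "c \<in> A \<Longrightarrow> d \<in> A \<Longrightarrow> x \<in> local_dom c d f \<Longrightarrow> chart_inv d (local_rep c d f x) = f (chart_inv c x)"
  using chart_inv_snd local_dom_iff by (simp add: local_rep_def)

lemma local_rep_has_derivative:
  "smooth_map M A f \<Longrightarrow> c \<in> A \<Longrightarrow> d \<in> A \<Longrightarrow> x \<in> local_dom c d f \<Longrightarrow>
    (local_rep c d f has_derivative local_deriv c d f x) (at x)"
  unfolding local_deriv_def using smooth_mapD(3) smooth_on_has_derivative by blast

lemma linear_local_deriv:
  "smooth_map M A f \<Longrightarrow> c \<in> A \<Longrightarrow> d \<in> A \<Longrightarrow> x \<in> local_dom c d f \<Longrightarrow> linear (local_deriv c d f x)"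
  using has_derivative_linear[OF local_rep_has_derivative] .

text \<open>The chain rule in charts; with one of the maps the identity it compares local representatives in
  different charts.\<close>
lemma local_rep_compose:
  assumes f: "smooth_map M A f" and h: "smooth_map M A h"
    and c: "c \<in> A" "c' \<in> A" "d \<in> A"
    and x: "x \<in> local_dom c c' f" and hx: "h (f (chart_inv c x)) \<in> fst d"
  shows "local_rep c c' f x \<in> local_dom c' d h"
    and "local_rep c d (h \<circ> f) x = local_rep c' d h (local_rep c c' f x)"
    and "local_deriv c d (h \<circ> f) x v = local_deriv c' d h (local_rep c c' f x) (local_deriv c c' f x v)"
proof -
  let ?T = "local_dom c c' f"
  have eq: "local_rep c d (h \<circ> f) y = local_rep c' d h (local_rep c c' f y)" if "y \<in> ?T" for y
    using chart_inv_local_rep[OF c(1,2) that] unfolding local_rep_def by (simp add: local_rep_def)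
  show in_dom: "local_rep c c' f x \<in> local_dom c' d h"
    unfolding local_dom_iff[OF c(2)] chart_inv_local_rep[OF c(1,2) x]
    using local_rep_in[OF c(1,2) x] hx by simp
  show "local_rep c d (h \<circ> f) x = local_rep c' d h (local_rep c c' f x)" by (rule eq[OF x])
  have "((\<lambda>y. local_rep c' d h (local_rep c c' f y)) has_derivative
      (\<lambda>v. local_deriv c' d h (local_rep c c' f x) (local_deriv c c' f x v))) (at x)"
    by (rule has_derivative_compose[OF local_rep_has_derivative[OF f c(1,2) x]
          local_rep_has_derivative[OF h c(2,3) in_dom]])
  then have "(local_rep c d (h \<circ> f) has_derivative
      (\<lambda>v. local_deriv c' d h (local_rep c c' f x) (local_deriv c c' f x v))) (at x)"
    by (rule has_derivative_transform_within_open[OF _ open_local_dom[OF f c(1,2)] x]) (simp add: eq)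
  then show "local_deriv c d (h \<circ> f) x v = local_deriv c' d h (local_rep c c' f x) (local_deriv c c' f x v)"
    unfolding local_deriv_def[of c d] using fd_eq by metis
qed

lemma forms_local: "\<phi> \<in> diff_forms A k \<Longrightarrow> c \<in> A \<Longrightarrow> local_form k (chart_image c) (\<phi> c)"
  unfolding diff_forms_def local_form_def using open_chart_image by blast

lemma diff_formsI:
  assumes "\<And>c. c \<in> A \<Longrightarrow> local_form k (chart_image c) (\<phi> c)"
    and "\<And>c c' x v. c \<in> A \<Longrightarrow> c' \<in> A \<Longrightarrow> x \<in> local_dom c c' id \<Longrightarrow>
        \<phi> c x v = \<phi> c' (local_rep c c' id x) (\<lambda>i. local_deriv c c' id x (v i))"
    and "\<And>c x v. \<not> (c \<in> A \<and> x \<in> chart_image c) \<Longrightarrow> \<phi> c x v = 0"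
  shows "\<phi> \<in> diff_forms A k"
  unfolding diff_forms_def using assms by (auto simp: local_form_def)

lemma target_chart:
  assumes "smooth_map M A f" "c \<in> A" "x \<in> chart_image c"
  shows "target_chart A f c x \<in> A" "x \<in> local_dom c (target_chart A f c x) f"
proof -
  have "f (chart_inv c x) \<in> M"
    using smooth_mapD(1)[OF assms(1)] chart_inv_in_M[OF assms(2,3)] by blast
  then have "\<exists>c'. c' \<in> A \<and> f (chart_inv c x) \<in> fst c'" using chart_cover by blast
  from someI_ex[OF this, folded target_chart_def]
  show "target_chart A f c x \<in> A" "x \<in> local_dom c (target_chart A f c x) f"
    using local_dom_iff[OF assms(2)] assms(3) by auto
qed

text \<open>Frees the pull-back from the chosen target chart.\<close>
lemma pullback_form_eq:
  assumes f: "smooth_map M A f" and \<phi>: "\<phi> \<in> diff_forms A k"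
    and c: "c \<in> A" "d \<in> A" and x: "x \<in> local_dom c d f"
  shows "pullback_form A f \<phi> c x v = \<phi> d (local_rep c d f x) (\<lambda>i. local_deriv c d f x (v i))"
proof -
  have xc: "x \<in> chart_image c" "f (chart_inv c x) \<in> fst d" using x local_dom_iff[OF c(1)] by auto
  define c' where "c' = target_chart A f c x"
  have c': "c' \<in> A" "x \<in> local_dom c c' f" using target_chart[OF f c(1) xc(1)] by (auto simp: c'_def)
  have "pullback_form A f \<phi> c x v = \<phi> c' (local_rep c c' f x) (\<lambda>i. local_deriv c c' f x (v i))"
    using c xc by (simp add: pullback_form_def c'_def Let_def)
  also have "\<dots> = \<phi> d (local_rep c d f x) (\<lambda>i. local_deriv c d f x (v i))"
    using local_rep_compose[where f=f and h=id, OF f smooth_map_id c(1) c'(1) c(2) c'(2)] xc(2)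
      diff_forms_compat[OF \<phi> c'(1) c(2)] by simp
  finally show ?thesis .
qed

lemma ex_target: "smooth_map M A f \<Longrightarrow> c \<in> A \<Longrightarrow> x \<in> chart_image c \<Longrightarrow> \<exists>d\<in>A. x \<in> local_dom c d f"
  using target_chart by blast

lemma transform_local_form:
  assumes f: "smooth_map M A f" and \<phi>: "local_form k (chart_image d) \<phi>" and c: "c \<in> A" "d \<in> A"
  shows "local_form k (local_dom c d f) (\<lambda>x v. \<phi> (local_rep c d f x) (\<lambda>i. local_deriv c d f x (v i)))"
  unfolding local_deriv_def
  by (rule local_form_pullback[OF \<phi> open_local_dom[OF f c] smooth_mapD(3)[OF f c] local_rep_image[OF c]])

lemma pullback_form_in_diff_forms:
  assumes f: "smooth_map M A f" and \<phi>: "\<phi> \<in> diff_forms A k"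
  shows "pullback_form A f \<phi> \<in> diff_forms A k"
proof (rule diff_formsI)
  fix c assume c: "c \<in> A"
  show "local_form k (chart_image c) (pullback_form A f \<phi> c)"
  proof (rule local_form_local[OF open_chart_image[OF c]])
    fix x assume "x \<in> chart_image c"
    then obtain d where d: "d \<in> A" "x \<in> local_dom c d f" using ex_target[OF f c] by blast
    show "\<exists>T \<psi>. x \<in> T \<and> local_form k T \<psi> \<and> (\<forall>y\<in>T. \<forall>v. \<psi> y v = pullback_form A f \<phi> c y v)"
      by (intro exI conjI ballI allI)
         (rule d(2), rule transform_local_form[OF f forms_local[OF \<phi> d(1)] c d(1)],
          rule pullback_form_eq[OF f \<phi> c d(1), symmetric])
  qed
next
  fix c c' x v assume c: "c \<in> A" "c' \<in> A" and x: "x \<in> local_dom c c' id"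
  then have xc: "x \<in> chart_image c" using local_dom_iff by blast
  then obtain d where d: "d \<in> A" "x \<in> local_dom c d f" using ex_target[OF f c(1)] by blast
  then have ftarget: "f (id (chart_inv c x)) \<in> fst d" using local_dom_iff[OF c(1)] by simp
  note comp = local_rep_compose[where f=id and h=f, OF smooth_map_id f c d(1) x ftarget]
  show "pullback_form A f \<phi> c x v
      = pullback_form A f \<phi> c' (local_rep c c' id x) (\<lambda>i. local_deriv c c' id x (v i))"
    using pullback_form_eq[OF f \<phi> c(1) d] pullback_form_eq[OF f \<phi> c(2) d(1) comp(1)] comp(2,3)
    by (simp del: id_apply add: comp_id)
qed (auto simp: pullback_form_def)

lemma local_d_transform:
  assumes f: "smooth_map M A f" and \<sigma>: "local_form 2 (chart_image d) \<sigma>" and c: "c \<in> A" "d \<in> A"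
    and \<psi>: "\<And>y v. y \<in> local_dom c d f \<Longrightarrow> \<psi> y v = \<sigma> (local_rep c d f y) (\<lambda>i. local_deriv c d f y (v i))"
    and x: "x \<in> local_dom c d f"
  shows "local_d 2 \<psi> x v = local_d 2 \<sigma> (local_rep c d f x) (\<lambda>i. local_deriv c d f x (v i))"
proof -
  have "local_d 2 \<psi> x v = local_d 2 (\<lambda>y v. \<sigma> (local_rep c d f y) (\<lambda>i. local_deriv c d f y (v i))) x v"
    by (rule local_d_cong[OF open_local_dom[OF f c] x \<psi>])
  also have "\<dots> = local_d 2 \<sigma> (local_rep c d f x) (\<lambda>i. local_deriv c d f x (v i))"
    unfolding local_deriv_def
    by (rule local_d_pullback[OF \<sigma> open_local_dom[OF f c] smooth_mapD(3)[OF f c] local_rep_image[OF c] x])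
  finally show ?thesis .
qed

lemma ext_deriv_in_diff_forms:
  assumes \<phi>: "\<phi> \<in> diff_forms A 2"
  shows "ext_deriv A 2 \<phi> \<in> diff_forms A 3"
proof (rule diff_formsI)
  fix c assume c: "c \<in> A"
  have l: "local_form 3 (chart_image c) (local_d 2 (\<phi> c))"
    by (rule local_form_local_d[OF forms_local[OF \<phi> c]])
  show "local_form 3 (chart_image c) (ext_deriv A 2 \<phi> c)"
    by (rule local_form_local[OF open_chart_image[OF c]])
       (use l c in \<open>auto simp: ext_deriv_eq_local_d intro!: exI[of _ "chart_image c"] exI[of _ "local_d 2 (\<phi> c)"]\<close>)
next
  fix c c' x v assume c: "c \<in> A" "c' \<in> A" and x: "x \<in> local_dom c c' id"
  then show "ext_deriv A 2 \<phi> c x v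
      = ext_deriv A 2 \<phi> c' (local_rep c c' id x) (\<lambda>i. local_deriv c c' id x (v i))"
    using local_d_transform[OF smooth_map_id forms_local[OF \<phi> c(2)] c diff_forms_compat[OF \<phi> c] x]
      local_dom_iff[OF c(1)] local_rep_in[OF c x] by (simp add: ext_deriv_eq_local_d)
qed (auto simp: ext_deriv_eq_local_d)

lemma ext_deriv_pullback:
  assumes f: "smooth_map M A f" and \<phi>: "\<phi> \<in> diff_forms A 2"
  shows "ext_deriv A 2 (pullback_form A f \<phi>) = pullback_form A f (ext_deriv A 2 \<phi>)"
proof (intro ext)
  fix c x v
  show "ext_deriv A 2 (pullback_form A f \<phi>) c x v = pullback_form A f (ext_deriv A 2 \<phi>) c x v"
  proof (cases "c \<in> A \<and> x \<in> chart_image c")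
    case True
    then obtain d where d: "d \<in> A" "x \<in> local_dom c d f" using ex_target[OF f] by blast
    have c: "c \<in> A" using True by simp
    have "local_d 2 (pullback_form A f \<phi> c) x v
        = local_d 2 (\<phi> d) (local_rep c d f x) (\<lambda>i. local_deriv c d f x (v i))"
      by (rule local_d_transform[OF f forms_local[OF \<phi> d(1)] c d(1) pullback_form_eq[OF f \<phi> c d(1)] d(2)])
    then show ?thesis
      using pullback_form_eq[OF f ext_deriv_in_diff_forms[OF \<phi>] c d] True d(1) local_rep_in[OF c d]
      by (simp add: ext_deriv_eq_local_d)
  next
    case False
    then show ?thesis by (auto simp: ext_deriv_eq_local_d pullback_form_def)
  qed
qed

lemma ext_deriv_closed:
  assumes \<phi>: "\<phi> \<in> diff_forms A 2" and c: "c \<in> A" and x: "x \<in> chart_image c"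
  shows "local_d 3 (ext_deriv A 2 \<phi> c) x v = 0"
proof -
  have "local_d 3 (ext_deriv A 2 \<phi> c) x v = local_d 3 (local_d 2 (\<phi> c)) x v"
    by (rule local_d_cong[OF open_chart_image[OF c] x]) (simp add: ext_deriv_eq_local_d c)
  then show ?thesis using local_d_local_d[OF forms_local[OF \<phi> c] x] by simp
qed

lemma vector_fieldsD:
  assumes "w \<in> vector_fields A"
  shows "\<And>c. c \<in> A \<Longrightarrow> smooth_on (chart_image c) (w c)"
    and "\<And>c c' x. c \<in> A \<Longrightarrow> c' \<in> A \<Longrightarrow> x \<in> local_dom c c' id \<Longrightarrow>
        w c' (local_rep c c' id x) = local_deriv c c' id x (w c x)"
  using assms by (auto simp: vector_fields_def)

lemma interior_product_transform:
  assumes "\<And>v. \<phi> c x v = \<phi>' d y (\<lambda>i. L (v i))" "w' d y = L (w c x)"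
  shows "interior_product w \<phi> c x v = interior_product w' \<phi>' d y (\<lambda>i. L (v i))"
proof -
  have "(\<lambda>i. L (case_nat (w c x) v i)) = case_nat (L (w c x)) (\<lambda>i. L (v i))"
    by (auto split: nat.split)
  then show ?thesis using assms by (simp add: interior_product_def)
qed

lemma wedge_transform:
  assumes "\<And>v. \<alpha> c x v = \<alpha>' d y (\<lambda>i. L (v i))" "\<And>v. \<beta> c x v = \<beta>' d y (\<lambda>i. L (v i))"
  shows "wedge p q \<alpha> \<beta> c x v = wedge p q \<alpha>' \<beta>' d y (\<lambda>i. L (v i))"
  by (simp add: wedge_def assms)

lemma interior_product_in_diff_forms:
  assumes w: "w \<in> vector_fields A" and \<phi>: "\<phi> \<in> diff_forms A (Suc k)"
  shows "interior_product w \<phi> \<in> diff_forms A k"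
proof (rule diff_formsI)
  fix c assume c: "c \<in> A"
  show "local_form k (chart_image c) (interior_product w \<phi> c)"
    using local_form_interior[OF forms_local[OF \<phi> c] vector_fieldsD(1)[OF w c]]
    by (simp add: interior_product_def[abs_def])
next
  fix c c' x v assume c: "c \<in> A" "c' \<in> A" and x: "x \<in> local_dom c c' id"
  show "interior_product w \<phi> c x v
      = interior_product w \<phi> c' (local_rep c c' id x) (\<lambda>i. local_deriv c c' id x (v i))"
    by (rule interior_product_transform[where \<phi>=\<phi> and \<phi>'=\<phi> and c=c and x=x and d=c'
          and y="local_rep c c' id x" and L="local_deriv c c' id x" and w=w and w'=w, OF diff_forms_compat[OF \<phi> c x] vector_fieldsD(2)[OF w c x]])
qed (use diff_forms_zero[OF \<phi>] in \<open>simp add: interior_product_def\<close>)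

lemma smooth_on_wedge:
  assumes "open U" "\<And>v. smooth_on U (\<lambda>x. \<alpha> c x v)" "\<And>v. smooth_on U (\<lambda>x. \<beta> c x v)"
  shows "smooth_on U (\<lambda>x. wedge p q \<alpha> \<beta> c x v)"
  unfolding wedge_def divide_inverse
  by (intro smooth_on_mult smooth_on_sum smooth_on_const assms)

lemma wedge_in_diff_forms:
  assumes \<alpha>: "\<alpha> \<in> diff_forms A p" and \<beta>: "\<beta> \<in> diff_forms A q"
  shows "wedge p q \<alpha> \<beta> \<in> diff_forms A (p + q)"
proof (rule diff_formsI)
  fix c assume c: "c \<in> A"
  note a = forms_local[OF \<alpha> c] and b = forms_local[OF \<beta> c]
  show "local_form (p + q) (chart_image c) (wedge p q \<alpha> \<beta> c)"
    unfolding local_form_def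
    using alt_form_wedge[where \<alpha>=\<alpha> and \<beta>=\<beta> and c=c, OF local_formD(2)[OF a] local_formD(2)[OF b]]
      smooth_on_wedge[where \<alpha>=\<alpha> and \<beta>=\<beta> and c=c, OF open_chart_image[OF c] local_formD(3)[OF a] local_formD(3)[OF b]]
      open_chart_image[OF c] by blast
next
  fix c c' x v assume c: "c \<in> A" "c' \<in> A" and x: "x \<in> local_dom c c' id"
  show "wedge p q \<alpha> \<beta> c x v = wedge p q \<alpha> \<beta> c' (local_rep c c' id x) (\<lambda>i. local_deriv c c' id x (v i))"
    by (rule wedge_transform[where \<alpha>=\<alpha> and \<alpha>'=\<alpha> and \<beta>=\<beta> and \<beta>'=\<beta> and c=c and x=x and d=c'
          and y="local_rep c c' id x" and L="local_deriv c c' id x", OF diff_forms_compat[OF \<alpha> c x] diff_forms_compat[OF \<beta> c x]])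
qed (use diff_forms_zero[OF \<alpha>] in \<open>simp add: wedge_def\<close>)

lemma interior_product_3:
  assumes "w \<in> vector_fields A" "\<phi> \<in> diff_forms A 3"
  shows "interior_product w \<phi> \<in> diff_forms A 2"
  using interior_product_in_diff_forms[OF assms(1), of \<phi> 2] assms(2) by simp

lemma form_star_in_diff_forms:
  assumes "w \<in> vector_fields A" "\<phi> \<in> diff_forms A 3"
  shows "form_star \<phi> w \<in> diff_forms A 5"
  using wedge_in_diff_forms[OF assms(2) interior_product_3[OF assms]] by (simp add: form_star_def)

definition smooth_function :: "('m \<Rightarrow> real) \<Rightarrow> bool" where
  "smooth_function \<eta> \<longleftrightarrow> (\<forall>c\<in>A. smooth_on (chart_image c) (\<lambda>x. \<eta> (chart_inv c x)))"

lemma function_multiple_in_diff_forms: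
  assumes \<eta>: "smooth_function \<eta>" and \<phi>: "\<phi> \<in> diff_forms A k"
  shows "(\<lambda>c x v. \<eta> (chart_inv c x) * \<phi> c x v) \<in> diff_forms A k"
proof (rule diff_formsI)
  fix c assume c: "c \<in> A"
  note lf = local_formD[OF forms_local[OF \<phi> c]]
  have "alternating_form k (\<lambda>v. r * \<phi> c x v)" if "x \<in> chart_image c" for r x
    using alt_form_divide[OF lf(2)[OF that], of "inverse r"] by (simp add: divide_inverse mult.commute)
  moreover have "smooth_on (chart_image c) (\<lambda>x. \<eta> (chart_inv c x) * \<phi> c x v)" for v
    using \<eta> c lf by (intro smooth_on_mult) (auto simp: smooth_function_def)
  ultimately show "local_form k (chart_image c) (\<lambda>x v. \<eta> (chart_inv c x) * \<phi> c x v)"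
    using lf(1) by (simp add: local_form_def)
next
  fix c c' x v assume c: "c \<in> A" "c' \<in> A" and x: "x \<in> local_dom c c' id"
  show "\<eta> (chart_inv c x) * \<phi> c x v = \<eta> (chart_inv c' (local_rep c c' id x)) *
      \<phi> c' (local_rep c c' id x) (\<lambda>i. local_deriv c c' id x (v i))"
    using diff_forms_compat[OF \<phi> c x] chart_inv_local_rep[OF c x] by simp
qed (use diff_forms_zero[OF \<phi>] in simp)

lemma alt_form_diff:
  "alternating_form k \<alpha> \<Longrightarrow> alternating_form k \<beta> \<Longrightarrow> alternating_form k (\<lambda>v. \<alpha> v - \<beta> v)"
  unfolding alternating_form_def by (auto intro!: linear_compose_sub) metis

lemma diff_in_diff_forms:
  assumes \<phi>: "\<phi> \<in> diff_forms A k" and \<psi>: "\<psi> \<in> diff_forms A k"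
  shows "(\<lambda>c x v. \<phi> c x v - \<psi> c x v) \<in> diff_forms A k"
proof (rule diff_formsI)
  fix c assume c: "c \<in> A"
  note lf = local_formD[OF forms_local[OF \<phi> c]] local_formD[OF forms_local[OF \<psi> c]]
  show "local_form k (chart_image c) (\<lambda>x v. \<phi> c x v - \<psi> c x v)"
    unfolding local_form_def using lf by (auto intro!: alt_form_diff smooth_on_diff)
qed (use diff_forms_compat[OF \<phi>] diff_forms_compat[OF \<psi>] diff_forms_zero[OF \<phi>] diff_forms_zero[OF \<psi>] in auto)

lemma ext_deriv_diff:
  assumes \<phi>: "\<phi> \<in> diff_forms A k" and \<psi>: "\<psi> \<in> diff_forms A k"
  shows "ext_deriv A k (\<lambda>c x v. \<phi> c x v - \<psi> c x v) c x v = ext_deriv A k \<phi> c x v - ext_deriv A k \<psi> c x v"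
proof (cases "c \<in> A \<and> x \<in> chart_image c")
  case True
  then have "fd (\<lambda>y. \<phi> c y u - \<psi> c y u) x h = fd (\<lambda>y. \<phi> c y u) x h - fd (\<lambda>y. \<psi> c y u) x h" for u h
    using fd_eq[OF has_derivative_diff[OF local_formD(4)[OF forms_local[OF \<phi>]]
          local_formD(4)[OF forms_local[OF \<psi>]]]] by simp
  then show ?thesis using True by (simp add: ext_deriv_def right_diff_distrib sum_subtractf)
qed (auto simp: ext_deriv_def)

text \<open>In Cartan's formula the term with \<open>d\<phi>\<close> drops out.\<close>
lemma lie_deriv_closed:
  assumes w: "w \<in> vector_fields A" and \<phi>: "\<phi> \<in> diff_forms A 3"
    and closed: "\<And>c x v. c \<in> A \<Longrightarrow> x \<in> chart_image c \<Longrightarrow> local_d 3 (\<phi> c) x v = 0"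
  shows "lie_deriv A 3 w \<phi> = ext_deriv A 2 (interior_product w \<phi>)"
proof (intro ext)
  fix c x v
  show "lie_deriv A 3 w \<phi> c x v = ext_deriv A 2 (interior_product w \<phi>) c x v"
    using local_cartan[OF forms_local[OF \<phi>] vector_fieldsD(1)[OF w], of c x v] closed[of c x]
    by (simp add: lie_deriv_def ext_deriv_eq_local_d interior_product_def[abs_def])
qed

text \<open>The vector field \<open>f\<^sup>*w\<close> is the one that the derivative of \<open>f\<close> maps to \<open>w\<close>, and both operations in
  \<open>\<phi> \<and> i\<^sub>w\<phi>\<close> are natural under linear maps.\<close>
lemma form_star_pullback:
  assumes f: "f \<in> oriented_diffeos M A" and w: "w \<in> vector_fields A" and \<phi>: "\<phi> \<in> diff_forms A 3"
  shows "form_star (pullback_form A f \<phi>) (pullback_vfield A f w) = pullback_form A f (form_star \<phi> w)"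
proof (intro ext)
  have sm: "smooth_map M A f" using f by (simp add: oriented_diffeos_def)
  fix c x v
  show "form_star (pullback_form A f \<phi>) (pullback_vfield A f w) c x v = pullback_form A f (form_star \<phi> w) c x v"
  proof (cases "c \<in> A \<and> x \<in> chart_image c")
    case True
    define d where "d = target_chart A f c x"
    have c: "c \<in> A" and d: "d \<in> A" "x \<in> local_dom c d f"
      using True target_chart[OF sm] by (auto simp: d_def)
    let ?L = "local_deriv c d f x" and ?y = "local_rep c d f x"
    have "det (matrix ?L) > 0" using f c d by (simp add: oriented_diffeos_def)
    then have "inj ?L" using det_nz_iff_inj[OF linear_local_deriv[OF sm c d]] by simp
    then have "surj ?L" using linear_injective_imp_surjective[OF linear_local_deriv[OF sm c d]] by blast
    moreover have "pullback_vfield A f w c x = inv ?L (w d ?y)"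
      using True by (simp add: pullback_vfield_def d_def Let_def)
    ultimately have Lw: "w d ?y = ?L (pullback_vfield A f w c x)" by (simp add: surj_f_inv_f)
    note pull = pullback_form_eq[OF sm \<phi> c d]
    have "form_star (pullback_form A f \<phi>) (pullback_vfield A f w) c x v = form_star \<phi> w d ?y (\<lambda>i. ?L (v i))"
      unfolding form_star_def
    proof (rule wedge_transform)
      show "interior_product (pullback_vfield A f w) (pullback_form A f \<phi>) c x u
          = interior_product w \<phi> d ?y (\<lambda>i. ?L (u i))" for u
        by (rule interior_product_transform) (rule pull Lw)+
    qed (rule pull)
    then show ?thesis using pullback_form_eq[OF sm form_star_in_diff_forms[OF w \<phi>] c d] by simp
  next
    case False
    then show ?thesis by (auto simp: form_star_def wedge_def pullback_form_def)
  qed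
qed

end

section \<open>Integrals of compactly supported functions\<close>

lemma integral_support:
  fixes F :: "real^5 \<Rightarrow> real"
  assumes "L \<subseteq> S" "\<And>x. x \<in> S - L \<Longrightarrow> F x = 0"
  shows "F absolutely_integrable_on S \<longleftrightarrow> F absolutely_integrable_on L"
    and "integral S F = integral L F"
proof -
  have "(if x \<in> S then F x else 0) = (if x \<in> L then F x else 0)" for x
    using assms(1) assms(2)[of x] by auto
  then show "F absolutely_integrable_on S \<longleftrightarrow> F absolutely_integrable_on L" "integral S F = integral L F"
    using absolutely_integrable_restrict_UNIV[of S F] absolutely_integrable_restrict_UNIV[of L F]
      integral_restrict_UNIV[of S F] integral_restrict_UNIV[of L F] by presburger+
qed

lemma absolutely_integrable_compact_support:
  fixes F :: "real^5 \<Rightarrow> real"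
  assumes "compact L" "L \<subseteq> S" "continuous_on S F" "\<And>x. x \<in> S - L \<Longrightarrow> F x = 0"
  shows "F absolutely_integrable_on S"
proof -
  have "integrable lborel (\<lambda>x. indicator L x *\<^sub>R F x)"
    using borel_integrable_compact[OF assms(1) continuous_on_subset[OF assms(3,2)]] .
  then have "F absolutely_integrable_on L"
    unfolding set_integrable_def by (simp add: integrable_completion)
  then show ?thesis using integral_support(1)[of L S F, OF assms(2) assms(4)] by blast
qed

text \<open>The integral of a translate \<open>g (x + t v)\<close> does not depend on \<open>t\<close>; differentiate under the integral
  sign.\<close>
proposition integral_fd_compact_support:
  fixes g :: "real^5 \<Rightarrow> real"
  assumes U: "open U" and g: "smooth_on U g" and L: "compact L" "L \<subseteq> U"
    and supp: "\<And>x. x \<in> U - L \<Longrightarrow> g x = 0"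
  shows "(\<lambda>x. fd g x v) integrable_on U" "integral U (\<lambda>x. fd g x v) = 0"
proof -
  define G where "G x = (if x \<in> U then g x else 0)" for x
  have oL: "open (- L)" using compact_imp_closed[OF L(1)] by auto
  have GL: "G x = 0" if "x \<in> - L" for x using that supp by (auto simp: G_def)
  have sm: "smooth_on UNIV G"
  proof (rule smooth_on_local)
    fix x :: "real^5"
    show "\<exists>T. open T \<and> x \<in> T \<and> smooth_on T G"
    proof (cases "x \<in> U")
      case True
      then show ?thesis using smooth_on_cong[OF U _ g, of G] U by (auto simp: G_def)
    next
      case False
      then show ?thesis using smooth_on_cong[OF oL _ smooth_on_const[of "- L" 0], of G] GL oL L(2) by auto
    qed
  qed
  have fdU: "fd G x v = fd g x v" if "x \<in> U" for x
    using fd_cong_open[OF U that, of G g] by (simp add: G_def)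
  have fdL: "fd G x v = 0" if "x \<in> - L" for x
    using fd_cong_open[OF oL that, of G "\<lambda>_. 0"] GL by simp
  have cont: "continuous_on S G" "continuous_on S (\<lambda>x. fd G x v)" for S
    using smooth_on_continuous[OF sm] smooth_on_continuous[OF smooth_on_fd[OF sm]]
    by (auto intro: continuous_on_subset)
  have "(\<lambda>x. fd G x v) absolutely_integrable_on U"
    by (rule absolutely_integrable_compact_support[OF L cont(2)]) (use fdL in auto)
  then have int: "(\<lambda>x. fd G x v) integrable_on U"
    using set_lebesgue_integral_eq_integral(1) by blast
  then show "(\<lambda>x. fd g x v) integrable_on U"
    using integrable_cong[of U "\<lambda>x. fd G x v" "\<lambda>x. fd g x v"] fdU by simp
  \<comment> \<open>the supports of the translates with \<open>\<bar>t\<bar> \<le> 1\<close>, to be enclosed in one box\<close>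
  let ?shifts = "(\<lambda>(x, t). x - t *\<^sub>R v) ` (L \<times> {-1..1::real})"
  have "compact ?shifts"
    by (intro compact_continuous_image compact_Times L compact_Icc) (auto intro!: continuous_intros simp: split_beta)
  then obtain b where b: "?shifts \<subseteq> cbox (- b) b"
    using bounded_subset_cbox_symmetric compact_imp_bounded by metis
  let ?I = "\<lambda>t. integral (cbox (- b) b) (\<lambda>x. G (t *\<^sub>R v + x))"
  have const: "?I t = integral L G" if t: "t \<in> {-1<..<1}" for t
  proof -
    have "?I t = integral (cbox (- b + t *\<^sub>R v) (b + t *\<^sub>R v)) G"
      using integral_shift_cbox_plus[of "- b" b G "t *\<^sub>R v"] by (simp add: o_def)
    also have "\<dots> = integral L G"
    proof (rule integral_support(2))
      show "L \<subseteq> cbox (- b + t *\<^sub>R v) (b + t *\<^sub>R v)"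
      proof
        fix x assume "x \<in> L"
        then have "x - t *\<^sub>R v \<in> cbox (- b) b" using b t by force
        then show "x \<in> cbox (- b + t *\<^sub>R v) (b + t *\<^sub>R v)"
          by (simp add: mem_box inner_diff_left inner_add_left algebra_simps)
      qed
    qed (use GL in auto)
    finally show ?thesis .
  qed
  have "(?I has_vector_derivative
      integral (cbox (- b) b) (\<lambda>x. fd G (0 *\<^sub>R v + x) v)) (at 0 within {-1<..<1})"
  proof (rule leibniz_rule_vector_derivative)
    fix t :: real and x :: "real^5"
    have 1: "((\<lambda>t. t *\<^sub>R v + x) has_derivative (\<lambda>r. r *\<^sub>R v)) (at t within {-1<..<1})"
      by (auto intro!: derivative_eq_intros)
    have 2: "(G has_derivative fd G (t *\<^sub>R v + x)) (at (t *\<^sub>R v + x))"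
      using smooth_on_has_derivative[OF sm] by simp
    show "((\<lambda>t. G (t *\<^sub>R v + x)) has_vector_derivative fd G (t *\<^sub>R v + x) v) (at t within {-1<..<1})"
      unfolding has_vector_derivative_def
      using has_derivative_compose[OF 1 2] linear_scale[OF has_derivative_linear[OF 2]] by simp
  next
    show "(\<lambda>x. G (t *\<^sub>R v + x)) integrable_on cbox (- b) b" for t
      by (intro integrable_continuous continuous_on_compose2[OF cont(1)[of UNIV]] continuous_intros) auto
    have "continuous_on ({-1<..<1} \<times> cbox (- b) b) (\<lambda>p. fd G (fst p *\<^sub>R v + snd p) v)"
      by (rule continuous_on_compose2[OF cont(2)[of UNIV]]) (auto intro!: continuous_intros)
    then show "continuous_on ({-1<..<1} \<times> cbox (- b) b) (\<lambda>(t, x). fd G (t *\<^sub>R v + x) v)"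
      by (simp add: split_beta)
  qed auto
  moreover have "at 0 within {-1<..<1::real} = at 0" by (rule at_within_open) auto
  ultimately have "(?I has_vector_derivative
      integral (cbox (- b) b) (\<lambda>x. fd G x v)) (at 0)"
    by (simp only: scaleR_zero_left add_0_left)
  moreover have "(?I has_vector_derivative 0) (at 0)"
  proof (rule has_vector_derivative_transform_within_open[where f="\<lambda>_. integral L G" and S="{-1<..<1}"])
    show "((\<lambda>t::real. integral L G) has_vector_derivative 0) (at 0)" by simp
    show "open {-1<..<1::real}" "0 \<in> {-1<..<1::real}" by simp_all
    show "integral L G = ?I t" if "t \<in> {-1<..<1}" for t
      by (rule const[OF that, symmetric])
  qed
  ultimately have "integral (cbox (- b) b) (\<lambda>x. fd G x v) = 0"
    using vector_derivative_unique_at by blast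
  moreover have "L \<subseteq> cbox (- b) b"
  proof
    fix x assume "x \<in> L"
    then have "x - 0 *\<^sub>R v \<in> ?shifts" by force
    then show "x \<in> cbox (- b) b" using b by auto
  qed
  ultimately have "integral L (\<lambda>x. fd G x v) = 0"
    using integral_support(2)[of L "cbox (- b) b" "\<lambda>x. fd G x v"] fdL by auto
  then have "integral U (\<lambda>x. fd G x v) = 0"
    using integral_support(2)[of L U "\<lambda>x. fd G x v"] fdL L(2) by auto
  then show "integral U (\<lambda>x. fd g x v) = 0"
    using integral_cong[of U "\<lambda>x. fd G x v" "\<lambda>x. fd g x v"] fdU by simp
qed

text \<open>The integrand is a finite sum of derivatives of compactly supported functions.\<close>
lemma local_stokes:
  assumes \<alpha>: "local_form 2 U \<alpha>" and \<beta>: "local_form 2 U \<beta>"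
    and closed: "\<And>x v. x \<in> U \<Longrightarrow> local_d 2 \<alpha> x v = 0"
    and L: "compact L" "L \<subseteq> U" and supp: "\<And>x v. x \<in> U - L \<Longrightarrow> \<beta> x v = 0"
  shows "integral U (\<lambda>x. alternation 5 (\<lambda>u. \<alpha> x u * local_d 2 \<beta> x (\<lambda>i. u (2 + i))) v) = 0"
proof -
  define h where "h \<pi> y = \<alpha> y (\<lambda>i. v (\<pi> i)) * \<beta> y (\<lambda>i. v (\<pi> (3 + i)))" for \<pi> :: "nat \<Rightarrow> nat" and y
  let ?P = "{\<pi>. \<pi> permutes {..<5::nat}}"
  have sm: "smooth_on U (h \<pi>)" for \<pi>
    unfolding h_def by (intro smooth_on_mult local_formD(1)[OF \<alpha>] local_formD(3)[OF \<alpha>] local_formD(3)[OF \<beta>])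
  have z0: "h \<pi> x = 0" if "x \<in> U - L" for \<pi> x using supp[OF that] by (simp add: h_def)
  have z: "(\<lambda>x. fd (h \<pi>) x u) integrable_on U" "integral U (\<lambda>x. fd (h \<pi>) x u) = 0" for \<pi> u
    by (rule integral_fd_compact_support[OF local_formD(1)[OF \<alpha>] sm L], rule z0, assumption)+
  have "integral U (\<lambda>x. alternation 5 (\<lambda>u. \<alpha> x u * local_d 2 \<beta> x (\<lambda>i. u (2 + i))) v)
      = integral U (\<lambda>x. \<Sum>\<pi>\<in>?P. (3 * of_int (sign \<pi>)) * fd (h \<pi>) x (v (\<pi> 2)))"
  proof (rule integral_cong)
    fix x assume x: "x \<in> U"
    show "alternation 5 (\<lambda>u. \<alpha> x u * local_d 2 \<beta> x (\<lambda>i. u (2 + i))) v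
        = (\<Sum>\<pi>\<in>?P. (3 * of_int (sign \<pi>)) * fd (h \<pi>) x (v (\<pi> 2)))"
      unfolding alternation_closed_wedge_d[OF \<alpha> \<beta> x closed[OF x]]
      by (simp add: alternation_def h_def[abs_def] sum_distrib_left mult.assoc)
  qed
  also have "\<dots> = (\<Sum>\<pi>\<in>?P. integral U (\<lambda>x. (3 * of_int (sign \<pi>)) * fd (h \<pi>) x (v (\<pi> 2))))"
    by (intro integral_sum finite_permutations integrable_on_mult_right z(1)) auto
  also have "\<dots> = 0"
    by (intro sum.neutral ballI) (simp add: z(2))
  finally show ?thesis .
qed

context closed_5_manifold
begin

section \<open>Partitions of unity\<close>

lemma smooth_function_sum:
  "(\<And>i. i \<in> I \<Longrightarrow> smooth_function (\<eta> i)) \<Longrightarrow> smooth_function (\<lambda>p. \<Sum>i\<in>I. \<eta> i p)"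
  unfolding smooth_function_def using open_chart_image by (auto intro!: smooth_on_sum)

lemma smooth_function_divide:
  assumes "smooth_function \<eta>" "smooth_function \<theta>" "\<And>p. p \<in> M \<Longrightarrow> \<theta> p \<noteq> 0"
  shows "smooth_function (\<lambda>p. \<eta> p / \<theta> p)"
  unfolding smooth_function_def divide_inverse
proof
  fix c assume c: "c \<in> A"
  show "smooth_on (chart_image c) (\<lambda>x. \<eta> (chart_inv c x) * inverse (\<theta> (chart_inv c x)))"
    using assms c chart_inv_in_M[OF c]
    by (intro smooth_on_mult smooth_on_inverse open_chart_image) (auto simp: smooth_function_def)
qed

lemma smooth_function_continuous:
  assumes "smooth_function \<eta>"
  shows "continuous_on M \<eta>"
  unfolding continuous_on_eq_continuous_within
proof
  fix p assume "p \<in> M"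
  then obtain c where c: "c \<in> A" "p \<in> fst c" using chart_cover by blast
  obtain T where T: "open T" "fst c = M \<inter> T" using openin_chart[OF c(1)] by (auto simp: openin_open)
  have "continuous_on (fst c) (\<lambda>q. \<eta> (chart_inv c (snd c q)))"
    using assms c(1) snd_in_chart_image[OF c(1)]
    by (intro continuous_on_compose2[OF smooth_on_continuous continuous_chart[OF c(1)], of "chart_image c" "\<lambda>x. \<eta> (chart_inv c x)"])
       (auto simp: smooth_function_def)
  then have "continuous_on (fst c) \<eta>"
    by (rule continuous_on_eq) (simp add: chart_inv_snd[OF c(1)])
  then have "continuous (at p within fst c) \<eta>"
    using c(2) by (simp add: continuous_on_eq_continuous_within)
  moreover have "at p within fst c = at p within M"
    using T c(2) by (intro at_within_nhd[of p T]) auto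
  ultimately show "continuous (at p within M) \<eta>" by simp
qed

definition chart_ball :: "'m chart \<Rightarrow> real^5 \<Rightarrow> real \<Rightarrow> 'm set" where
  "chart_ball c a r = chart_inv c ` ball a r"

text \<open>The squared distance keeps the bump smooth at its centre.\<close>
definition bump :: "'m chart \<Rightarrow> real^5 \<Rightarrow> real \<Rightarrow> 'm \<Rightarrow> real" where
  "bump c a r p = (if p \<in> fst c then flat_exp 0 (r\<^sup>2 - (snd c p - a) \<bullet> (snd c p - a)) else 0)"

lemma bump_nonneg: "bump c a r p \<ge> 0"
  by (simp add: bump_def flat_exp_0_nonneg)

context
  fixes c a r assumes c: "c \<in> A" and r: "r > 0" and sub: "cball a r \<subseteq> chart_image c"
begin

lemma compact_chart_cball: "compact (chart_inv c ` cball a r)"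
  using continuous_on_subset[OF continuous_chart_inv[OF c] sub] by (intro compact_continuous_image) auto

lemma chart_cball_subset: "chart_inv c ` cball a r \<subseteq> fst c"
  using sub chart_inv_in[OF c] by blast

lemma openin_chart_ball: "openin (top_of_set M) (chart_ball c a r)"
proof -
  have "openin (top_of_set (chart_image c)) (ball a r)"
    using sub by (intro open_subset) auto
  then have "openin (top_of_set (fst c)) (chart_ball c a r)"
    unfolding chart_ball_def
    using homeomorphism_imp_open_map[OF homeomorphism_sym[THEN iffD1, OF chart_homeomorphism[OF c]]] by blast
  then show ?thesis using openin_chart[OF c] openin_trans by blast
qed

lemma bump_pos: "p \<in> chart_ball c a r \<Longrightarrow> bump c a r p > 0"
proof -
  assume "p \<in> chart_ball c a r"
  then obtain x where x: "x \<in> ball a r" "p = chart_inv c x" by (auto simp: chart_ball_def)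
  then have xc: "x \<in> chart_image c" using sub by auto
  have "norm (x - a) < r" using x by (simp add: dist_norm norm_minus_commute)
  then have "(x - a) \<bullet> (x - a) < r\<^sup>2"
    using power_strict_mono[of "norm (x - a)" r 2] by (simp add: power2_norm_eq_inner)
  then show "bump c a r p > 0"
    using x xc chart_inv_in[OF c xc] snd_chart_inv[OF c xc] by (simp add: bump_def flat_exp_0_pos)
qed

lemma bump_support: "bump c a r p \<noteq> 0 \<Longrightarrow> p \<in> chart_inv c ` cball a r"
proof -
  assume nz: "bump c a r p \<noteq> 0"
  then have p: "p \<in> fst c" by (auto simp: bump_def split: if_splits)
  have "(norm (snd c p - a))\<^sup>2 < r\<^sup>2"
    using nz p flat_exp_0_nonpos[of "r\<^sup>2 - (snd c p - a) \<bullet> (snd c p - a)"]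
    by (force simp: bump_def power2_norm_eq_inner)
  then have "norm (snd c p - a) < r" using r power2_less_imp_less by force
  then have "snd c p \<in> cball a r" by (simp add: dist_norm norm_minus_commute)
  then show "p \<in> chart_inv c ` cball a r" using chart_inv_snd[OF c p] by force
qed

lemma smooth_bump: "smooth_function (bump c a r)"
  unfolding smooth_function_def
proof (intro ballI smooth_on_local)
  fix d x assume d: "d \<in> A" and x: "x \<in> chart_image d"
  show "\<exists>T. open T \<and> x \<in> T \<and> smooth_on T (\<lambda>x. bump c a r (chart_inv d x))"
  proof (cases "chart_inv d x \<in> fst c")
    case True
    let ?T = "local_dom d c id" and ?g = "local_rep d c id"
    have T: "open ?T" "x \<in> ?T" using open_local_dom[OF smooth_map_id d c] x True local_dom_iff[OF d] by auto
    have g: "smooth_on ?T ?g" using smooth_mapD(3)[OF smooth_map_id d c] .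
    have "smooth_on ?T (\<lambda>y. flat_exp 0 (r\<^sup>2 - (?g y - a) \<bullet> (?g y - a)))"
      by (rule smooth_on_compose[OF T(1) _ _ smooth_on_flat_exp])
         (intro subset_UNIV smooth_on_diff smooth_on_inner smooth_on_const g T)+
    then have "smooth_on ?T (\<lambda>x. bump c a r (chart_inv d x))"
      by (rule smooth_on_cong[OF T(1), rotated]) (simp add: bump_def local_rep_def local_dom_iff[OF d])
    then show ?thesis using T by blast
  next
    case False
    let ?T = "{y \<in> chart_image d. chart_inv d y \<notin> chart_inv c ` cball a r}"
    have T: "open ?T" by (rule open_chart_minus_compact[OF d compact_chart_cball])
    have "smooth_on ?T (\<lambda>x. bump c a r (chart_inv d x))"
      using bump_support by (intro smooth_on_cong[OF T _ smooth_on_const[of _ 0]]) auto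
    moreover have "x \<in> ?T" using x False chart_cball_subset by auto
    ultimately show ?thesis using T by blast
  qed
qed

end

text \<open>Finitely many bumps are positive on a covering of \<open>M\<close>. Bumps in the same chart are added up, because
  the functions are indexed by charts.\<close>
proposition ex_partition_of_unity: "\<exists>C \<rho>. partition_of_unity M A C \<rho>"
proof -
  have "\<exists>c r. c \<in> A \<and> p \<in> fst c \<and> r > 0 \<and> cball (snd c p) r \<subseteq> chart_image c" if p: "p \<in> M" for p
  proof -
    obtain c where c: "c \<in> A" "p \<in> fst c" using chart_cover[OF p] by blast
    then obtain r where "r > 0" "cball (snd c p) r \<subseteq> chart_image c"
      using open_chart_image[OF c(1)] snd_in_chart_image[OF c] open_contains_cball by blast
    then show ?thesis using c by blast
  qed
  then obtain C R where CR: "\<And>p. p \<in> M \<Longrightarrow> C p \<in> A" "\<And>p. p \<in> M \<Longrightarrow> p \<in> fst (C p)"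
    "\<And>p. p \<in> M \<Longrightarrow> R p > 0" "\<And>p. p \<in> M \<Longrightarrow> cball (snd (C p) p) (R p) \<subseteq> chart_image (C p)"
    by metis
  define W where "W p = chart_ball (C p) (snd (C p) p) (R p)" for p
  define b where "b p = bump (C p) (snd (C p) p) (R p)" for p
  define K where "K p = chart_inv (C p) ` cball (snd (C p) p) (R p)" for p
  have W: "openin (top_of_set M) (W p)" "p \<in> W p" if "p \<in> M" for p
  proof -
    show "openin (top_of_set M) (W p)" unfolding W_def by (rule openin_chart_ball[OF CR(1,3,4)[OF that]])
    show "p \<in> W p" unfolding W_def chart_ball_def
      using CR(3)[OF that] chart_inv_snd[OF CR(1,2)[OF that]]
      by (intro image_eqI[of _ _ "snd (C p) p"]) auto
  qed
  have "\<forall>u\<in>W ` M. openin (top_of_set M) u" "M \<subseteq> \<Union>(W ` M)" using W by auto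
  then obtain D where D: "D \<subseteq> W ` M" "finite D" "M \<subseteq> \<Union>D"
    using compact_M unfolding compact_eq_openin_cover by meson
  obtain F where F: "F \<subseteq> M" "finite F" "D = W ` F" using finite_subset_image[OF D(2,1)] by blast
  define \<rho> where "\<rho> c q = (\<Sum>p\<in>{p\<in>F. C p = c}. b p q) / (\<Sum>p\<in>F. b p q)" for c q
  have b_smooth: "smooth_function (b p)" if "p \<in> F" for p
    unfolding b_def by (intro smooth_bump CR) (use that F(1) in auto)
  have pos: "(\<Sum>p\<in>F. b p q) > 0" if q: "q \<in> M" for q
  proof -
    obtain p where p: "p \<in> F" "q \<in> W p" using D(3) F(3) q by blast
    have "b p q > 0" unfolding b_def by (intro bump_pos CR p(2)[unfolded W_def]) (use p F(1) in auto)
    then show ?thesis using F(2) p(1) bump_nonneg unfolding b_def by (intro sum_pos2[of F p]) auto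
  qed
  have "partition_of_unity M A (C ` F) \<rho>"
    unfolding partition_of_unity_def
  proof (intro conjI ballI)
    show "finite (C ` F)" "C ` F \<subseteq> A" using F CR by auto
    fix c assume "c \<in> C ` F"
    have "smooth_function (\<rho> c)" unfolding \<rho>_def[abs_def]
    proof (intro smooth_function_divide smooth_function_sum b_smooth)
      show "(\<Sum>p\<in>F. b p q) \<noteq> 0" if "q \<in> M" for q using pos[OF that] by simp
    qed auto
    then show "smooth_on (chart_image c') (\<lambda>x. \<rho> c (chart_inv c' x))" if "c' \<in> A" for c'
      using that by (simp add: smooth_function_def)
    show "\<rho> c q \<ge> 0" for q
      unfolding \<rho>_def b_def by (intro divide_nonneg_nonneg sum_nonneg bump_nonneg)
    let ?K = "\<Union>p\<in>{p\<in>F. C p = c}. K p"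
    have "closed ?K"
    proof (intro closed_UN ballI)
      fix p assume "p \<in> {p\<in>F. C p = c}"
      then have "p \<in> M" using F by auto
      then show "closed (K p)" unfolding K_def
        by (intro compact_imp_closed compact_chart_cball CR)
    qed (use F(2) in auto)
    moreover have "{q\<in>M. \<rho> c q \<noteq> 0} \<subseteq> ?K"
    proof
      fix q assume "q \<in> {q\<in>M. \<rho> c q \<noteq> 0}"
      then have "(\<Sum>p\<in>{p\<in>F. C p = c}. b p q) \<noteq> 0" by (auto simp: \<rho>_def)
      then obtain p where p: "p \<in> F" "C p = c" "b p q \<noteq> 0" by (metis (mono_tags, lifting) mem_Collect_eq sum.neutral)
      then have "p \<in> M" using F by auto
      then have "q \<in> K p" unfolding K_def by (intro bump_support CR p(3)[unfolded b_def])
      then show "q \<in> ?K" using p by blast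
    qed
    ultimately have "closure {q\<in>M. \<rho> c q \<noteq> 0} \<subseteq> ?K" by (rule closure_minimal[rotated])
    moreover have "?K \<subseteq> fst c"
    proof (rule UN_least)
      fix p assume "p \<in> {p\<in>F. C p = c}"
      then have "p \<in> M" "C p = c" using F by auto
      then show "K p \<subseteq> fst c"
        using chart_cball_subset[OF CR(1,3,4)[of p]] by (simp add: K_def)
    qed
    ultimately show "M \<inter> closure {q\<in>M. \<rho> c q \<noteq> 0} \<subseteq> fst c" by blast
  next
    fix q assume q: "q \<in> M"
    have "(\<Sum>c\<in>C ` F. \<Sum>p\<in>{p\<in>F. C p = c}. b p q) = (\<Sum>p\<in>F. b p q)"
      using sum.image_gen[OF F(2), of "\<lambda>p. b p q" C] by simp
    then show "(\<Sum>c\<in>C ` F. \<rho> c q) = 1"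
      using pos[OF q] by (simp add: \<rho>_def flip: sum_divide_distrib)
  qed
  then show ?thesis by blast
qed

end

section \<open>Change of variables\<close>

text \<open>The formula for values in \<open>real^1\<close>, transferred to real values.\<close>
lemma real_change_of_variables:
  fixes F :: "real^5 \<Rightarrow> real" and g :: "real^5 \<Rightarrow> real^5"
  assumes S: "S \<in> sets lebesgue" and g: "\<And>x. x \<in> S \<Longrightarrow> (g has_derivative g' x) (at x within S)"
    and inj: "inj_on g S" and F: "F absolutely_integrable_on g ` S"
  shows "(\<lambda>x. \<bar>det (matrix (g' x))\<bar> * F (g x)) absolutely_integrable_on S"
    and "integral S (\<lambda>x. \<bar>det (matrix (g' x))\<bar> * F (g x)) = integral (g ` S) F"
proof -
  have "(\<lambda>x. \<bar>det (matrix (g' x))\<bar> *\<^sub>R (vec (F (g x)) :: real^1)) absolutely_integrable_on S \<and>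
      integral S (\<lambda>x. \<bar>det (matrix (g' x))\<bar> *\<^sub>R (vec (F (g x)) :: real^1)) = vec (integral (g ` S) F)"
    using has_absolute_integral_change_of_variables[OF S g inj, of "\<lambda>x. vec (F x) :: real^1" "vec (integral (g ` S) F)"] F
    by (simp add: absolutely_integrable_on_1_iff integral_on_1_eq)
  then show "(\<lambda>x. \<bar>det (matrix (g' x))\<bar> * F (g x)) absolutely_integrable_on S"
    "integral S (\<lambda>x. \<bar>det (matrix (g' x))\<bar> * F (g x)) = integral (g ` S) F"
    by (simp_all add: absolutely_integrable_on_1_iff integral_on_1_eq)
qed

context closed_5_manifold
begin

text \<open>\<open>F\<close> and \<open>G\<close> express one density in the charts \<open>d\<close> and \<open>c\<close>. The support \<open>K\<close> keeps it away from the boundary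
  of the part of \<open>c\<close> that \<open>f\<close> maps into \<open>d\<close>, so that no more than the change of variables on that part is needed.\<close>
lemma integral_change_of_charts:
  assumes f: "smooth_map M A f" "inj_on f M" and c: "c \<in> A" "d \<in> A"
    and det: "\<And>x. x \<in> local_dom c d f \<Longrightarrow> det (matrix (local_deriv c d f x)) > 0"
    and K: "compact K" "K \<subseteq> {p \<in> fst c. f p \<in> fst d}"
    and F: "continuous_on (chart_image d) F" "\<And>y. y \<in> chart_image d \<Longrightarrow> F y \<noteq> 0 \<Longrightarrow> chart_inv d y \<in> f ` K"
    and G: "\<And>x. x \<in> local_dom c d f \<Longrightarrow> G x = det (matrix (local_deriv c d f x)) * F (local_rep c d f x)"
      "\<And>x. x \<in> chart_image c \<Longrightarrow> x \<notin> local_dom c d f \<Longrightarrow> G x = 0"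
  shows "G integrable_on chart_image c" "F integrable_on chart_image d"
    "integral (chart_image c) G = integral (chart_image d) F"
proof -
  let ?T = "local_dom c d f" and ?g = "local_rep c d f"
  let ?L = "snd d ` f ` K"
  have KM: "K \<subseteq> M" using K(2) chart_subset[OF c(1)] by auto
  have "compact (f ` K)"
    by (intro compact_continuous_image continuous_on_subset[OF smooth_mapD(2)[OF f(1)] KM] K(1))
  then have L: "compact ?L"
    by (rule compact_continuous_image[OF continuous_on_subset[OF continuous_chart[OF c(2)]], rotated]) (use K(2) in auto)
  have T_sub: "?T \<subseteq> chart_image c" using local_dom_iff[OF c(1)] by blast
  have gT_sub: "?g ` ?T \<subseteq> chart_image d" by (rule local_rep_image[OF c])
  have L_sub: "?L \<subseteq> ?g ` ?T"
  proof
    fix y assume "y \<in> ?L"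
    then obtain p where p: "p \<in> K" "y = snd d (f p)" by blast
    then have pc: "p \<in> fst c" "f p \<in> fst d" using K(2) by auto
    have "snd c p \<in> ?T" "?g (snd c p) = y"
      using pc p chart_inv_snd[OF c(1)] snd_in_chart_image[OF c(1)]
      by (auto simp: local_dom_iff[OF c(1)] local_rep_def)
    then show "y \<in> ?g ` ?T" by blast
  qed
  have F0: "F y = 0" if "y \<in> chart_image d - ?L" for y
  proof (rule ccontr)
    assume "F y \<noteq> 0"
    then have "snd d (chart_inv d y) \<in> ?L" using F(2)[of y] that by blast
    then show False using that snd_chart_inv[OF c(2)] by simp
  qed
  have Fd: "F absolutely_integrable_on chart_image d"
    using absolutely_integrable_compact_support[OF L _ F(1) F0] L_sub gT_sub by blast
  then show "F integrable_on chart_image d"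
    using set_lebesgue_integral_eq_integral(1) by blast
  have F0': "F y = 0" if "y \<in> chart_image d - ?g ` ?T" for y using F0 that L_sub by blast
  note Fg = integral_support[OF gT_sub, of F, OF F0']
  have inj: "inj_on ?g ?T"
  proof (rule inj_onI)
    fix x y assume xy: "x \<in> ?T" "y \<in> ?T" and "?g x = ?g y"
    then have "f (chart_inv c x) = f (chart_inv c y)"
      using chart_inv_local_rep[OF c xy(1)] chart_inv_local_rep[OF c xy(2)] by simp
    moreover have xc: "x \<in> chart_image c" "y \<in> chart_image c" using xy T_sub by auto
    ultimately have "chart_inv c x = chart_inv c y"
      using inj_onD[OF f(2)] chart_inv_in_M[OF c(1)] by blast
    then show "x = y" using snd_chart_inv[OF c(1)] xc by metis
  qed
  have Tm: "?T \<in> sets lebesgue" using open_local_dom[OF f(1) c] by simp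
  have der: "(?g has_derivative local_deriv c d f x) (at x within ?T)" if "x \<in> ?T" for x
    using local_rep_has_derivative[OF f(1) c that] by (rule has_derivative_at_withinI)
  have Geq: "\<bar>det (matrix (local_deriv c d f x))\<bar> * F (?g x) = G x" if "x \<in> ?T" for x
    using G(1)[OF that] det[OF that] by simp
  have F_abs: "F absolutely_integrable_on ?g ` ?T" using Fg(1) Fd by blast
  have cov: "(\<lambda>x. \<bar>det (matrix (local_deriv c d f x))\<bar> * F (?g x)) absolutely_integrable_on ?T"
    "integral ?T (\<lambda>x. \<bar>det (matrix (local_deriv c d f x))\<bar> * F (?g x)) = integral (?g ` ?T) F"
    by (rule real_change_of_variables[OF Tm _ inj F_abs], erule der)+
  have "(\<lambda>x. \<bar>det (matrix (local_deriv c d f x))\<bar> * F (?g x)) absolutely_integrable_on ?T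
      \<longleftrightarrow> G absolutely_integrable_on ?T"
    by (rule set_integrable_cong[OF refl refl]) (rule Geq)
  then have "G absolutely_integrable_on ?T" using cov(1) by blast
  then have "G absolutely_integrable_on chart_image c"
    using integral_support(1)[of ?T "chart_image c" G] T_sub G(2) by blast
  then show "G integrable_on chart_image c"
    using set_lebesgue_integral_eq_integral(1) by blast
  have "integral (chart_image c) G = integral ?T G"
    using integral_support(2)[of ?T "chart_image c" G] T_sub G(2) by blast
  also have "\<dots> = integral ?T (\<lambda>x. \<bar>det (matrix (local_deriv c d f x))\<bar> * F (?g x))"
    by (rule integral_cong) (simp add: Geq)
  also have "\<dots> = integral (?g ` ?T) F" by (rule cov(2))
  also have "\<dots> = integral (chart_image d) F" using Fg(2) by simp
  finally show "integral (chart_image c) G = integral (chart_image d) F" .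
qed

section \<open>Integration of 5-forms\<close>

text \<open>The partition of unity that \<open>form_integral\<close> selects.\<close>
definition pou_index :: "'m chart set" where
  "pou_index = fst (SOME P. partition_of_unity M A (fst P) (snd P))"

definition pou :: "'m chart \<Rightarrow> 'm \<Rightarrow> real" where
  "pou = snd (SOME P. partition_of_unity M A (fst P) (snd P))"

lemma partition_of_unity_pou: "partition_of_unity M A pou_index pou"
proof -
  obtain C \<rho> where "partition_of_unity M A C \<rho>" using ex_partition_of_unity by blast
  then have "\<exists>P. partition_of_unity M A (fst P) (snd P)" by (intro exI[of _ "(C, \<rho>)"]) simp
  from someI_ex[OF this] show ?thesis unfolding pou_index_def pou_def .
qed

lemma form_integral_pou:
  "form_integral M A \<omega> = (\<Sum>c\<in>pou_index. integral (chart_image c) (\<lambda>x. pou c (chart_inv c x) * \<omega> c x std_frame))"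
  by (simp add: form_integral_def Let_def pou_index_def pou_def)

lemma finite_pou_index: "finite pou_index"
  and pou_index_subset: "c \<in> pou_index \<Longrightarrow> c \<in> A"
  and smooth_pou: "c \<in> pou_index \<Longrightarrow> smooth_function (pou c)"
  and pou_sum: "p \<in> M \<Longrightarrow> (\<Sum>c\<in>pou_index. pou c p) = 1"
  using partition_of_unity_pou unfolding partition_of_unity_def smooth_function_def by auto

definition pou_support :: "'m chart \<Rightarrow> 'm set" where
  "pou_support c = M \<inter> closure {p \<in> M. pou c p \<noteq> 0}"

lemma compact_pou_support: "compact (pou_support c)"
  unfolding pou_support_def by (intro compact_Int_closed compact_M closed_closure)

lemma pou_support_subset: "c \<in> pou_index \<Longrightarrow> pou_support c \<subseteq> fst c"
  using partition_of_unity_pou unfolding partition_of_unity_def pou_support_def by blast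

lemma pou_supportI: "p \<in> M \<Longrightarrow> pou c p \<noteq> 0 \<Longrightarrow> p \<in> pou_support c"
  unfolding pou_support_def using closure_subset by fastforce

lemma pou_outside_chart: "c \<in> pou_index \<Longrightarrow> p \<in> M \<Longrightarrow> p \<notin> fst c \<Longrightarrow> pou c p = 0"
  using pou_supportI pou_support_subset by blast

lemma compact_chart_pou_support: "c \<in> pou_index \<Longrightarrow> compact (snd c ` pou_support c)"
  using continuous_on_subset[OF continuous_chart pou_support_subset] pou_index_subset
  by (intro compact_continuous_image compact_pou_support) blast

lemma chart_pou_support_subset: "c \<in> pou_index \<Longrightarrow> snd c ` pou_support c \<subseteq> chart_image c"
  using pou_support_subset snd_in_chart_image pou_index_subset by blast

lemma continuous_pou_chart:
  "c \<in> pou_index \<Longrightarrow> d \<in> A \<Longrightarrow> continuous_on (chart_image d) (\<lambda>x. pou c (chart_inv d x))"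
  using smooth_pou smooth_on_continuous unfolding smooth_function_def by blast

lemma continuous_5_form:
  "\<omega> \<in> diff_forms A 5 \<Longrightarrow> c \<in> A \<Longrightarrow> continuous_on (chart_image c) (\<lambda>x. \<omega> c x std_frame)"
  by (rule smooth_on_continuous[OF local_formD(3)[OF forms_local]])

lemma integrable_pou_form:
  assumes \<omega>: "\<omega> \<in> diff_forms A 5" and c: "c \<in> pou_index"
  shows "(\<lambda>x. pou c (chart_inv c x) * \<omega> c x std_frame) integrable_on chart_image c"
proof -
  note cA = pou_index_subset[OF c]
  have "(\<lambda>x. pou c (chart_inv c x) * \<omega> c x std_frame) absolutely_integrable_on chart_image c"
  proof (rule absolutely_integrable_compact_support)
    show "compact (snd c ` pou_support c)" "snd c ` pou_support c \<subseteq> chart_image c"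
      using c by (rule compact_chart_pou_support, rule chart_pou_support_subset)
    show "continuous_on (chart_image c) (\<lambda>x. pou c (chart_inv c x) * \<omega> c x std_frame)"
      by (intro continuous_on_mult continuous_pou_chart continuous_5_form \<omega> c cA)
    show "pou c (chart_inv c x) * \<omega> c x std_frame = 0" if "x \<in> chart_image c - snd c ` pou_support c" for x
    proof -
      have "chart_inv c x \<notin> pou_support c" using that snd_chart_inv[OF cA, of x] by force
      then have "pou c (chart_inv c x) = 0" using pou_supportI chart_inv_in_M[OF cA] that by blast
      then show ?thesis by simp
    qed
  qed
  then show ?thesis using set_lebesgue_integral_eq_integral(1) by blast
qed

lemma form_integral_cong:
  assumes "\<And>c x. c \<in> A \<Longrightarrow> x \<in> chart_image c \<Longrightarrow> \<omega> c x std_frame = \<omega>' c x std_frame"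
  shows "form_integral M A \<omega> = form_integral M A \<omega>'"
  unfolding form_integral_pou
  by (intro sum.cong refl integral_cong) (simp add: assms pou_index_subset)

lemma form_integral_sum:
  assumes "finite I" "\<And>i. i \<in> I \<Longrightarrow> \<omega> i \<in> diff_forms A 5"
  shows "form_integral M A (\<lambda>c x v. \<Sum>i\<in>I. a i * \<omega> i c x v) = (\<Sum>i\<in>I. a i * form_integral M A (\<omega> i))"
proof -
  have "integral (chart_image c) (\<lambda>x. pou c (chart_inv c x) * (\<Sum>i\<in>I. a i * \<omega> i c x std_frame))
      = (\<Sum>i\<in>I. a i * integral (chart_image c) (\<lambda>x. pou c (chart_inv c x) * \<omega> i c x std_frame))"
    if c: "c \<in> pou_index" for c
  proof -
    have "integral (chart_image c) (\<lambda>x. pou c (chart_inv c x) * (\<Sum>i\<in>I. a i * \<omega> i c x std_frame))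
        = integral (chart_image c) (\<lambda>x. \<Sum>i\<in>I. a i * (pou c (chart_inv c x) * \<omega> i c x std_frame))"
      by (simp add: sum_distrib_left mult_ac)
    also have "\<dots> = (\<Sum>i\<in>I. integral (chart_image c) (\<lambda>x. a i * (pou c (chart_inv c x) * \<omega> i c x std_frame)))"
      by (intro integral_sum assms(1) integrable_on_mult_right integrable_pou_form assms(2) c)
    finally show ?thesis by simp
  qed
  then have "form_integral M A (\<lambda>c x v. \<Sum>i\<in>I. a i * \<omega> i c x v)
      = (\<Sum>c\<in>pou_index. \<Sum>i\<in>I. a i * integral (chart_image c) (\<lambda>x. pou c (chart_inv c x) * \<omega> i c x std_frame))"
    by (simp add: form_integral_pou)
  also have "\<dots> = (\<Sum>i\<in>I. a i * form_integral M A (\<omega> i))"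
    unfolding form_integral_pou by (subst sum.swap) (simp add: sum_distrib_left)
  finally show ?thesis .
qed

lemma pullback_std_frame:
  assumes f: "smooth_map M A f" and \<omega>: "\<omega> \<in> diff_forms A 5" and c: "c \<in> A" "d \<in> A" and x: "x \<in> local_dom c d f"
  shows "\<omega> d (local_rep c d f x) (\<lambda>i. local_deriv c d f x (std_frame i))
    = det (matrix (local_deriv c d f x)) * \<omega> d (local_rep c d f x) std_frame"
  by (rule alternating_5_form_det[OF local_formD(2)[OF forms_local[OF \<omega> c(2)] local_rep_in[OF c x]]
        linear_local_deriv[OF f c x]])

lemma det_id_pos: "c \<in> A \<Longrightarrow> d \<in> A \<Longrightarrow> x \<in> local_dom c d id \<Longrightarrow> det (matrix (local_deriv c d id x)) > 0"
  using manifold unfolding compact_oriented_5_manifold_def by blast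

text \<open>Cut the form into pieces, each supported in a set on which \<open>f\<close> maps one chart into another.\<close>
proposition form_integral_pullback:
  assumes f: "f \<in> oriented_diffeos M A" and \<omega>: "\<omega> \<in> diff_forms A 5"
  shows "form_integral M A (pullback_form A f \<omega>) = form_integral M A \<omega>"
proof -
  define h where "h = inv_into M f"
  have sm: "smooth_map M A f" "smooth_map M A h" and bij: "bij_betw f M M"
    and det: "\<And>c d x. c \<in> A \<Longrightarrow> d \<in> A \<Longrightarrow> x \<in> local_dom c d f \<Longrightarrow> det (matrix (local_deriv c d f x)) > 0"
    using f by (auto simp: oriented_diffeos_def h_def)
  have inj: "inj_on f M" using bij by (simp add: bij_betw_def)
  have hf: "h (f p) = p" "f (h p) = p" "f p \<in> M" "h p \<in> M" if "p \<in> M" for p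
    using that bij smooth_mapD(1)[OF sm(1)] smooth_mapD(1)[OF sm(2)]
    unfolding h_def by (auto simp: bij_betw_def f_inv_into_f)
  \<comment> \<open>the piece cut out by \<open>c\<close> in the source and \<open>d\<close> in the target, in both charts\<close>
  define F where "F c d y = pou c (h (chart_inv d y)) * (pou d (chart_inv d y) * \<omega> d y std_frame)" for c d y
  define G where "G c d x = pou c (chart_inv c x) * pou d (f (chart_inv c x)) * pullback_form A f \<omega> c x std_frame" for c d x
  have cov: "G c d integrable_on chart_image c" "F c d integrable_on chart_image d"
      "integral (chart_image c) (G c d) = integral (chart_image d) (F c d)"
    if cd: "c \<in> pou_index" "d \<in> pou_index" for c d
  proof -
    note c = pou_index_subset[OF cd(1)] and d = pou_index_subset[OF cd(2)]
    let ?K = "pou_support c \<inter> h ` pou_support d"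
    have sub: "pou_support d \<subseteq> M" using pou_support_subset[OF cd(2)] chart_subset[OF d] by blast
    have K: "compact ?K"
      by (intro compact_Int compact_pou_support compact_continuous_image
          continuous_on_subset[OF smooth_mapD(2)[OF sm(2)] sub])
    have K_sub: "?K \<subseteq> {p \<in> fst c. f p \<in> fst d}"
    proof
      fix p assume "p \<in> ?K"
      then obtain q where q: "p \<in> pou_support c" "q \<in> pou_support d" "p = h q" by blast
      then have "f p = q" using hf(2) sub by blast
      then show "p \<in> {p \<in> fst c. f p \<in> fst d}"
        using q pou_support_subset[OF cd(1)] pou_support_subset[OF cd(2)] by blast
    qed
    have F_cont: "continuous_on (chart_image d) (F c d)"
      unfolding F_def
      by (intro continuous_on_mult continuous_pou_chart continuous_5_form \<omega> cd d
          continuous_on_compose2[OF smooth_function_continuous[OF smooth_pou[OF cd(1)]]]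
          continuous_on_compose2[OF smooth_mapD(2)[OF sm(2)]] continuous_chart_inv)
         (use hf(4) chart_inv_in_M[OF d] in auto)
    have F_supp: "chart_inv d y \<in> f ` ?K" if "y \<in> chart_image d" "F c d y \<noteq> 0" for y
    proof -
      have q: "chart_inv d y \<in> M" using chart_inv_in_M[OF d that(1)] .
      have "h (chart_inv d y) \<in> pou_support c" "chart_inv d y \<in> pou_support d"
        using that(2) pou_supportI[OF hf(4)[OF q]] pou_supportI[OF q] by (auto simp: F_def)
      then show ?thesis using hf(2)[OF q] by (intro image_eqI[of _ _ "h (chart_inv d y)"]) auto
    qed
    have G1: "G c d x = det (matrix (local_deriv c d f x)) * F c d (local_rep c d f x)" if x: "x \<in> local_dom c d f" for x
    proof -
      have "chart_inv c x \<in> M" using chart_inv_in_M[OF c] x local_dom_iff[OF c] by blast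
      then show ?thesis
        using pullback_form_eq[OF sm(1) \<omega> c d x] pullback_std_frame[OF sm(1) \<omega> c d x]
          chart_inv_local_rep[OF c d x] hf(1) by (simp add: F_def G_def)
    qed
    have G2: "G c d x = 0" if "x \<in> chart_image c" "x \<notin> local_dom c d f" for x
      using that pou_outside_chart[OF cd(2) hf(3)[OF chart_inv_in_M[OF c]], of x]
      by (simp add: G_def local_dom_iff[OF c])
    from integral_change_of_charts[OF sm(1) inj c d det[OF c d] K K_sub F_cont F_supp G1 G2]
    show "G c d integrable_on chart_image c" "F c d integrable_on chart_image d"
      "integral (chart_image c) (G c d) = integral (chart_image d) (F c d)" by blast+
  qed
  have "form_integral M A (pullback_form A f \<omega>)
      = (\<Sum>c\<in>pou_index. integral (chart_image c) (\<lambda>x. \<Sum>d\<in>pou_index. G c d x))"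
    unfolding form_integral_pou
  proof (intro sum.cong refl integral_cong)
    fix c x assume "c \<in> pou_index" "x \<in> chart_image c"
    then have "f (chart_inv c x) \<in> M" using hf(3) chart_inv_in_M pou_index_subset by blast
    then show "pou c (chart_inv c x) * pullback_form A f \<omega> c x std_frame = (\<Sum>d\<in>pou_index. G c d x)"
      using pou_sum by (simp add: G_def flip: sum_distrib_left sum_distrib_right)
  qed
  also have "\<dots> = (\<Sum>c\<in>pou_index. \<Sum>d\<in>pou_index. integral (chart_image c) (G c d))"
    by (intro sum.cong refl integral_sum finite_pou_index cov(1))
  also have "\<dots> = (\<Sum>c\<in>pou_index. \<Sum>d\<in>pou_index. integral (chart_image d) (F c d))"
    by (intro sum.cong refl cov(3))
  also have "\<dots> = (\<Sum>d\<in>pou_index. \<Sum>c\<in>pou_index. integral (chart_image d) (F c d))"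
    by (rule sum.swap)
  also have "\<dots> = (\<Sum>d\<in>pou_index. integral (chart_image d) (\<lambda>y. \<Sum>c\<in>pou_index. F c d y))"
    by (intro sum.cong refl integral_sum[symmetric] finite_pou_index cov(2))
  also have "\<dots> = form_integral M A \<omega>"
    unfolding form_integral_pou
  proof (intro sum.cong refl integral_cong)
    fix d y assume "d \<in> pou_index" "y \<in> chart_image d"
    then have "h (chart_inv d y) \<in> M" using hf(4) chart_inv_in_M pou_index_subset by blast
    then show "(\<Sum>c\<in>pou_index. F c d y) = pou d (chart_inv d y) * \<omega> d y std_frame"
      using pou_sum by (simp add: F_def flip: sum_distrib_right)
  qed
  finally show ?thesis .
qed

text \<open>Each member of the partition of unity cuts a piece out of \<open>\<omega>\<close> that is supported in two charts at once; move it to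
  \<open>c\<close> and add up there.\<close>
lemma form_integral_single_chart:
  assumes \<omega>: "\<omega> \<in> diff_forms A 5" and c: "c \<in> A" and K: "compact K" "K \<subseteq> fst c"
    and supp: "\<And>d x. d \<in> A \<Longrightarrow> x \<in> chart_image d \<Longrightarrow> chart_inv d x \<notin> K \<Longrightarrow> \<omega> d x std_frame = 0"
  shows "form_integral M A \<omega> = integral (chart_image c) (\<lambda>x. \<omega> c x std_frame)"
proof -
  define F where "F d y = pou d (chart_inv d y) * \<omega> d y std_frame" for d y
  define G where "G d x = pou d (chart_inv c x) * \<omega> c x std_frame" for d x
  have cov: "G d integrable_on chart_image c" "integral (chart_image c) (G d) = integral (chart_image d) (F d)"
    if di: "d \<in> pou_index" for d
  proof -
    note d = pou_index_subset[OF di]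
    let ?K = "K \<inter> pou_support d"
    have comp: "compact ?K" by (intro compact_Int K compact_pou_support)
    have K_sub: "?K \<subseteq> {p \<in> fst c. id p \<in> fst d}" using K pou_support_subset[OF di] by auto
    have F_cont: "continuous_on (chart_image d) (F d)"
      unfolding F_def by (intro continuous_on_mult continuous_pou_chart continuous_5_form \<omega> di d)
    have F_supp: "chart_inv d y \<in> id ` ?K" if "y \<in> chart_image d" "F d y \<noteq> 0" for y
      using that supp[OF d that(1)] pou_supportI[OF chart_inv_in_M[OF d that(1)], of d]
      by (auto simp: F_def)
    have G1: "G d x = det (matrix (local_deriv c d id x)) * F d (local_rep c d id x)" if x: "x \<in> local_dom c d id" for x
      using diff_forms_compat[OF \<omega> c d x] pullback_std_frame[OF smooth_map_id \<omega> c d x]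
        chart_inv_local_rep[OF c d x] by (simp add: F_def G_def)
    have G2: "G d x = 0" if "x \<in> chart_image c" "x \<notin> local_dom c d id" for x
      using that pou_outside_chart[OF di chart_inv_in_M[OF c], of x]
      by (simp add: G_def local_dom_iff[OF c])
    from integral_change_of_charts[OF smooth_map_id inj_on_id c d det_id_pos[OF c d] comp K_sub F_cont F_supp G1 G2]
    show "G d integrable_on chart_image c" "integral (chart_image c) (G d) = integral (chart_image d) (F d)" by blast+
  qed
  have "form_integral M A \<omega> = (\<Sum>d\<in>pou_index. integral (chart_image d) (F d))"
    unfolding form_integral_pou F_def ..
  also have "\<dots> = (\<Sum>d\<in>pou_index. integral (chart_image c) (G d))"
    by (intro sum.cong refl cov(2)[symmetric])
  also have "\<dots> = integral (chart_image c) (\<lambda>x. \<Sum>d\<in>pou_index. G d x)"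
    by (intro integral_sum[symmetric] finite_pou_index cov(1))
  also have "\<dots> = integral (chart_image c) (\<lambda>x. \<omega> c x std_frame)"
  proof (rule integral_cong)
    fix x assume "x \<in> chart_image c"
    then show "(\<Sum>d\<in>pou_index. G d x) = \<omega> c x std_frame"
      using pou_sum[OF chart_inv_in_M[OF c]] by (simp add: G_def flip: sum_distrib_right)
  qed
  finally show ?thesis .
qed

text \<open>The part of \<open>\<tau>\<close> that a member of the partition of unity cuts out has its support in one chart, where
  Stokes' theorem for compactly supported forms applies.\<close>
proposition stokes_closed_wedge_exact:
  assumes \<alpha>: "\<alpha> \<in> diff_forms A 2" and \<tau>: "\<tau> \<in> diff_forms A 2"
    and closed: "\<And>c x v. ext_deriv A 2 \<alpha> c x v = 0"
  shows "form_integral M A (wedge 2 3 \<alpha> (ext_deriv A 2 \<tau>)) = 0"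
proof -
  define \<beta> where "\<beta> i = (\<lambda>c x v. pou i (chart_inv c x) * \<tau> c x v)" for i
  define \<omega> where "\<omega> i = wedge 2 3 \<alpha> (ext_deriv A 2 (\<beta> i))" for i
  have \<beta>: "\<beta> i \<in> diff_forms A 2" if "i \<in> pou_index" for i
    unfolding \<beta>_def by (rule function_multiple_in_diff_forms[OF smooth_pou[OF that] \<tau>])
  have \<omega>: "\<omega> i \<in> diff_forms A 5" if "i \<in> pou_index" for i
    using wedge_in_diff_forms[OF \<alpha> ext_deriv_in_diff_forms[OF \<beta>[OF that]]] by (simp add: \<omega>_def)
  have closed': "local_d 2 (\<alpha> c) x v = 0" if "c \<in> A" "x \<in> chart_image c" for c x v
    using closed[of c x v] that by (simp add: ext_deriv_eq_local_d)
  have zero: "form_integral M A (\<omega> i) = 0" if i: "i \<in> pou_index" for i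
  proof -
    note iA = pou_index_subset[OF i]
    have \<beta>0: "\<beta> i d x v = 0" if "d \<in> A" "x \<in> chart_image d" "chart_inv d x \<notin> pou_support i" for d x v
    proof -
      have "pou i (chart_inv d x) = 0"
        using pou_supportI[OF chart_inv_in_M[OF that(1,2)], of i] that(3) by blast
      then show ?thesis by (simp add: \<beta>_def)
    qed
    have "\<omega> i d x std_frame = 0" if d: "d \<in> A" and x: "x \<in> chart_image d" "chart_inv d x \<notin> pou_support i" for d x
    proof -
      let ?T = "{y \<in> chart_image d. chart_inv d y \<notin> pou_support i}"
      have T: "open ?T" by (rule open_chart_minus_compact[OF d compact_pou_support])
      have xT: "x \<in> ?T" using x by simp
      have "local_d 2 (\<beta> i d) x v = local_d 2 (\<lambda>_ _. 0) x v" for v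
        by (rule local_d_cong[OF T xT]) (use \<beta>0[OF d] in simp)
      then have "ext_deriv A 2 (\<beta> i) d x v = 0" for v
        by (simp add: ext_deriv_eq_local_d local_d_def)
      then show ?thesis by (simp add: \<omega>_def wedge_def)
    qed
    then have "form_integral M A (\<omega> i) = integral (chart_image i) (\<lambda>x. \<omega> i i x std_frame)"
      by (rule form_integral_single_chart[OF \<omega>[OF i] iA compact_pou_support pou_support_subset[OF i]])
    also have "\<dots> = integral (chart_image i)
        (\<lambda>x. alternation 5 (\<lambda>u. \<alpha> i x u * local_d 2 (\<beta> i i) x (\<lambda>j. u (2 + j))) std_frame / (fact 2 * fact 3))"
    proof (rule integral_cong)
      fix x assume "x \<in> chart_image i"
      then have "ext_deriv A 2 (\<beta> i) i x = local_d 2 (\<beta> i i) x"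
        by (intro ext) (simp add: ext_deriv_eq_local_d iA)
      then show "\<omega> i i x std_frame
          = alternation 5 (\<lambda>u. \<alpha> i x u * local_d 2 (\<beta> i i) x (\<lambda>j. u (2 + j))) std_frame / (fact 2 * fact 3)"
        unfolding \<omega>_def wedge_eq_alternation by simp
    qed
    also have "\<dots> = 0"
    proof -
      have "integral (chart_image i)
          (\<lambda>x. alternation 5 (\<lambda>u. \<alpha> i x u * local_d 2 (\<beta> i i) x (\<lambda>j. u (2 + j))) std_frame) = 0"
      proof (rule local_stokes[OF forms_local[OF \<alpha> iA] forms_local[OF \<beta>[OF i] iA] closed'[OF iA]])
        show "compact (snd i ` pou_support i)" "snd i ` pou_support i \<subseteq> chart_image i"
          using i by (rule compact_chart_pou_support, rule chart_pou_support_subset)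
        show "\<beta> i i x v = 0" if "x \<in> chart_image i - snd i ` pou_support i" for x v
          using \<beta>0[OF iA] that snd_chart_inv[OF iA, of x] by force
      qed
      then show ?thesis by simp
    qed
    finally show ?thesis .
  qed
  have "form_integral M A (wedge 2 3 \<alpha> (ext_deriv A 2 \<tau>)) = form_integral M A (\<lambda>c x v. \<Sum>i\<in>pou_index. 1 * \<omega> i c x v)"
  proof (rule form_integral_cong)
    fix c x assume c: "c \<in> A" and x: "x \<in> chart_image c"
    have "local_d 2 (\<tau> c) x v = (\<Sum>i\<in>pou_index. local_d 2 (\<beta> i c) x v)" for v
    proof -
      have "fd (\<lambda>y. \<tau> c y u) x z = (\<Sum>i\<in>pou_index. fd (\<lambda>y. \<beta> i c y u) x z)" for u z
      proof -
        have 1: "fd (\<lambda>y. \<tau> c y u) x = fd (\<lambda>y. \<Sum>i\<in>pou_index. \<beta> i c y u) x"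
          by (rule fd_cong_open[OF open_chart_image[OF c] x])
             (use pou_sum[OF chart_inv_in_M[OF c]] in \<open>simp add: \<beta>_def flip: sum_distrib_right\<close>)
        have 2: "((\<lambda>y. \<Sum>i\<in>pou_index. \<beta> i c y u) has_derivative
            (\<lambda>z. \<Sum>i\<in>pou_index. fd (\<lambda>y. \<beta> i c y u) x z)) (at x)"
          by (intro has_derivative_sum local_formD(4)[OF forms_local[OF \<beta> c] x])
        show ?thesis unfolding 1 fd_eq[OF 2] ..
      qed
      then show ?thesis
        unfolding local_d_def by (simp add: sum_distrib_left) (rule sum.swap)
    qed
    then have "ext_deriv A 2 \<tau> c x v = (\<Sum>i\<in>pou_index. ext_deriv A 2 (\<beta> i) c x v)" for v
      using c x by (simp add: ext_deriv_eq_local_d)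
    then show "wedge 2 3 \<alpha> (ext_deriv A 2 \<tau>) c x std_frame = (\<Sum>i\<in>pou_index. 1 * \<omega> i c x std_frame)"
      by (simp only: \<omega>_def wedge_eq_alternation mult_1 sum_distrib_left alternation_sum flip: sum_divide_distrib)
  qed
  also have "\<dots> = 0"
    by (subst form_integral_sum) (auto simp: finite_pou_index \<omega> zero)
  finally show ?thesis .
qed

section \<open>The moment map\<close>

lemma exact_3_formsE:
  assumes "\<phi> \<in> exact_3_forms A"
  obtains \<sigma> where "\<sigma> \<in> diff_forms A 2" "\<phi> = ext_deriv A 2 \<sigma>"
  using assms by (auto simp: exact_3_forms_def)

lemma exact_in_diff_forms: "\<phi> \<in> exact_3_forms A \<Longrightarrow> \<phi> \<in> diff_forms A 3"
  by (elim exact_3_formsE) (simp add: ext_deriv_in_diff_forms)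

lemma pullback_exact:
  assumes "f \<in> oriented_diffeos M A" "\<phi> \<in> exact_3_forms A"
  shows "pullback_form A f \<phi> \<in> exact_3_forms A"
proof -
  have f: "smooth_map M A f" using assms(1) by (simp add: oriented_diffeos_def)
  obtain \<sigma> where \<sigma>: "\<sigma> \<in> diff_forms A 2" "\<phi> = ext_deriv A 2 \<sigma>" using assms(2) by (rule exact_3_formsE)
  then show ?thesis
    using ext_deriv_pullback[OF f \<sigma>(1), symmetric] pullback_form_in_diff_forms[OF f \<sigma>(1)]
    by (simp add: exact_3_forms_def)
qed

lemma moment_equivariant:
  assumes "f \<in> oriented_diffeos M A" "\<phi> \<in> exact_3_forms A" "w \<in> vector_fields A"
  shows "moment M A (pullback_form A f \<phi>) (pullback_vfield A f w) = moment M A \<phi> w"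
  using form_star_pullback[OF assms(1,3) exact_in_diff_forms[OF assms(2)]]
    form_integral_pullback[OF assms(1) form_star_in_diff_forms[OF assms(3) exact_in_diff_forms[OF assms(2)]]]
  by (simp add: moment_def)

lemma lie_deriv_exact_form:
  assumes w: "w \<in> vector_fields A" and \<phi>: "\<phi> \<in> exact_3_forms A"
  shows "lie_deriv A 3 w \<phi> = ext_deriv A 2 (interior_product w \<phi>)"
  using \<phi>
proof (rule exact_3_formsE)
  fix \<sigma> assume \<sigma>: "\<sigma> \<in> diff_forms A 2" "\<phi> = ext_deriv A 2 \<sigma>"
  show ?thesis
    by (rule lie_deriv_closed[OF w exact_in_diff_forms[OF \<phi>]]) (simp add: \<sigma> ext_deriv_closed)
qed

lemma lie_deriv_exact:
  assumes "w \<in> vector_fields A" "\<phi> \<in> exact_3_forms A"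
  shows "lie_deriv A 3 w \<phi> \<in> exact_3_forms A"
  using lie_deriv_exact_form[OF assms] interior_product_3[OF assms(1) exact_in_diff_forms[OF assms(2)]]
  by (auto simp: exact_3_forms_def)

text \<open>Two primitives differ by a closed form, whose wedge product with an exact form has integral 0.\<close>
lemma symplectic_pairing_eq:
  assumes \<sigma>: "\<sigma> \<in> diff_forms A 2" and \<delta>: "\<delta> \<in> exact_3_forms A"
  shows "symplectic_pairing M A (ext_deriv A 2 \<sigma>) \<delta> = form_integral M A (wedge 2 3 \<sigma> \<delta>)"
proof -
  define \<sigma>' where "\<sigma>' = (SOME \<sigma>'. \<sigma>' \<in> diff_forms A 2 \<and> ext_deriv A 2 \<sigma> = ext_deriv A 2 \<sigma>')"
  have "\<exists>\<sigma>'. \<sigma>' \<in> diff_forms A 2 \<and> ext_deriv A 2 \<sigma> = ext_deriv A 2 \<sigma>'" using \<sigma> by blast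
  from someI_ex[OF this, folded \<sigma>'_def]
  have \<sigma>': "\<sigma>' \<in> diff_forms A 2" "ext_deriv A 2 \<sigma> = ext_deriv A 2 \<sigma>'" by blast+
  obtain \<tau> where \<tau>: "\<tau> \<in> diff_forms A 2" "\<delta> = ext_deriv A 2 \<tau>" using \<delta> by (rule exact_3_formsE)
  define \<alpha> where "\<alpha> = (\<lambda>c x v. \<sigma>' c x v - \<sigma> c x v)"
  have "\<alpha> \<in> diff_forms A 2" unfolding \<alpha>_def by (rule diff_in_diff_forms[OF \<sigma>'(1) \<sigma>])
  moreover have "ext_deriv A 2 \<alpha> c x v = 0" for c x v
    unfolding \<alpha>_def ext_deriv_diff[OF \<sigma>'(1) \<sigma>] by (simp add: \<sigma>'(2))
  ultimately have zero: "form_integral M A (wedge 2 3 \<alpha> \<delta>) = 0"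
    using stokes_closed_wedge_exact[OF _ \<tau>(1)] \<tau>(2) by simp
  have w5: "wedge 2 3 \<sigma> \<delta> \<in> diff_forms A 5" "wedge 2 3 \<alpha> \<delta> \<in> diff_forms A 5"
    using wedge_in_diff_forms[OF \<sigma> exact_in_diff_forms[OF \<delta>]]
      wedge_in_diff_forms[OF \<open>\<alpha> \<in> diff_forms A 2\<close> exact_in_diff_forms[OF \<delta>]] by simp_all
  \<comment> \<open>\<open>\<sigma>' = \<sigma> + \<alpha>\<close>; the sum over the Booleans puts this in the form that linearity of the integral expects.\<close>
  have "wedge 2 3 \<sigma>' \<delta> = (\<lambda>c x v. \<Sum>b\<in>UNIV. 1 * (if b then wedge 2 3 \<sigma> \<delta> else wedge 2 3 \<alpha> \<delta>) c x v)"
    by (intro ext) (simp add: UNIV_bool wedge_eq_alternation \<alpha>_def left_diff_distrib alternation_diff diff_divide_distrib)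
  then have "form_integral M A (wedge 2 3 \<sigma>' \<delta>) = form_integral M A (wedge 2 3 \<sigma> \<delta>)"
    using form_integral_sum[of "UNIV :: bool set" "\<lambda>b. if b then wedge 2 3 \<sigma> \<delta> else wedge 2 3 \<alpha> \<delta>" "\<lambda>_. 1"] w5 zero
    by (simp add: UNIV_bool)
  then show ?thesis by (simp add: symplectic_pairing_def Let_def \<sigma>'_def)
qed

text \<open>Both mixed terms of the quadratic map \<open>\<phi> \<mapsto> \<phi> \<and> i\<^sub>w\<phi>\<close> are \<open>i\<^sub>w\<phi> \<and> \<delta>\<close>, which compensates for the factor
  1/2 of the moment.\<close>
lemma moment_quadratic:
  assumes w: "w \<in> vector_fields A" and \<phi>: "\<phi> \<in> diff_forms A 3" and \<delta>: "\<delta> \<in> diff_forms A 3"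
  shows "moment M A (\<lambda>c x v. \<phi> c x v + t * \<delta> c x v) w
    = moment M A \<phi> w + t * form_integral M A (wedge 2 3 (interior_product w \<phi>) \<delta>) + t\<^sup>2 * moment M A \<delta> w"
proof -
  let ?\<eta> = "wedge 2 3 (interior_product w \<phi>) \<delta>"
  define \<omega> where "\<omega> i = (if i = 0 then form_star \<phi> w else if i = 1 then ?\<eta> else form_star \<delta> w)" for i :: nat
  define a where "a i = (if i = 0 then 1 else if i = 1 then 2 * t else t\<^sup>2)" for i :: nat
  have \<eta>: "?\<eta> \<in> diff_forms A 5"
    using wedge_in_diff_forms[OF interior_product_3[OF w \<phi>] \<delta>] by simp
  have \<omega>: "\<omega> i \<in> diff_forms A 5" for i
    using form_star_in_diff_forms[OF w] \<phi> \<delta> \<eta> by (simp add: \<omega>_def)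
  have "form_integral M A (form_star (\<lambda>c x v. \<phi> c x v + t * \<delta> c x v) w)
      = form_integral M A (\<lambda>c x v. \<Sum>i<3. a i * \<omega> i c x v)"
  proof (rule form_integral_cong)
    fix c x assume c: "c \<in> A" and x: "x \<in> chart_image c"
    have "form_star (\<lambda>c x v. \<phi> c x v + t * \<delta> c x v) w c x std_frame
        = form_star \<phi> w c x std_frame + t * wedge 3 2 \<phi> (interior_product w \<delta>) c x std_frame
          + t * wedge 3 2 \<delta> (interior_product w \<phi>) c x std_frame + t\<^sup>2 * form_star \<delta> w c x std_frame"
    proof -
      define p q P Q where "p u = \<phi> c x u" and "q u = \<delta> c x u"
        and "P u = \<phi> c x (case_nat (w c x) (\<lambda>i. u (3 + i)))"
        and "Q u = \<delta> c x (case_nat (w c x) (\<lambda>i. u (3 + i)))" for u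
      have "alternation 5 (\<lambda>u. (p u + t * q u) * (P u + t * Q u)) std_frame
          = alternation 5 (\<lambda>u. p u * P u + (t * (p u * Q u) + (t * (q u * P u) + t\<^sup>2 * (q u * Q u)))) std_frame"
        by (rule alternation_cong) (simp add: algebra_simps power2_eq_square)
      also have "\<dots> = alternation 5 (\<lambda>u. p u * P u) std_frame + (t * alternation 5 (\<lambda>u. p u * Q u) std_frame
          + (t * alternation 5 (\<lambda>u. q u * P u) std_frame + t\<^sup>2 * alternation 5 (\<lambda>u. q u * Q u) std_frame))"
        by (simp only: alternation_add alternation_cmult)
      finally show ?thesis
        unfolding form_star_def wedge_eq_alternation interior_product_def p_def q_def P_def Q_def
        by (simp add: add_divide_distrib)
    qed
    then show "form_star (\<lambda>c x v. \<phi> c x v + t * \<delta> c x v) w c x std_frame = (\<Sum>i<3. a i * \<omega> i c x std_frame)"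
      using wedge_interior_product[where \<phi>=\<phi> and \<delta>=\<delta> and w=w, OF local_formD(2)[OF forms_local[OF \<phi> c] x]
          local_formD(2)[OF forms_local[OF \<delta> c] x]]
      by (simp add: numeral_3_eq_3 numeral_2_eq_2 a_def \<omega>_def)
  qed
  also have "\<dots> = (\<Sum>i<3. a i * form_integral M A (\<omega> i))"
    by (rule form_integral_sum) (simp_all add: \<omega>)
  finally show ?thesis by (simp add: moment_def numeral_3_eq_3 a_def \<omega>_def algebra_simps)
qed

lemma moment_has_derivative:
  assumes w: "w \<in> vector_fields A" and \<phi>: "\<phi> \<in> exact_3_forms A" and \<delta>: "\<delta> \<in> exact_3_forms A"
  shows "((\<lambda>t. moment M A (\<lambda>c x v. \<phi> c x v + t * \<delta> c x v) w)
    has_real_derivative symplectic_pairing M A (lie_deriv A 3 w \<phi>) \<delta>) (at 0)"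
proof -
  note \<phi>3 = exact_in_diff_forms[OF \<phi>] and \<delta>3 = exact_in_diff_forms[OF \<delta>]
  have "symplectic_pairing M A (lie_deriv A 3 w \<phi>) \<delta> = form_integral M A (wedge 2 3 (interior_product w \<phi>) \<delta>)"
    unfolding lie_deriv_exact_form[OF w \<phi>] by (rule symplectic_pairing_eq[OF interior_product_3[OF w \<phi>3] \<delta>])
  then show ?thesis
    unfolding moment_quadratic[OF w \<phi>3 \<delta>3] by (auto intro!: derivative_eq_intros)
qed

end

theorem proposition5:
  fixes M :: "'m::t2_space set" and A :: "'m chart set"
  assumes "compact_oriented_5_manifold M A"
  shows "(\<forall>f\<in>oriented_diffeos M A. \<forall>\<phi>\<in>exact_3_forms A.
            pullback_form A f \<phi> \<in> exact_3_forms A \<and>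
            (\<forall>w\<in>vector_fields A.
               moment M A (pullback_form A f \<phi>) (pullback_vfield A f w) = moment M A \<phi> w)) \<and>
         (\<forall>w\<in>vector_fields A. \<forall>\<phi>\<in>exact_3_forms A.
            lie_deriv A 3 w \<phi> \<in> exact_3_forms A \<and>
            (\<forall>\<delta>\<in>exact_3_forms A.
               ((\<lambda>t. moment M A (\<lambda>c x v. \<phi> c x v + t * \<delta> c x v) w)
                  has_real_derivative symplectic_pairing M A (lie_deriv A 3 w \<phi>) \<delta>) (at 0)))"
proof -
  interpret closed_5_manifold M A by (rule closed_5_manifold.intro) (rule assms)
  show ?thesis
    using pullback_exact moment_equivariant lie_deriv_exact moment_has_derivative by blast
qed

end
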